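(* For each weight $\mu=t_{j\alpha_1}(\Lambda_0)-d\delta$ ($j\in\mathbb{Z}$, $d\in\mathbb{Z}_{\ge0}$) of $L(\Lambda_0)$, and each even integer $n\ge2(d+|j|)$, put $\mathfrak{P}_\mu(n)=\{(n,k,\lambda)\in\mathfrak{P}(n):k-\tfrac n2=j,\ |\lambda|=d\}$ and $\mathcal{B}_\mu=\{\mathfrak{c}(\xi):\xi\in\mathfrak{P}_\mu(n)\}$. Then $\mathcal{B}_\mu$ is independent of the choice of the even integer $n\ge2(d+|j|)$ and is a basis of the weight space $L(\Lambda_0)_\mu$. Consequently the disjoint union $\mathcal{B}=\bigsqcup_\mu\mathcal{B}_\mu$ over all weights $\mu$ of $L(\Lambda_0)$ is a basis of $L(\Lambda_0)$.
   Context: Affine Lie algebra. $\mathfrak{sl}_2$ is the complex Lie algebra of trace-zero $2\times2$ matrices with standard basis $x=\begin{pmatrix}0&1\\0&0\end{pmatrix}$, $h=\begin{pmatrix}1&0\\0&-1\end{pmatrix}$, $y=\begin{pmatrix}0&0\\1&0\end{pmatrix}$ and form $(A,B)=\mathrm{trace}(AB)$. $\widehat{\mathfrak{sl}_2}=\mathfrak{sl}_2\otimes\mathbb{C}[t,t^{-1}]\oplus\mathbb{C}c\oplus\mathbb{C}d$, where $At^m$ means $A\otimes t^m$, $c$ is central, $[At^m,Bt^n]=[A,B]t^{m+n}+m\,\delta_{m,-n}(A,B)c$ and $[d,At^m]=mAt^m$. The Cartan subalgebra is $\widehat{\mathfrak h}=\mathbb{C}h\oplus\mathbb{C}c\oplus\mathbb{C}d$.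 Chevalley generators: $e_1=x$, $f_1=y$, $e_0=yt$, $f_0=xt^{-1}$; simple coroots $\alpha_1^\vee=h$, $\alpha_0^\vee=c-h$. The simple root $\alpha_1\in\widehat{\mathfrak h}^*$ takes values $2,0,0$ on $h,c,d$; $\delta$ takes values $0,0,1$; $\Lambda_0$ takes values $0,1,0$. $L(\Lambda_0)$ is the irreducible highest weight $\widehat{\mathfrak{sl}_2}$-module with highest weight $\Lambda_0$ and highest weight vector $v_{\Lambda_0}$; $L(\Lambda_0)_\mu$ denotes its $\mu$-weight space. One has $t_{j\alpha_1}(\Lambda_0)=\Lambda_0+j\alpha_1-j^2\delta$, and the set of weights of $L(\Lambda_0)$ is $\{t_{j\alpha_1}(\Lambda_0)-d\delta: j\in\mathbb{Z},d\in\mathbb{Z}_{\ge0}\}$ (distinct pairs $(j,d)$ giving distinct weights). Divided powers: $X^{(p)}=X^p/p!$. For even $n\ge0$, $w_n=(xt^{-n/2})^{(n/2)}v_{\Lambda_0}\in L(\Lambda_0)$. A partition $\lambda=(\lambda_1\ge\lambda_2\ge\cdots)$ is a weakly decreasing sequence of non-negative integers, eventually zero; $|\lambda|=\sum_i\lambda_i$; $\mathrm{supp}\,\lambda$ is the number of non-zero parts. $\mathfrak{P}(n)$ is the set of triples $(n,k,\lambda)$ with $k$ an integer, $0\le k\le n$, and $\lambda$ a partition with $\lambda_1\le k$ and $\mathrm{supp}\,\lambda\le n-k$. For $n$ even and $\xi=(n,k,\lambda)\in\mathfrak{P}(n)$ define $$\mathfrak{c}(\xi)=z(\xi)\Big(\prod_{i=1}^{n-k}yt^{k-\lambda_i}\Big)w_n\in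 L(\Lambda_0),\qquad z(\xi)=\frac{(-1)^{[n/4]-[(n-k)/2]}}{\prod_{j=0}^k m_j!},$$ where $[\cdot]$ is the floor function, $m_j=\#\{i:\lambda_i=j\}$ for $j\ge1$, and $m_0=n-k-\mathrm{supp}\,\lambda$. *)

theory Defs
  imports "HOL-Analysis.Analysis" "HOL-Library.Poly_Mapping"
begin

section \<open>The affine Lie algebra\<close>

type_synonym mat2 = "complex ^ 2 ^ 2"

text \<open>
  A triple \<open>(X, u, w)\<close> stands for the sum of all \<open>X\<^sub>m t\<^sup>m\<close>, of \<open>u c\<close> and of \<open>w d\<close>, where \<open>X\<^sub>m\<close> is
  \<open>Poly_Mapping.lookup X m\<close>.  The type also contains loops in matrices of non-zero trace; the
  carrier \<open>affine_sl2\<close> excludes them.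
\<close>
type_synonym affine = "(int \<Rightarrow>\<^sub>0 mat2) \<times> complex \<times> complex"

definition sl2_x :: mat2 where "sl2_x = vector [vector [0, 1], vector [0, 0]]"
definition sl2_h :: mat2 where "sl2_h = vector [vector [1, 0], vector [0, -1]]"
definition sl2_y :: mat2 where "sl2_y = vector [vector [0, 0], vector [1, 0]]"

definition mat_scale :: "complex \<Rightarrow> mat2 \<Rightarrow> mat2" where
  "mat_scale a A = (\<chi> i j. a * A $ i $ j)"

definition mat_bracket :: "mat2 \<Rightarrow> mat2 \<Rightarrow> mat2" where
  "mat_bracket A B = A ** B - B ** A"

definition affine_sl2 :: "affine set" where
  "affine_sl2 = {(X, u, w). \<forall>m. trace (Poly_Mapping.lookup X m) = 0}"

definition affine_scale :: "complex \<Rightarrow> affine \<Rightarrow> affine" where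
  "affine_scale a = (\<lambda>(X, u, w). (Poly_Mapping.map (mat_scale a) X, a * u, a * w))"

definition loop_deriv :: "(int \<Rightarrow>\<^sub>0 mat2) \<Rightarrow> (int \<Rightarrow>\<^sub>0 mat2)" where
  "loop_deriv X = (\<Sum>m\<in>Poly_Mapping.keys X.
     Poly_Mapping.single m (mat_scale (of_int m) (Poly_Mapping.lookup X m)))"

text \<open>
  The bilinear antisymmetric extension of the defining relations; see \<open>affine_bracket_loop\<close>,
  \<open>affine_bracket_c\<close> and \<open>affine_bracket_d\<close> below.
\<close>
definition affine_bracket :: "affine \<Rightarrow> affine \<Rightarrow> affine" where
  "affine_bracket = (\<lambda>(X, u, w) (X', u', w').
     ((\<Sum>m\<in>Poly_Mapping.keys X. \<Sum>n\<in>Poly_Mapping.keys X'.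
          Poly_Mapping.single (m + n)
            (mat_bracket (Poly_Mapping.lookup X m) (Poly_Mapping.lookup X' n)))
        + Poly_Mapping.map (mat_scale w) (loop_deriv X')
        - Poly_Mapping.map (mat_scale w') (loop_deriv X),
      (\<Sum>m\<in>Poly_Mapping.keys X.
          of_int m * trace (Poly_Mapping.lookup X m ** Poly_Mapping.lookup X' (- m))),
      0))"

definition loop :: "mat2 \<Rightarrow> int \<Rightarrow> affine" where
  "loop A m = (Poly_Mapping.single m A, 0, 0)"

definition central_c :: affine where "central_c = (0, 1, 0)"
definition deriv_d :: affine where "deriv_d = (0, 0, 1)"

definition e1 :: affine where "e1 = loop sl2_x 0"
definition e0 :: affine where "e0 = loop sl2_y 1"


section \<open>The Cartan subalgebra and its dual\<close>

text \<open>A triple \<open>(a, b, e)\<close> stands for \<open>a h + b c + e d\<close>; a weight is a functional of such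
  triples.  The type does not impose linearity, but a functional with a non-zero weight space in a
  module is automatically linear.\<close>
type_synonym cartan = "complex \<times> complex \<times> complex"
type_synonym weight = "cartan \<Rightarrow> complex"

definition of_cartan :: "cartan \<Rightarrow> affine" where
  "of_cartan = (\<lambda>(a, b, e).
     affine_scale a (loop sl2_h 0) + affine_scale b central_c + affine_scale e deriv_d)"

definition alpha1 :: weight where "alpha1 = (\<lambda>(a, b, e). 2 * a)"
definition Lambda0 :: weight where "Lambda0 = (\<lambda>(a, b, e). b)"
definition delta :: weight where "delta = (\<lambda>(a, b, e). e)"

text \<open>The value at \<open>Lambda0\<close> of the translation by \<open>j alpha1\<close>.\<close>
definition transl_Lambda0 :: "int \<Rightarrow> weight" where
  "transl_Lambda0 j = (\<lambda>H. Lambda0 H + of_int j * alpha1 H - of_int (j\<^sup>2) * delta H)"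

definition wt :: "int \<Rightarrow> nat \<Rightarrow> weight" where
  "wt j d = (\<lambda>H. transl_Lambda0 j H - of_nat d * delta H)"


section \<open>Modules\<close>

locale affine_module = vector_space scl
  for scl :: "complex \<Rightarrow> 'v::ab_group_add \<Rightarrow> 'v" +
  fixes act :: "affine \<Rightarrow> 'v \<Rightarrow> 'v"
  assumes act_linear: "X \<in> affine_sl2 \<Longrightarrow> Vector_Spaces.linear scl scl (act X)"
    and act_add: "X \<in> affine_sl2 \<Longrightarrow> Y \<in> affine_sl2 \<Longrightarrow> act (X + Y) u = act X u + act Y u"
    and act_scale: "X \<in> affine_sl2 \<Longrightarrow> act (affine_scale a X) u = scl a (act X u)"
    and act_bracket: "X \<in> affine_sl2 \<Longrightarrow> Y \<in> affine_sl2 \<Longrightarrow>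
      act (affine_bracket X Y) u = act X (act Y u) - act Y (act X u)"

definition submodule ::
  "(complex \<Rightarrow> 'v::ab_group_add \<Rightarrow> 'v) \<Rightarrow> (affine \<Rightarrow> 'v \<Rightarrow> 'v) \<Rightarrow> 'v set \<Rightarrow> bool" where
  "submodule scl act W \<longleftrightarrow>
     module.subspace scl W \<and> (\<forall>X\<in>affine_sl2. \<forall>u\<in>W. act X u \<in> W)"

definition weight_space ::
  "(complex \<Rightarrow> 'v \<Rightarrow> 'v) \<Rightarrow> (affine \<Rightarrow> 'v \<Rightarrow> 'v) \<Rightarrow> weight \<Rightarrow> 'v set" where
  "weight_space scl act \<mu> = {u. \<forall>H. act (of_cartan H) u = scl (\<mu> H) u}"

definition weights ::
  "(complex \<Rightarrow> 'v::ab_group_add \<Rightarrow> 'v) \<Rightarrow> (affine \<Rightarrow> 'v \<Rightarrow> 'v) \<Rightarrow> weight set" where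
  "weights scl act = {\<mu>. weight_space scl act \<mu> \<noteq> {0}}"

text \<open>
  The module \<open>L(\<Lambda>)\<close> is determined up to isomorphism by this predicate; \<open>v\<close> is its highest weight
  vector.  Annihilation by \<open>e0\<close> and \<open>e1\<close> is annihilation by the positive part, which they generate.
\<close>
locale irreducible_highest_weight_module = affine_module scl act
  for scl :: "complex \<Rightarrow> 'v::ab_group_add \<Rightarrow> 'v" and act :: "affine \<Rightarrow> 'v \<Rightarrow> 'v" +
  fixes \<Lambda> :: weight and v :: 'v
  assumes hw_nonzero: "v \<noteq> 0"
    and hw_weight: "v \<in> weight_space scl act \<Lambda>"
    and hw_e0: "act e0 v = 0"
    and hw_e1: "act e1 v = 0"
    and hw_generates: "submodule scl act W \<Longrightarrow> v \<in> W \<Longrightarrow> W = UNIV"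
    and irreducible: "submodule scl act W \<Longrightarrow> W = {0} \<or> W = UNIV"

definition is_basis ::
  "(complex \<Rightarrow> 'v::ab_group_add \<Rightarrow> 'v) \<Rightarrow> 'v set \<Rightarrow> 'v set \<Rightarrow> bool" where
  "is_basis scl B W \<longleftrightarrow> \<not> module.dependent scl B \<and> module.span scl B = W"


section \<open>Partitions and the vectors attached to them\<close>

text \<open>The part \<open>\<lambda>\<^sub>i\<close>, \<open>i \<ge> 1\<close>, of a partition is \<open>lam (i - 1)\<close>.\<close>

definition is_partition :: "(nat \<Rightarrow> nat) \<Rightarrow> bool" where
  "is_partition lam \<longleftrightarrow> antimono lam \<and> finite {i. lam i \<noteq> 0}"

definition psize :: "(nat \<Rightarrow> nat) \<Rightarrow> nat" where
  "psize lam = (\<Sum>i | lam i \<noteq> 0. lam i)"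

definition psupp :: "(nat \<Rightarrow> nat) \<Rightarrow> nat" where
  "psupp lam = card {i. lam i \<noteq> 0}"

type_synonym pop = "nat \<times> nat \<times> (nat \<Rightarrow> nat)"

definition PP :: "nat \<Rightarrow> pop set" where
  "PP n = {(n, k, lam) | k lam. k \<le> n \<and> is_partition lam \<and> lam 0 \<le> k \<and> psupp lam \<le> n - k}"

text \<open>The pair \<open>(j, d)\<close> is unique, as \<open>wt\<close> is injective (\<open>wt_inject\<close> below).\<close>
definition PP_wt :: "weight \<Rightarrow> nat \<Rightarrow> pop set" where
  "PP_wt \<mu> n = {(n', k, lam) \<in> PP n.
     \<exists>j d. \<mu> = wt j d \<and> of_nat k - of_nat n / 2 = (of_int j :: rat) \<and> psize lam = d}"

definition mult_part :: "pop \<Rightarrow> nat \<Rightarrow> nat" where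
  "mult_part = (\<lambda>(n, k, lam) j. if j = 0 then n - k - psupp lam else card {i. lam i = j})"

definition zcoef :: "pop \<Rightarrow> complex" where
  "zcoef = (\<lambda>(n, k, lam).
     (- 1) powi (int (n div 4) - int ((n - k) div 2))
       / (\<Prod>j = 0..k. fact (mult_part (n, k, lam) j)))"

definition divided_power ::
  "(complex \<Rightarrow> 'v \<Rightarrow> 'v) \<Rightarrow> ('v \<Rightarrow> 'v) \<Rightarrow> nat \<Rightarrow> 'v \<Rightarrow> 'v" where
  "divided_power scl T p u = scl (1 / fact p) ((T ^^ p) u)"

text \<open>To be used for even \<open>n\<close> only, as is \<open>cvec\<close>.\<close>
definition wvec ::
  "(complex \<Rightarrow> 'v \<Rightarrow> 'v) \<Rightarrow> (affine \<Rightarrow> 'v \<Rightarrow> 'v) \<Rightarrow> 'v \<Rightarrow> nat \<Rightarrow> 'v" where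
  "wvec scl act v n =
     divided_power scl (act (loop sl2_x (- int (n div 2)))) (n div 2) v"

definition cvec ::
  "(complex \<Rightarrow> 'v \<Rightarrow> 'v) \<Rightarrow> (affine \<Rightarrow> 'v \<Rightarrow> 'v) \<Rightarrow> 'v \<Rightarrow> pop \<Rightarrow> 'v" where
  "cvec scl act v = (\<lambda>(n, k, lam). scl (zcoef (n, k, lam))
     (foldr (\<lambda>i. act (loop sl2_y (int k - int (lam i)))) [0..<n - k] (wvec scl act v n)))"

definition BB ::
  "(complex \<Rightarrow> 'v \<Rightarrow> 'v) \<Rightarrow> (affine \<Rightarrow> 'v \<Rightarrow> 'v) \<Rightarrow> 'v \<Rightarrow> weight \<Rightarrow> nat \<Rightarrow> 'v set" where
  "BB scl act v \<mu> n = cvec scl act v ` PP_wt \<mu> n"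


section \<open>The defining relations\<close>

lemma mat_scale_0 [simp]: "mat_scale a 0 = 0"
  by (simp add: mat_scale_def vec_eq_iff)

lemma map_mat_scale_single:
  "Poly_Mapping.map (mat_scale a) (Poly_Mapping.single m A) = Poly_Mapping.single m (mat_scale a A)"
  by (rule poly_mapping_eqI) (auto simp: Poly_Mapping.map.rep_eq lookup_single when_def)

lemma loop_deriv_single:
  "loop_deriv (Poly_Mapping.single m A) = Poly_Mapping.single m (mat_scale (of_int m) A)"
  by (cases "A = 0") (simp_all add: loop_deriv_def)

lemma map_mat_scale_0 [simp]: "Poly_Mapping.map (mat_scale a) 0 = 0"
  by (rule poly_mapping_eqI) (simp add: Poly_Mapping.map.rep_eq)

lemma map_mat_scale_zero [simp]: "Poly_Mapping.map (mat_scale 0) X = 0"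
  by (rule poly_mapping_eqI) (auto simp: Poly_Mapping.map.rep_eq when_def mat_scale_def vec_eq_iff)

lemma mat_scale_1 [simp]: "mat_scale 1 A = A"
  by (simp add: mat_scale_def vec_eq_iff)

lemma trace_mat2_0 [simp]: "trace (0 :: mat2) = 0"
  by (simp add: trace_def)

lemma loop_deriv_0 [simp]: "loop_deriv 0 = 0"
  by (simp add: loop_deriv_def)

lemma affine_bracket_loop:
  "affine_bracket (loop A m) (loop B n) =
     loop (mat_bracket A B) (m + n)
       + affine_scale (if m = - n then of_int m * trace (A ** B) else 0) central_c"
  by (cases "A = 0"; cases "B = 0")
    (auto simp: affine_bracket_def loop_def affine_scale_def central_c_def mat_bracket_def
      lookup_single when_def)

lemma affine_bracket_c: "affine_bracket central_c X = 0" "affine_bracket X central_c = 0"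
proof -
  obtain Y u w where X: "X = (Y, u, w)"
    by (cases X)
  show "affine_bracket central_c X = 0" "affine_bracket X central_c = 0"
    unfolding X by (simp_all add: affine_bracket_def central_c_def zero_prod_def)
qed

lemma affine_bracket_d:
  "affine_bracket deriv_d (loop A m) = affine_scale (of_int m) (loop A m)"
  "affine_bracket (loop A m) deriv_d = - affine_scale (of_int m) (loop A m)"
  by (simp_all add: affine_bracket_def loop_def affine_scale_def deriv_d_def
      map_mat_scale_single loop_deriv_single)

lemma wt_inject: "wt j d = wt j' d' \<longleftrightarrow> j = j' \<and> d = d'"
proof
  assume eq: "wt j d = wt j' d'"
  from fun_cong [OF eq, of "(1, 0, 0)"] have j: "j = j'"
    by (simp add: wt_def transl_Lambda0_def Lambda0_def alpha1_def delta_def)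
  with fun_cong [OF eq, of "(0, 0, 1)"] show "j = j' \<and> d = d'"
    by (simp add: wt_def transl_Lambda0_def Lambda0_def alpha1_def delta_def)
qed simp

end

theory Submission
  imports Defs "HOL-Combinatorics.Multiset_Permutations"
begin

text \<open>
  Write \<open>E(z) = exp (- \<Sum>l>0. h t\<^sup>-\<^sup>l z\<^sup>l / l)\<close>, a generating function of commuting operators.  In
  \<open>L(\<Lambda>\<^sub>0)\<close> one has \<open>y(z)\<^sup>2 = 0\<close>, and commuting this relation with \<open>x t\<^sup>a\<close> gives \<open>y(z) e\<^sub>m = E(z) e\<^sub>m\<^sub>-\<^sub>1\<close>
  on the extremal vectors \<open>e\<^sub>m\<close> (up to a power of \<open>z\<close>), hence
  \<open>y(u\<^sub>1) \<dots> y(u\<^sub>r) e\<^sub>m = (\<Prod>i<k. (u\<^sub>i - u\<^sub>k)\<^sup>2) E(u\<^sub>1) \<dots> E(u\<^sub>r) e\<^sub>m\<^sub>-\<^sub>r\<close>.  By Lagrange interpolation, the operator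
  \<open>\<Sum>s. h\<^sub>s(u) y t\<^sup>k\<^sup>-\<^sup>s\<close>, with \<open>k + r = 2 m\<close> and \<open>h\<^sub>s\<close> the complete symmetric polynomials, acts as the
  combination \<open>\<Sum>i. y(u\<^sub>i) / \<Prod>l\<noteq>i. (u\<^sub>i - u\<^sub>l)\<close>.  Its \<open>r\<close>-th power is computed from \<open>y(u\<^sub>i)\<^sup>2 = 0\<close>; the squared
  Vandermonde determinant cancels, and what remains is
  \<open>\<Sum>\<lambda>. h\<^sub>\<lambda>(u) c(\<lambda>) = E(u\<^sub>1) \<dots> E(u\<^sub>r) e\<^sub>m\<^sub>-\<^sub>r\<close>, so \<open>c(\<lambda>)\<close> is the monomial symmetric function of shape
  \<open>\<lambda>\<close> in the Heisenberg operators.  The right-hand side is unchanged by an additional variable \<open>0\<close>, which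
  gives the independence of \<open>n\<close>.  Its coefficients span the weight space, whose dimension is at least the
  number of partitions because the Heisenberg monomials are linearly independent; so the \<open>c(\<lambda>)\<close> form a
  basis.
\<close>

section \<open>Linear algebra and level-one operators\<close>

text \<open>No character formula enters. Heisenberg monomials on the vectors \<open>e_m\<close> span
  the module because their span is stable under all operators and the module is irreducible; the
  pairing of positive with negative modes supplies the lower bound. The basic relations are proved
  for the vacuum alone. The automorphism exchanging x and y, and the spectral flow, which shifts the
  modes of x and y by opposite amounts, carry them to every \<open>e_m\<close>.

  The \<open>u_i\<close> are complex numbers, since the interpolation weights require division by
  their differences; a single grading variable keeps every sum finite in each degree. The price is
  that the identities hold at distinct points only, so coefficients have to be recovered from
  sufficiently many values.

  Both signs in z have one source: the product of all differences u_i - u_l is (-1)^(r(r-1)/2) times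
  the squared Vandermonde determinant, and r(r-1)/2 has the parity of [r/2]. With r = n - k this
  gives (-1)^[(n-k)/2]; with x in place of y and r = n/2 it gives the sign (-1)^[n/4] of w_n
  relative to \<open>e_m\<close>, m = n/2.\<close>

context vector_space
begin

lemma eigenvectors_span:
  assumes A: "module_hom scale scale A"
    and eig: "\<And>s. s \<in> S \<Longrightarrow> A s = scale (\<kappa> s) s"
    and w: "w \<in> span S" and Aw: "A w = scale a w"
  shows "w \<in> span {s \<in> S. \<kappa> s = a}"
proof -
  interpret A: module_hom scale scale A by (fact A)
  \<comment> \<open>Over an independent subset the coefficients of \<open>w\<close> are unique, so
    \<open>A w\<close> and \<open>scale a w\<close> can be compared coefficientwise.\<close>
  obtain B where B: "B \<subseteq> S" "independent B" "span B = span S"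
    using maximal_independent_subset [of S] span_minimal subspace_span span_mono
    by (metis subset_antisym)
  define c where "c = representation B w"
  have wB: "w \<in> span B" using w B by simp
  have fin: "finite {b. c b \<noteq> 0}" unfolding c_def by (rule finite_representation)
  have sub: "{b. c b \<noteq> 0} \<subseteq> B" unfolding c_def using representation_ne_zero by blast
  have w_eq: "w = (\<Sum>b | c b \<noteq> 0. scale (c b) b)"
    unfolding c_def using sum_nonzero_representation_eq [OF B(2) wB] by simp
  have "0 = A w - scale a w" using Aw by simp
  also have "\<dots> = (\<Sum>b | c b \<noteq> 0. scale (c b * (\<kappa> b - a)) b)"
  proof (subst (1 2) w_eq, simp add: A.sum A.scale scale_sum_right flip: sum_subtractf, rule sum.cong)
  qed (use sub B eig in \<open>auto simp: scale_left_diff_distrib right_diff_distrib mult.commute\<close>)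
  finally have z: "(\<Sum>b | c b \<noteq> 0. scale (c b * (\<kappa> b - a)) b) = 0" by simp
  have "c b * (\<kappa> b - a) = 0" if "c b \<noteq> 0" for b
    using independentD [OF B(2) fin sub z] that by simp
  then have "\<kappa> b = a" if "c b \<noteq> 0" for b using that by force
  with sub B have "{b. c b \<noteq> 0} \<subseteq> {s \<in> S. \<kappa> s = a}" by auto
  then show ?thesis
    by (subst w_eq) (auto intro!: span_sum span_scale intro: span_base)
qed

lemma module_hom_span_closed:
  assumes "module_hom scale scale A" "\<And>s. s \<in> S \<Longrightarrow> A s \<in> span T" "w \<in> span S"
  shows "A w \<in> span T"
proof -
  interpret A: module_hom scale scale A by (fact assms)
  show ?thesis using assms(3)
    by (induction rule: span_induct_alt)
      (auto simp: A.add A.scale A.zero span_zero intro!: span_add span_scale assms(2))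
qed

text \<open>For \<open>P(x) = \<Sum>i\<le>N. x\<^sup>i a\<^sub>i\<close>, the polynomial \<open>P(b x) - b\<^sup>N P(x)\<close> has smaller degree.\<close>

lemma coefficients_in_subspace:
  fixes a :: "nat \<Rightarrow> 'b" and c :: 'a
  assumes W: "subspace W" and c: "c \<noteq> 0" and inj: "inj (\<lambda>n. b ^ n)"
    and P: "\<And>n. (\<Sum>i\<le>N. scale ((c * b ^ n) ^ i) (a i)) \<in> W"
  shows "i \<le> N \<Longrightarrow> a i \<in> W"
  using P
proof (induction N arbitrary: a i)
  case 0
  then show ?case using 0(2)[of 0] by simp
next
  case (Suc N)
  define a' where "a' i = scale (b ^ i - b ^ Suc N) (a i)" for i
  have "(\<Sum>i\<le>N. scale ((c * b ^ n) ^ i) (a' i)) \<in> W" for n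
  proof -
    have "(\<Sum>i\<le>N. scale ((c * b ^ n) ^ i) (a' i)) = (\<Sum>i\<le>Suc N. scale ((c * b ^ n) ^ i) (a' i))"
      by (simp add: a'_def)
    also have "\<dots> = (\<Sum>i\<le>Suc N. scale ((c * b ^ Suc n) ^ i) (a i))
          - scale (b ^ Suc N) (\<Sum>i\<le>Suc N. scale ((c * b ^ n) ^ i) (a i))"
      unfolding scale_sum_right sum_subtractf [symmetric] scale_scale a'_def
      by (intro sum.cong refl)
        (simp add: scale_left_diff_distrib algebra_simps power_mult_distrib)
    also have "\<dots> \<in> W"
      by (intro subspace_diff [OF W] subspace_scale [OF W] Suc.prems)
    finally show ?thesis .
  qed
  then have a': "a' i \<in> W" if "i \<le> N" for i using Suc.IH that by blast
  have low: "a i \<in> W" if "i \<le> N" for i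
  proof -
    have "b ^ i - b ^ Suc N \<noteq> 0" using injD [OF inj, of i "Suc N"] that by auto
    then have "a i = scale (1 / (b ^ i - b ^ Suc N)) (a' i)" by (simp add: a'_def)
    then show ?thesis using a' [OF that] subspace_scale [OF W] by metis
  qed
  have "(\<Sum>i\<le>Suc N. scale ((c * b ^ 0) ^ i) (a i)) - (\<Sum>i\<le>N. scale ((c * b ^ 0) ^ i) (a i)) \<in> W"
    by (intro subspace_diff [OF W] subspace_sum [OF W] subspace_scale [OF W] low Suc.prems) auto
  then have "scale (c ^ Suc N) (a (Suc N)) \<in> W" by simp
  from subspace_scale [OF W this, of "1 / c ^ Suc N"] have "a (Suc N) \<in> W" using c by simp
  with low show ?case using Suc.prems(1) le_Suc_eq by blast
qed

text \<open>A redundant element of \<open>T\<close> could be removed without shrinking the span,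
  which would then contain more independent vectors than it has generators.\<close>

lemma spanning_set_independent:
  assumes T: "finite T" "card T \<le> card S" and S: "independent S" "S \<subseteq> span T"
  shows "independent T" "card T = card S"
proof -
  show eq: "card T = card S" using independent_span_bound [OF T(1) S] T by simp
  show "independent T"
  proof
    assume "dependent T"
    then obtain a where a: "a \<in> T" "a \<in> span (T - {a})" by (auto simp: dependent_def)
    then have "span (T - {a}) = span T" by (metis insert_Diff span_redundant)
    then have "card S \<le> card (T - {a})" using independent_span_bound [of "T - {a}" S] T S by auto
    also have "\<dots> < card T" using a T by (meson card_Diff1_less)
    finally show False using eq by simp
  qed
qed

end

text \<open>\<open>X a\<close>, \<open>Y a\<close>, \<open>H a\<close> and \<open>D\<close> are the actions of \<open>x t\<^sup>a\<close>, \<open>y t\<^sup>a\<close>, \<open>h t\<^sup>a\<close> and \<open>d\<close>; the central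
  element acts as the identity.\<close>

locale level_one_operators = vector_space scl
  for scl :: "complex \<Rightarrow> 'v::ab_group_add \<Rightarrow> 'v" +
  fixes X Y H :: "int \<Rightarrow> 'v \<Rightarrow> 'v" and D :: "'v \<Rightarrow> 'v"
  assumes hom_X: "module_hom scl scl (X a)"
    and hom_Y: "module_hom scl scl (Y a)"
    and hom_H: "module_hom scl scl (H a)"
    and hom_D: "module_hom scl scl D"
    and X_X: "X a (X b u) = X b (X a u)"
    and Y_Y: "Y a (Y b u) = Y b (Y a u)"
    and H_X: "H a (X b u) = X b (H a u) + scl 2 (X (a + b) u)"
    and H_Y: "H a (Y b u) = Y b (H a u) + scl (- 2) (Y (a + b) u)"
    and H_H: "H a (H b u) = H b (H a u) + scl (if a + b = 0 then 2 * of_int a else 0) u"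
    and X_Y: "X a (Y b u) = Y b (X a u) + H (a + b) u + scl (if a + b = 0 then of_int a else 0) u"
    and D_X: "D (X a u) = X a (D u) + scl (of_int a) (X a u)"
    and D_Y: "D (Y a u) = Y a (D u) + scl (of_int a) (Y a u)"
    and D_H: "D (H a u) = H a (D u) + scl (of_int a) (H a u)"
begin

lemmas X_simps [simp] = module_hom.add [OF hom_X] module_hom.scale [OF hom_X]
    module_hom.zero [OF hom_X] module_hom.diff [OF hom_X] module_hom.neg [OF hom_X]
lemmas Y_simps [simp] = module_hom.add [OF hom_Y] module_hom.scale [OF hom_Y]
    module_hom.zero [OF hom_Y] module_hom.diff [OF hom_Y] module_hom.neg [OF hom_Y]
lemmas H_simps [simp] = module_hom.add [OF hom_H] module_hom.scale [OF hom_H]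
    module_hom.zero [OF hom_H] module_hom.diff [OF hom_H] module_hom.neg [OF hom_H]
lemmas D_simps [simp] = module_hom.add [OF hom_D] module_hom.scale [OF hom_D]
    module_hom.zero [OF hom_D] module_hom.diff [OF hom_D] module_hom.neg [OF hom_D]
lemmas sum_simps = module_hom.sum [OF hom_X] module_hom.sum [OF hom_Y]
    module_hom.sum [OF hom_H] module_hom.sum [OF hom_D]

lemma Y_X: "Y b (X a u) = X a (Y b u) - H (a + b) u - scl (if a + b = 0 then of_int a else 0) u"
  using X_Y [of a b u] by (simp add: algebra_simps)

lemma scale_2: "scl 2 u = u + u"
  using scale_left_distrib [of 1 1 u] by simp

text \<open>The four operators are the Chevalley generators e_1 = x, f_0 = x t^-1, f_1 = y, e_0 = y
  t. Their brackets give h t and h t^-1, and bracketing with these moves a mode of x or y by one in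
  either direction.\<close>

lemma stable_under_generators:
  assumes W: "subspace W"
    and X0: "\<And>u. u \<in> W \<Longrightarrow> X 0 u \<in> W" and Xm: "\<And>u. u \<in> W \<Longrightarrow> X (- 1) u \<in> W"
    and Y0: "\<And>u. u \<in> W \<Longrightarrow> Y 0 u \<in> W" and Y1: "\<And>u. u \<in> W \<Longrightarrow> Y 1 u \<in> W"
    and u: "u \<in> W"
  shows "X a u \<in> W" "Y a u \<in> W" "H a u \<in> W"
proof -
  have H1: "H 1 u \<in> W" if "u \<in> W" for u
  proof -
    have "H 1 u = X 0 (Y 1 u) - Y 1 (X 0 u)" by (subst X_Y) simp
    with that show ?thesis by (simp add: subspace_diff W X0 Y1)
  qed
  have Hm: "H (- 1) u \<in> W" if "u \<in> W" for u
  proof -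
    have "H (- 1) u = X (- 1) (Y 0 u) - Y 0 (X (- 1) u)" by (subst X_Y) simp
    with that show ?thesis by (simp add: subspace_diff W Xm Y0)
  qed
  have Xa: "X a u \<in> W" if "u \<in> W" for a u
    using that
  proof (induction a arbitrary: u rule: int_induct [where k = 0])
    case base
    then show ?case by (rule X0)
  next
    case (step1 i)
    have "X (i + 1) u = scl (1/2) (H 1 (X i u) - X i (H 1 u))"
      by (subst H_X) (simp add: add.commute)
    with step1 show ?case by (simp add: subspace_diff subspace_scale W H1)
  next
    case (step2 i)
    have "X (i - 1) u = scl (1/2) (H (- 1) (X i u) - X i (H (- 1) u))"
      by (subst H_X) (simp add: add.commute)
    with step2 show ?case by (simp add: subspace_diff subspace_scale W Hm)
  qed
  have Ya: "Y a u \<in> W" if "u \<in> W" for a u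
    using that
  proof (induction a arbitrary: u rule: int_induct [where k = 0])
    case base
    then show ?case by (rule Y0)
  next
    case (step1 i)
    have "Y (i + 1) u = scl (-1/2) (H 1 (Y i u) - Y i (H 1 u))"
      by (subst H_Y) (simp add: add.commute)
    with step1 show ?case by (simp only:) (intro subspace_diff subspace_scale W H1 step1.IH)
  next
    case (step2 i)
    have "Y (i - 1) u = scl (-1/2) (H (- 1) (Y i u) - Y i (H (- 1) u))"
      by (subst H_Y) (simp add: add.commute)
    with step2 show ?case by (simp only:) (intro subspace_diff subspace_scale W Hm step2.IH)
  qed
  have "H a u = X a (Y 0 u) - Y 0 (X a u) - scl (if a = 0 then of_int a else 0) u"
    by (subst X_Y) simp
  also have "\<dots> \<in> W"
    by (intro subspace_diff subspace_scale W Xa Ya u)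
  finally show "H a u \<in> W" .
  show "X a u \<in> W" "Y a u \<in> W" using Xa Ya u by auto
qed


text \<open>The automorphism x <-> y, h -> -h. Through it every fact about \<open>X\<close> yields
  its counterpart for \<open>Y\<close>.\<close>

lemma swapped_operators: "level_one_operators scl Y X (\<lambda>a u. - H a u) D"
proof -
  have 1: "- H a (Y b u) = Y b (- H a u) + scl 2 (Y (a + b) u)" for a b u
    by (simp add: H_Y)
  have 2: "- H a (X b u) = X b (- H a u) + scl (- 2) (X (a + b) u)" for a b u
    by (simp add: H_X)
  have 3: "- H a (- H b u) = - H b (- H a u) + scl (if a + b = 0 then 2 * of_int a else 0) u"
    for a b u using H_H [of a b u] by simp
  have 4: "Y a (X b u) = X b (Y a u) + - H (a + b) u + scl (if a + b = 0 then of_int a else 0) u"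
    for a b u
  proof -
    \<comment> \<open>Reversing the bracket turns the central term \<open>b\<close> into
      \<open>- b\<close>, which equals \<open>a\<close> exactly where the term is present.\<close>
    have "(if b + a = 0 then of_int b else 0) = - (if a + b = 0 then of_int a else (0::complex))"
      by auto (metis add_eq_0_iff2 of_int_minus)
    then show ?thesis using X_Y [of b a u] by (simp only: scale_minus_left add.commute [of b a]) simp
  qed
  have 5: "D (- H a u) = - H a (D u) + scl (of_int a) (- H a u)" for a u
    by (simp add: D_H)
  show ?thesis
    by (unfold_locales; (rule 1 2 3 4 5 X_X Y_Y D_X D_Y)?) simp_all
qed

end

section \<open>Singular vectors and the quadratic relation\<close>

text \<open>Words in the lowering generators f_0 = x t^-1 (\<open>True\<close>) and f_1 = y
  (\<open>False\<close>). On a singular weight vector they span the submodule that it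
  generates.\<close>

primrec (in level_one_operators) descend :: "'v \<Rightarrow> bool list \<Rightarrow> 'v" where
  "descend u [] = u"
| "descend u (b # bs) = (if b then X (- 1) (descend u bs) else Y 0 (descend u bs))"

locale level_one_vacuum = level_one_operators scl X Y H D
  for scl :: "complex \<Rightarrow> 'v::ab_group_add \<Rightarrow> 'v" and X Y H D +
  fixes v :: 'v
  assumes v_nonzero: "v \<noteq> 0"
    and X0_v: "X 0 v = 0" and Y1_v: "Y 1 v = 0" and H0_v: "H 0 v = 0" and D_v: "D v = 0"
    and irreducible: "subspace W \<Longrightarrow> (\<And>a u. u \<in> W \<Longrightarrow> X a u \<in> W) \<Longrightarrow> (\<And>a u. u \<in> W \<Longrightarrow> Y a u \<in> W)
      \<Longrightarrow> (\<And>a u. u \<in> W \<Longrightarrow> H a u \<in> W) \<Longrightarrow> (\<And>u. u \<in> W \<Longrightarrow> D u \<in> W) \<Longrightarrow> W = {0} \<or> W = UNIV"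
begin

text \<open>The eigenvalue of h + 3 d drops along both lowering generators: by 1 for x t^-1, thanks
  to 3 > 2, and by 2 for y. So it is negative on the whole submodule generated by \<open>u\<close>,
  whereas \<open>v\<close> has eigenvalue 0. The submodule misses \<open>v\<close>, and
  irreducibility makes it 0.\<close>

lemma singular_vector_eq_0:
  assumes X0: "X 0 u = 0" and Y1: "Y 1 u = 0"
    and H0: "H 0 u = scl (of_int h) u" and D: "D u = scl (of_int e) u" and neg: "h + 3 * e < 0"
  shows "u = 0"
proof -
  define S where "S = range (descend u)"
  define G where "G = span S"
  define A where "A w = H 0 w + scl 3 (D w)" for w
  have A: "module_hom scl scl A"
    unfolding A_def by unfold_locales (simp_all add: algebra_simps scale_right_distrib)
  have weights: "\<exists>p q. p + 3 * q < 0 \<and> H 0 (descend u bs) = scl (of_int p) (descend u bs)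
      \<and> D (descend u bs) = scl (of_int q) (descend u bs)" for bs
  proof (induction bs)
    case Nil
    show ?case using neg H0 D by auto
  next
    case (Cons b bs)
    then obtain p q where pq: "p + 3 * q < 0" "H 0 (descend u bs) = scl (of_int p) (descend u bs)"
      "D (descend u bs) = scl (of_int q) (descend u bs)" by blast
    show ?case
    proof (cases b)
      case True
      have "H 0 (descend u (b # bs)) = scl (of_int (p + 2)) (descend u (b # bs))"
        "D (descend u (b # bs)) = scl (of_int (q - 1)) (descend u (b # bs))"
        using True pq by (simp_all add: H_X D_X scale_left_distrib scale_left_diff_distrib)
      with pq show ?thesis by (intro exI[of _ "p + 2"] exI[of _ "q - 1"]) simp
    next
      case False
      have "H 0 (descend u (b # bs)) = scl (of_int (p - 2)) (descend u (b # bs))"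
        "D (descend u (b # bs)) = scl (of_int q) (descend u (b # bs))"
        using False pq by (simp_all add: H_Y D_Y scale_left_distrib scale_left_diff_distrib)
      with pq show ?thesis by (intro exI[of _ "p - 2"] exI[of _ q]) simp
    qed
  qed
  have sub: "subspace G" by (simp add: G_def)
  have base: "descend u bs \<in> G" for bs by (simp add: G_def S_def span_base)
  have Xm: "X (- 1) w \<in> G" if "w \<in> G" for w
  proof -
    have "X (- 1) s \<in> span S" if "s \<in> S" for s
      using that base [of "True # _"] by (auto simp: S_def G_def)
    with that show ?thesis
      using module_hom_span_closed [OF hom_X, of S "- 1" S w] by (auto simp: G_def)
  qed
  have Y0: "Y 0 w \<in> G" if "w \<in> G" for w
  proof -
    have "Y 0 s \<in> span S" if "s \<in> S" for s
      using that base [of "False # _"] by (auto simp: S_def G_def)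
    with that show ?thesis
      using module_hom_span_closed [OF hom_Y, of S 0 S w] by (auto simp: G_def)
  qed
  have H0G: "H 0 (descend u bs) \<in> G" for bs
    using weights [of bs] subspace_scale [OF sub base] by metis
  have X0G: "X 0 (descend u bs) \<in> G" for bs
  proof (induction bs)
    case Nil
    show ?case using X0 by (simp add: subspace_0 sub)
  next
    case (Cons b bs)
    show ?case
      using Cons.IH
      by (auto simp: X_X [of 0] X_Y [of 0] Xm Y0 H0G intro!: subspace_add [OF sub])
  qed
  have Y1G: "Y 1 (descend u bs) \<in> G" for bs
  proof (induction bs)
    case Nil
    show ?case using Y1 by (simp add: subspace_0 sub)
  next
    case (Cons b bs)
    have "Y 1 (X (- 1) (descend u bs))
        = X (- 1) (Y 1 (descend u bs)) - H 0 (descend u bs) + descend u bs"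
      by (simp add: X_Y [of "- 1" 1])
    with Cons.IH show ?case
      by (auto simp: Y_Y [of 1] Xm Y0 H0G base intro!: subspace_add [OF sub] subspace_diff [OF sub])
  qed
  have X0': "X 0 w \<in> G" if "w \<in> G" for w
    using module_hom_span_closed [OF hom_X, of S 0 S] X0G that by (auto simp: S_def G_def)
  have Y1': "Y 1 w \<in> G" if "w \<in> G" for w
    using module_hom_span_closed [OF hom_Y, of S 1 S] Y1G that by (auto simp: S_def G_def)
  have D': "D w \<in> G" if "w \<in> G" for w
  proof -
    have "D (descend u bs) \<in> G" for bs
      using weights [of bs] subspace_scale [OF sub base] by metis
    then show ?thesis
      using module_hom_span_closed [OF hom_D, of S S] that by (auto simp: S_def G_def)
  qed
  have "G = {0} \<or> G = UNIV"
    by (rule irreducible [OF sub]) (use stable_under_generators [OF sub X0' Xm Y0 Y1'] D' in blast)+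
  moreover have "G \<noteq> UNIV"
  proof
    assume "G = UNIV"
    then have vS: "v \<in> span S" by (simp add: G_def)
    have "\<exists>k. k < 0 \<and> A s = scl (of_int k) s" if "s \<in> S" for s
    proof -
      from that obtain bs where s: "s = descend u bs" by (auto simp: S_def)
      from weights [of bs] obtain p q where pq: "p + 3 * q < 0"
        "H 0 s = scl (of_int p) s" "D s = scl (of_int q) s" unfolding s by blast
      then have "A s = scl (of_int (p + 3 * q)) s" by (simp add: A_def scale_left_distrib)
      with pq show ?thesis by blast
    qed
    then obtain \<kappa> where \<kappa>: "\<And>s. s \<in> S \<Longrightarrow> \<kappa> s < 0 \<and> A s = scl (of_int (\<kappa> s)) s" by metis
    have "v \<in> span {s \<in> S. (of_int (\<kappa> s) :: complex) = 0}"
      by (rule eigenvectors_span [OF A _ vS]) (use \<kappa> in \<open>auto simp: A_def H0_v D_v\<close>)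
    moreover have "{s \<in> S. (of_int (\<kappa> s) :: complex) = 0} = {}" using \<kappa> by force
    ultimately show False using v_nonzero by (simp only: span_empty) simp
  qed
  ultimately show ?thesis using base [of "[]"] by auto
qed

lemma Y0_v: "Y 0 v = 0"
proof (rule singular_vector_eq_0 [of _ "- 2" 0])
  show "X 0 (Y 0 v) = 0" by (simp add: X_Y X0_v H0_v)
  show "Y 1 (Y 0 v) = 0" by (simp add: Y_Y [of 1] Y1_v)
  show "H 0 (Y 0 v) = scl (of_int (- 2)) (Y 0 v)" by (simp add: H_Y H0_v)
  show "D (Y 0 v) = scl (of_int 0) (Y 0 v)" by (simp add: D_Y D_v)
qed simp

lemma H1_v: "H 1 v = 0"
  using X_Y [of 0 1 v] by (simp add: X0_v Y1_v)

lemma X_v: "X a v = 0" if "0 \<le> a"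
  using that
proof (induction a rule: int_ge_induct)
  case base
  show ?case by (rule X0_v)
next
  case (step i)
  then show ?case using H_X [of 1 i v] by (simp add: H1_v add.commute)
qed

lemma Y_v: "Y a v = 0" if "0 \<le> a"
  using that
proof (induction a rule: int_ge_induct)
  case base
  show ?case by (rule Y0_v)
next
  case (step i)
  then show ?case using H_Y [of 1 i v] by (simp add: H1_v add.commute)
qed

lemma H_v: "H a v = 0" if "0 \<le> a"
  using X_Y [of a 0 v] that by (cases "a = 0") (simp_all add: X_v Y_v H0_v)

text \<open>For the exchanged operators the vacuum conditions read \<open>Y 0 v = 0\<close> and
  \<open>X 1 v = 0\<close>, which is what the vanishing of the non-negative modes provides.\<close>

lemma swapped_vacuum: "level_one_vacuum scl Y X (\<lambda>a u. - H a u) D v"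
proof -
  interpret S: level_one_operators scl Y X "\<lambda>a u. - H a u" D by (rule swapped_operators)
  show ?thesis
  proof (unfold_locales, goal_cases)
    case (6 W)
    have "H a u \<in> W" if "u \<in> W" for a u
      using subspace_neg [OF 6(1) 6(4) [OF that]] by simp
    with 6 show ?case by (intro irreducible) auto
  qed (auto simp: v_nonzero Y_v X_v H_v D_v)
qed


lemma Y0_X_quadratic:
  "Y 0 (\<Sum>s\<le>S. X (- 1 - int s) (X (- 1 - int (S - s)) v)) =
    - (\<Sum>s\<le>S. X (- 1 - int (S - s)) (H (- 1 - int s) v) + H (- 1 - int s) (X (- 1 - int (S - s)) v))"
proof -
  have Y0: "Y 0 (X a (X b v)) = - X a (H b v) - H a (X b v)" for a b
    by (simp add: Y_X Y_v)
  have "(\<Sum>s\<le>S. X (- 1 - int s) (H (- 1 - int (S - s)) v))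
      = (\<Sum>s\<le>S. X (- 1 - int (S - s)) (H (- 1 - int s) v))"
    by (rule sum.reindex_bij_witness [of _ "\<lambda>s. S - s" "\<lambda>s. S - s"]) auto
  then show ?thesis
    by (simp add: sum_simps Y0 sum_subtractf sum_negf sum.distrib)
qed

text \<open>Passing \<open>Y 1\<close> through raises a mode by one and so leads from degree
  \<open>Suc S\<close> to degree \<open>S\<close>. The only surplus is the summand
  \<open>s = 0\<close>, where the two central terms add up to twice a vector \<open>X a v\<close>
  and cancel against \<open>H 0\<close>, whose eigenvalue on it is 2.\<close>

lemma Y1_X_quadratic:
  "Y 1 (\<Sum>s\<le>Suc S. X (- 1 - int s) (X (- 1 - int (Suc S - s)) v)) =
    Y 0 (\<Sum>s\<le>S. X (- 1 - int s) (X (- 1 - int (S - s)) v))"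
proof -
  have Y1: "Y 1 (X a (X b v)) = scl (if b = - 1 then 1 else 0) (X a v) - X a (H (b + 1) v)
      + scl (if a = - 1 then 1 else 0) (X b v) - H (a + 1) (X b v)" for a b
  proof -
    have "a + 1 = 0 \<longleftrightarrow> a = - 1" for a :: int by auto
    then show ?thesis by (simp add: Y_X Y_v) 
  qed
  have r: "(\<Sum>s\<le>Suc S. scl (if Suc S - s = 0 then 1 else 0) (X (- 1 - int s) v)
            - X (- 1 - int s) (H (- int (Suc S - s)) v))
      = (\<Sum>s\<le>Suc S. scl (if s = 0 then 1 else 0) (X (- 1 - int (Suc S - s)) v)
            - X (- 1 - int (Suc S - s)) (H (- int s) v))"
    by (rule sum.reindex_bij_witness [of _ "\<lambda>s. Suc S - s" "\<lambda>s. Suc S - s"]) auto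
  have "Y 1 (\<Sum>s\<le>Suc S. X (- 1 - int s) (X (- 1 - int (Suc S - s)) v))
    = (\<Sum>s\<le>Suc S. scl (if Suc S - s = 0 then 1 else 0) (X (- 1 - int s) v)
            - X (- 1 - int s) (H (- int (Suc S - s)) v))
      + (\<Sum>s\<le>Suc S. scl (if s = 0 then 1 else 0) (X (- 1 - int (Suc S - s)) v)
            - H (- int s) (X (- 1 - int (Suc S - s)) v))"
    unfolding sum_simps sum.distrib [symmetric]
    by (intro sum.cong refl) (auto simp: Y1 algebra_simps of_nat_diff)
  also have "\<dots> = (\<Sum>s\<le>Suc S. scl (if s = 0 then 2 else 0) (X (- 1 - int (Suc S - s)) v)
            - X (- 1 - int (Suc S - s)) (H (- int s) v) - H (- int s) (X (- 1 - int (Suc S - s)) v))"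
    unfolding r sum.distrib [symmetric]
    by (intro sum.cong refl) (auto simp: scale_2)
  also have "\<dots> = Y 0 (\<Sum>s\<le>S. X (- 1 - int s) (X (- 1 - int (S - s)) v))"
    unfolding Y0_X_quadratic sum.atMost_Suc_shift
    by (simp add: H_X H_v sum_negf sum_subtractf sum.distrib algebra_simps)
  finally show ?thesis .
qed

text \<open>The coefficients of \<open>x(z)\<^sup>2 v\<close> are singular vectors of weight different from that of \<open>v\<close>: by
  \<open>Y1_X_quadratic\<close>, \<open>Y 1\<close> annihilates the next coefficient once the previous one vanishes.\<close>

lemma X_quadratic: "(\<Sum>s\<le>S. X (- 1 - int s) (X (- 1 - int (S - s)) v)) = 0"
proof (induction S)
  case 0
  have "Y 1 (X (- 1) (X (- 1) v)) = 0"
    by (simp add: Y_X Y_v H_v H_X scale_2)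
  moreover have "H 0 (X (- 1) (X (- 1) v)) = scl (of_int 4) (X (- 1) (X (- 1) v))"
    by (simp add: H_X H_v flip: scale_left_distrib)
  moreover have "D (X (- 1) (X (- 1) v)) = scl (of_int (- 2)) (X (- 1) (X (- 1) v))"
    by (simp add: D_X D_v flip: scale_minus_left scale_left_diff_distrib scale_left_distrib)
  ultimately show ?case
    using singular_vector_eq_0 [of "X (- 1) (X (- 1) v)" 4 "- 2"] by (simp add: X_X [of 0] X_v)
next
  case (Suc S)
  define R where "R = (\<Sum>s\<le>Suc S. X (- 1 - int s) (X (- 1 - int (Suc S - s)) v))"
  have "X 0 R = 0" by (simp add: R_def sum_simps X_X [of 0] X_v del: sum.atMost_Suc)
  moreover have "Y 1 R = 0" using Y1_X_quadratic [of S] Suc by (simp add: R_def)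
  moreover have "H 0 (X a (X b v)) = scl (of_int 4) (X a (X b v))" for a b
    by (simp add: H_X H_v flip: scale_left_distrib)
  then have "H 0 R = scl (of_int 4) R"
    by (simp only: R_def sum_simps scale_sum_right)
  moreover have DX: "D (X a (X b v)) = scl (of_int (a + b)) (X a (X b v))" for a b
    by (simp add: D_X D_v add.commute flip: scale_left_distrib)
  then have "D R = scl (of_int (- 2 - int (Suc S))) R"
    unfolding R_def sum_simps scale_sum_right by (intro sum.cong refl) (simp add: DX of_nat_diff algebra_simps)
  ultimately have "R = 0"
    using singular_vector_eq_0 [of R 4 "- 2 - int (Suc S)"] by simp
  then show ?case by (simp only: R_def)
qed

text \<open>\<open>Y 0\<close> is applied to the vanishing coefficient of x(z)^2 v. Moving each
  \<open>H\<close> to the front costs \<open>2 X\<close>, once per summand, whence the factor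
  \<open>Suc S\<close>. This is Newton's recursion: x(z) v is an exponential in the negative modes
  of h applied to \<open>X (- 1) v\<close>.\<close>

lemma X_recursion:
  "scl (of_nat (Suc S)) (X (- 1 - int (Suc S)) v) = (\<Sum>s\<le>S. H (- 1 - int s) (X (- 1 - int (S - s)) v))"
proof -
  have "X (- 1 - int (S - s)) (H (- 1 - int s) v)
    = H (- 1 - int s) (X (- 1 - int (S - s)) v) - scl 2 (X (- 1 - int (Suc S)) v)" if "s \<le> S" for s
    using that by (simp add: H_X of_nat_diff algebra_simps)
  then have "X (- 1 - int (S - s)) (H (- 1 - int s) v) + H (- 1 - int s) (X (- 1 - int (S - s)) v)
    = scl 2 (H (- 1 - int s) (X (- 1 - int (S - s)) v)) - scl 2 (X (- 1 - int (Suc S)) v)"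
    if "s \<le> S" for s
    using that by (simp only: scale_2) simp
  then have "0 = (\<Sum>s\<le>S. scl 2 (H (- 1 - int s) (X (- 1 - int (S - s)) v))
      - scl 2 (X (- 1 - int (Suc S)) v))"
    using Y0_X_quadratic [of S] unfolding X_quadratic by (simp del: of_nat_Suc)
  also have "\<dots> = scl 2 ((\<Sum>s\<le>S. H (- 1 - int s) (X (- 1 - int (S - s)) v))
      - scl (of_nat (Suc S)) (X (- 1 - int (Suc S)) v))"
    by (simp add: sum_subtractf scale_right_diff_distrib scale_sum_right sum_constant_scale)
  finally show ?thesis by simp
qed

end

section \<open>Extremal vectors\<close>

text \<open>The coefficients of \<open>exp (\<Sum>l>0. A\<^sub>-\<^sub>l z\<^sup>l / l)\<close>; in terms of power sums, the complete
  symmetric functions.\<close>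

fun complete_op :: "(complex \<Rightarrow> 'v \<Rightarrow> 'v) \<Rightarrow> (int \<Rightarrow> 'v \<Rightarrow> 'v) \<Rightarrow> nat \<Rightarrow> 'v \<Rightarrow> 'v::ab_group_add" where
  "complete_op scl A 0 u = u"
| "complete_op scl A (Suc S) u =
    scl (1 / of_nat (Suc S)) (\<Sum>s\<le>S. A (- 1 - int s) (complete_op scl A (S - s) u))"

context level_one_vacuum
begin

lemma X_eq_complete_op: "X (- 1 - int S) v = complete_op scl H S (X (- 1) v)"
proof (induction S rule: less_induct)
  case (less S)
  show ?case
  proof (cases S)
    case (Suc T)
    have "X (- 1 - int (Suc T)) v
        = scl (1 / of_nat (Suc T)) (scl (of_nat (Suc T)) (X (- 1 - int (Suc T)) v))"
      by (simp del: of_nat_Suc)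
    also have "\<dots> = complete_op scl H (Suc T) (X (- 1) v)"
      unfolding X_recursion complete_op.simps using less Suc
      by (intro arg_cong2 [where f = scl] refl sum.cong) (simp del: of_nat_diff)
    finally show ?thesis by (simp only: Suc)
  qed simp
qed

lemma Y_eq_complete_op: "Y (- 1 - int S) v = complete_op scl (\<lambda>a u. - H a u) S (Y (- 1) v)"
  by (rule level_one_vacuum.X_eq_complete_op [OF swapped_vacuum])

lemma Y_quadratic: "(\<Sum>s\<le>S. Y (- 1 - int s) (Y (- 1 - int (S - s)) v)) = 0"
  by (rule level_one_vacuum.X_quadratic [OF swapped_vacuum])

text \<open>Degrees 0 and 1 of x(z)^2 v = 0. The second is the condition on x for
  \<open>X (- 1) v\<close> to be extremal; the first, with x and y exchanged, is the condition on y
  for \<open>Y (- 1) v\<close>.\<close>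

lemma X_top: "X (- 1) (X (- 1) v) = 0" "X (- 2) (X (- 1) v) = 0"
proof -
  show "X (- 1) (X (- 1) v) = 0" using X_quadratic [of 0] by simp
  have "scl 2 (X (- 2) (X (- 1) v)) = 0"
    using X_quadratic [of 1] by (simp add: X_X [of "- 1" "- 2"] scale_2)
  then show "X (- 2) (X (- 1) v) = 0" by simp
qed

lemma Y_top: "Y (- 1) (Y (- 1) v) = 0" "Y (- 2) (Y (- 1) v) = 0"
  using level_one_vacuum.X_top [OF swapped_vacuum] by auto

text \<open>The vacuum conditions for the operators shifted by \<open>2 * m\<close>; the eigenvalues
  are those of the weight t_{m alpha_1}(Lambda_0).\<close>

definition extremal :: "int \<Rightarrow> 'v \<Rightarrow> bool" where
  "extremal m w \<longleftrightarrow> w \<noteq> 0 \<and> X (- 2 * m) w = 0 \<and> Y (2 * m + 1) w = 0 \<and>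
     H 0 w = scl (of_int (2 * m)) w \<and> D w = scl (of_int (- (m ^ 2))) w"


text \<open>Spectral flow: an extremal vector is a vacuum for the shifted operators, so whatever is proved
  about \<open>v\<close> applies to it.\<close>

lemma shifted_operators:
  "level_one_operators scl (\<lambda>a. X (a - 2 * m)) (\<lambda>a. Y (a + 2 * m))
    (\<lambda>a u. H a u - scl (if a = 0 then of_int (2 * m) else 0) u)
    (\<lambda>u. D u + scl (of_int m) (H 0 u) - scl (of_int (m ^ 2)) u)"
  (is "level_one_operators scl ?X ?Y ?H ?D")
proof -
  have HX: "?H a (?X b u) = ?X b (?H a u) + scl 2 (?X (a + b) u)" for a b u
    by (simp add: H_X algebra_simps)
  have HY: "?H a (?Y b u) = ?Y b (?H a u) + scl (- 2) (?Y (a + b) u)" for a b u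
    by (simp add: H_Y algebra_simps)
  have HH: "?H a (?H b u) = ?H b (?H a u) + scl (if a + b = 0 then 2 * of_int a else 0) u" for a b u
    using H_H [of a b u] by (simp add: algebra_simps)
  have XY: "?X a (?Y b u) = ?Y b (?X a u) + ?H (a + b) u + scl (if a + b = 0 then of_int a else 0) u"
    for a b u
    by (simp add: X_Y algebra_simps)
  have DX: "?D (?X a u) = ?X a (?D u) + scl (of_int a) (?X a u)" for a u
    by (simp add: D_X H_X algebra_simps)
  have DY: "?D (?Y a u) = ?Y a (?D u) + scl (of_int a) (?Y a u)" for a u
    by (simp add: D_Y H_Y algebra_simps)
  have DH: "?D (?H a u) = ?H a (?D u) + scl (of_int a) (?H a u)" for a u
  proof -
    have "H 0 (H a u) = H a (H 0 u)" using H_H [of 0 a u] by simp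
    then show ?thesis by (cases "a = 0") (simp_all add: D_H algebra_simps)
  qed
  show ?thesis
    by (unfold_locales; (rule X_X Y_Y HX HY HH XY DX DY DH)?)
      (simp_all add: algebra_simps)
qed

text \<open>The corrections to \<open>H 0\<close> and \<open>D\<close> bring both eigenvalues of
  \<open>w\<close> to 0, for \<open>D\<close> as - m^2 + m (2 m) - m^2 = 0. A subspace stable under
  the shifted operators is stable under the original ones, so irreducibility is inherited.\<close>

lemma extremal_vacuum:
  assumes "extremal m w"
  shows "level_one_vacuum scl (\<lambda>a. X (a - 2 * m)) (\<lambda>a. Y (a + 2 * m))
    (\<lambda>a u. H a u - scl (if a = 0 then of_int (2 * m) else 0) u)
    (\<lambda>u. D u + scl (of_int m) (H 0 u) - scl (of_int (m ^ 2)) u) w"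
    (is "level_one_vacuum scl ?X ?Y ?H ?D w")
proof -
  interpret S: level_one_operators scl ?X ?Y ?H ?D by (rule shifted_operators)
  show ?thesis
  proof (unfold_locales, goal_cases)
    case (6 W)
    note sub = 6(1)
    have X: "X a u \<in> W" if "u \<in> W" for a u using 6(2) [OF that, of "a + 2 * m"] by simp
    have Y: "Y a u \<in> W" if "u \<in> W" for a u using 6(3) [OF that, of "a - 2 * m"] by simp
    have H: "H a u \<in> W" if "u \<in> W" for a u
      using subspace_add [OF sub 6(4) [OF that, of a] subspace_scale [OF sub that]]
      by (metis diff_add_cancel)
    have D: "D u \<in> W" if "u \<in> W" for u
    proof -
      have "D u = (D u + scl (of_int m) (H 0 u) - scl (of_int (m ^ 2)) u)
         - scl (of_int m) (H 0 u) + scl (of_int (m ^ 2)) u" by simp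
      also have "\<dots> \<in> W"
        by (intro subspace_add subspace_diff subspace_scale sub 6(5) H that)
      finally show ?thesis .
    qed
    show ?case using irreducible sub X Y H D by blast
  qed (use assms in \<open>auto simp: extremal_def add.commute power2_eq_square
      simp flip: scale_left_distrib scale_left_diff_distrib scale_minus_left\<close>)
qed

text \<open>In the shifted picture \<open>w\<close> is the vacuum and its successor is
  \<open>X (- 1) v\<close>. The central term makes \<open>Y 1\<close> lead back to \<open>w\<close>,
  so the successor is not 0.\<close>

lemma extremal_up:
  assumes "extremal m w"
  shows "extremal (m + 1) (X (- 1 - 2 * m) w)" "Y (2 * m + 1) (X (- 1 - 2 * m) w) = w"
proof -
  interpret S: level_one_vacuum scl "\<lambda>a. X (a - 2 * m)" "\<lambda>a. Y (a + 2 * m)"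
    "\<lambda>a u. H a u - scl (if a = 0 then of_int (2 * m) else 0) u"
    "\<lambda>u. D u + scl (of_int m) (H 0 u) - scl (of_int (m ^ 2)) u" w
    by (rule extremal_vacuum [OF assms])
  show w: "Y (2 * m + 1) (X (- 1 - 2 * m) w) = w"
    using S.Y_X [of 1 "- 1" w] S.Y_v [of 1] S.H_v [of 0] by (simp add: add.commute)
  have "Y (2 * m + 3) (X (- 1 - 2 * m) w) = 0"
    using S.Y_X [of 3 "- 1" w] S.Y_v [of 3] S.H_v [of 2] by (simp add: add.commute)
  moreover have "X (- 2 - 2 * m) (X (- 1 - 2 * m) w) = 0" using S.X_top by simp
  moreover have "X (- 1 - 2 * m) w \<noteq> 0" using w S.v_nonzero by auto
  moreover have H0: "H 0 w = scl (of_int (2 * m)) w" and D: "D w = scl (of_int (- (m ^ 2))) w"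
    using assms by (auto simp: extremal_def)
  have "H 0 (X (- 1 - 2 * m) w) = scl (of_int (2 * (m + 1))) (X (- 1 - 2 * m) w)"
    by (simp add: H_X H0 flip: scale_left_distrib)
  moreover have "D (X (- 1 - 2 * m) w) = scl (of_int (- ((m + 1) ^ 2))) (X (- 1 - 2 * m) w)"
    unfolding D_X D X_simps scale_left_distrib [symmetric]
    by (simp add: power2_eq_square algebra_simps)
  ultimately show "extremal (m + 1) (X (- 1 - 2 * m) w)"
    by (simp add: extremal_def algebra_simps)
qed

lemma extremal_down:
  assumes "extremal m w"
  shows "extremal (m - 1) (Y (- 1 + 2 * m) w)" "X (1 - 2 * m) (Y (- 1 + 2 * m) w) = w"
proof -
  interpret S: level_one_vacuum scl "\<lambda>a. X (a - 2 * m)" "\<lambda>a. Y (a + 2 * m)"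
    "\<lambda>a u. H a u - scl (if a = 0 then of_int (2 * m) else 0) u"
    "\<lambda>u. D u + scl (of_int m) (H 0 u) - scl (of_int (m ^ 2)) u" w
    by (rule extremal_vacuum [OF assms])
  show w: "X (1 - 2 * m) (Y (- 1 + 2 * m) w) = w"
    using S.X_Y [of 1 "- 1" w] S.X_v [of 1] S.H_v [of 0] by (simp add: add.commute)
  have "X (2 - 2 * m) (Y (- 1 + 2 * m) w) = 0"
    using S.X_Y [of 2 "- 1" w] S.X_v [of 2] S.H_v [of 1] by (simp add: add.commute)
  moreover have "Y (- 1 + 2 * m) (Y (- 1 + 2 * m) w) = 0" using S.Y_top by simp
  moreover have "Y (- 1 + 2 * m) w \<noteq> 0" using w S.v_nonzero by auto
  moreover have H0: "H 0 w = scl (of_int (2 * m)) w" and D: "D w = scl (of_int (- (m ^ 2))) w"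
    using assms by (auto simp: extremal_def)
  have "H 0 (Y (- 1 + 2 * m) w) = scl (of_int (2 * (m - 1))) (Y (- 1 + 2 * m) w)"
    unfolding H_Y H0 Y_simps add_0_left scale_left_distrib [symmetric] by simp
  moreover have "D (Y (- 1 + 2 * m) w) = scl (of_int (- ((m - 1) ^ 2))) (Y (- 1 + 2 * m) w)"
    unfolding D_Y D Y_simps scale_left_distrib [symmetric]
    by (simp add: power2_eq_square algebra_simps)
  ultimately show "extremal (m - 1) (Y (- 1 + 2 * m) w)"
    by (simp add: extremal_def algebra_simps)
qed

primrec extremal_above :: "nat \<Rightarrow> 'v" where
  "extremal_above 0 = v"
| "extremal_above (Suc m) = X (- 1 - 2 * int m) (extremal_above m)"

primrec extremal_below :: "nat \<Rightarrow> 'v" where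
  "extremal_below 0 = v"
| "extremal_below (Suc m) = Y (- 1 - 2 * int m) (extremal_below m)"

definition extremal_vec :: "int \<Rightarrow> 'v" where
  "extremal_vec m = (if 0 \<le> m then extremal_above (nat m) else extremal_below (nat (- m)))"

lemma extremal_extremal_above: "extremal (int m) (extremal_above m)"
proof (induction m)
  case 0
  show ?case by (simp add: extremal_def v_nonzero X_v Y_v H_v D_v)
next
  case (Suc m)
  show ?case using extremal_up(1) [OF Suc] by (simp add: add.commute)
qed

lemma extremal_extremal_below: "extremal (- int m) (extremal_below m)"
proof (induction m)
  case 0
  show ?case by (simp add: extremal_def v_nonzero X_v Y_v H_v D_v)
next
  case (Suc m)
  have "- 1 + 2 * (- int m) = - 1 - 2 * int m" "- int m - 1 = - int (Suc m)" by simp_all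
  then show ?case using extremal_down(1) [OF Suc] by (simp only: extremal_below.simps)
qed

lemma extremal_extremal_vec: "extremal m (extremal_vec m)"
  using extremal_extremal_above [of "nat m"] extremal_extremal_below [of "nat (- m)"]
  by (auto simp: extremal_vec_def)

lemma extremal_vec_0: "extremal_vec 0 = v"
  by (simp add: extremal_vec_def)

text \<open>For negative \<open>m\<close> the vector was built with \<open>Y\<close>; by
  \<open>extremal_down\<close> the operator \<open>X\<close> undoes that step exactly, so the two
  half chains join without normalising factors.\<close>

lemma X_extremal_vec: "X (- 1 - 2 * m) (extremal_vec m) = extremal_vec (m + 1)"
proof (cases "0 \<le> m")
  case True
  then have "nat (m + 1) = Suc (nat m)" by simp
  then show ?thesis using True by (simp add: extremal_vec_def)
next
  case False
  define k where "k = nat (- m - 1)"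
  have m: "nat (- m) = Suc k" "m = - int k - 1" using False by (auto simp: k_def)
  have "extremal_vec m = Y (- 1 - 2 * int k) (extremal_below k)"
    using False m(1) by (simp add: extremal_vec_def)
  moreover have "X (1 + 2 * int k) (Y (- 1 - 2 * int k) (extremal_below k)) = extremal_below k"
    using extremal_down(2) [OF extremal_extremal_below [of k]] by simp
  moreover have "extremal_vec (m + 1) = extremal_below k"
  proof -
    have "extremal_vec (- int k) = extremal_below k"
      by (cases "k = 0") (simp_all add: extremal_vec_def)
    then show ?thesis using m(2) by simp
  qed
  ultimately show ?thesis using m by simp
qed

lemma Y_extremal_vec: "Y (- 1 + 2 * m) (extremal_vec m) = extremal_vec (m - 1)"
proof (cases "0 < m")
  case False
  then have "nat (1 - m) = Suc (nat (- m))" by simp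
  then show ?thesis using False by (cases "m = 0") (auto simp: extremal_vec_def)
next
  case True
  define k where "k = nat (m - 1)"
  have m: "nat m = Suc k" "m = int k + 1" using True by (auto simp: k_def)
  have "extremal_vec m = X (- 1 - 2 * int k) (extremal_above k)"
    using True m(1) by (simp add: extremal_vec_def)
  moreover have "Y (2 * int k + 1) (X (- 1 - 2 * int k) (extremal_above k)) = extremal_above k"
    using extremal_up(2) [OF extremal_extremal_above [of k]] by simp
  moreover have "extremal_vec (m - 1) = extremal_above k"
    using m by (auto simp: extremal_vec_def)
  ultimately show ?thesis using m by (simp add: algebra_simps)
qed

end

text \<open>Only negative modes enter \<open>complete_op\<close>, so the correction that the
  spectral flow makes in mode 0 does not affect it.\<close>

lemma complete_op_cong:
  assumes "\<And>s u. A (- 1 - int s) u = B (- 1 - int s) u"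
  shows "complete_op scl A S u = complete_op scl B S u"
proof (induction S rule: less_induct)
  case (less S)
  show ?case
  proof (cases S)
    case (Suc T)
    have "(\<Sum>s\<le>T. A (- 1 - int s) (complete_op scl A (T - s) u))
        = (\<Sum>s\<le>T. B (- 1 - int s) (complete_op scl B (T - s) u))"
      using less Suc assms by (intro sum.cong) auto
    then show ?thesis by (simp add: Suc)
  qed simp
qed

section \<open>Commutation of y(w) with the exponential E(z)\<close>

context level_one_operators
begin

abbreviation E :: "nat \<Rightarrow> 'v \<Rightarrow> 'v" where
  "E \<equiv> complete_op scl (\<lambda>a u. - H a u)"

lemma E_Suc: "scl (of_nat (Suc S)) (E (Suc S) u) = - (\<Sum>s\<le>S. H (- 1 - int s) (E (S - s) u))"
  by (simp add: sum_negf del: of_nat_Suc)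

lemma module_hom_E: "module_hom scl scl (E s)"
proof -
  have "E s (u + w) = E s u + E s w" for u w
  proof (induction s rule: less_induct)
    case (less s)
    then show ?case
      by (cases s) (simp_all add: sum_subtractf less_Suc_eq_le sum_negf scale_right_diff_distrib del: of_nat_Suc of_nat_diff)
  qed
  moreover have "E s (scl c u) = scl c (E s u)" for c u
  proof (induction s rule: less_induct)
    case (less s)
    then show ?case
      by (cases s) (simp_all add: sum_negf less_Suc_eq_le mult.commute flip: scale_sum_right del: of_nat_Suc of_nat_diff)
  qed
  ultimately show ?thesis by unfold_locales auto
qed

lemmas E_simps [simp] = module_hom.add [OF module_hom_E] module_hom.scale [OF module_hom_E]
    module_hom.zero [OF module_hom_E] module_hom.diff [OF module_hom_E] module_hom.neg [OF module_hom_E]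

text \<open>The coefficient of z^s in z^k E(z).\<close>

definition E_shift :: "nat \<Rightarrow> nat \<Rightarrow> 'v \<Rightarrow> 'v" where
  "E_shift k s u = (if s < k then 0 else E (s - k) u)"

text \<open>Let h(z) be the sum of h t^-l z^l over l > 0. From z E'(z) = - h(z) E(z) one gets h(z)
  z^k E(z) = (k - z d/dz) (z^k E(z)).\<close>

lemma sum_H_E_shift:
  "(\<Sum>l\<le>S. H (- 1 - int l) (E_shift k (S - l) u)) = scl (of_nat k - of_nat (Suc S)) (E_shift k (Suc S) u)"
proof -
  consider "Suc S < k" | "Suc S = k" | T where "S = k + T"
    by (metis Suc_leI le_Suc_ex le_neq_implies_less linorder_le_less_linear not_less_eq)
  then show ?thesis
  proof cases
    case 3
    have "(\<Sum>l\<le>S. H (- 1 - int l) (E_shift k (S - l) u)) = (\<Sum>l\<le>T. H (- 1 - int l) (E (T - l) u))"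
      by (rule sum.mono_neutral_cong_right)
        (auto simp: 3 E_shift_def Suc_diff_le intro!: arg_cong2 [where f = H])
    also have "\<dots> = - scl (of_nat (Suc T)) (E (Suc T) u)"
      unfolding E_Suc by simp
    also have "\<dots> = scl (of_nat k - of_nat (Suc S)) (E (Suc T) u)"
      by (simp add: 3 flip: scale_minus_left del: complete_op.simps)
    finally show ?thesis by (simp add: 3 E_shift_def Suc_diff_le del: complete_op.simps)
  qed (auto simp: E_shift_def intro!: sum.neutral)
qed

text \<open>For y(w) = sum of \<open>Y a\<close> w^-a this reads y(w) E(z) = (1 - z/w)^2 E(z) y(w):
  as [h t^-l, y(w)] = -2 w^-l y(w), the factor is the exponential of -2 sum (z/w)^l / l. The proof
  obtains it from the recursion for \<open>E\<close>, by induction on the degree.\<close>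

lemma Y_E: "Y a (E s u) = E s (Y a u) - scl 2 (E_shift 1 s (Y (a - 1) u)) + E_shift 2 s (Y (a - 2) u)"
proof (induction s arbitrary: a u rule: less_induct)
  case (less s)
  show ?case
  proof (cases s)
    case 0
    then show ?thesis by (simp add: E_shift_def)
  next
    case (Suc S)
    define g where "g i = E_shift i (Suc S) (Y (a - int i) u)" for i
    have IH: "Y b (E (S - l) u) = E_shift (l + 1) (Suc S) (Y b u)
        - scl 2 (E_shift (l + 2) (Suc S) (Y (b - 1) u)) + E_shift (l + 3) (Suc S) (Y (b - 2) u)"
      if "l \<le> S" for b l
      using less [of "S - l" b] Suc that by (auto simp: E_shift_def) 
    have YH: "Y a (H (- 1 - int l) (E (S - l) u))
      = H (- 1 - int l) (E_shift 0 (S - l) (Y a u)) - scl 2 (H (- 1 - int l) (E_shift 1 (S - l) (Y (a - 1) u)))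
        + H (- 1 - int l) (E_shift 2 (S - l) (Y (a - 2) u))
        + scl 2 ((g (l + 1) - g (l + 2)) - (g (l + 2) - g (l + 3)))" if "l \<le> S" for l
    proof -
      have "Y a (H (- 1 - int l) (E (S - l) u))
        = H (- 1 - int l) (Y a (E (S - l) u)) + scl 2 (Y (a - 1 - int l) (E (S - l) u))"
        using H_Y [of "- 1 - int l" a "E (S - l) u"] by (simp add: algebra_simps)
      also have "Y (a - 1 - int l) (E (S - l) u) = (g (l + 1) - g (l + 2)) - (g (l + 2) - g (l + 3))"
        by (subst IH [OF that]) (simp add: g_def scale_2 algebra_simps)
      also have "Y a (E (S - l) u) = E_shift 0 (S - l) (Y a u)
          - scl 2 (E_shift 1 (S - l) (Y (a - 1) u)) + E_shift 2 (S - l) (Y (a - 2) u)"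
        using less [of "S - l" a u] Suc that by (simp add: E_shift_def [of 0])
      finally show ?thesis by simp
    qed
    \<comment> \<open>Commuting \<open>Y a\<close> past the modes of h produces second differences
      of \<open>g\<close>; the upper end vanishes because \<open>g i\<close> is 0 for i >
      \<open>Suc S\<close>.\<close>
    have tele: "(\<Sum>l\<le>S. (g (l + 1) - g (l + 2)) - (g (l + 2) - g (l + 3))) = g 1 - g 2"
    proof -
      have "g (S + 2) = 0" "g (S + 3) = 0" by (simp_all add: g_def E_shift_def)
      then show ?thesis
        using sum_telescope [of "\<lambda>l. g (l + 1) - g (l + 2)" S]
        by (simp add: numeral_eq_Suc)
    qed
    have "scl (of_nat (Suc S)) (Y a (E (Suc S) u)) = Y a (scl (of_nat (Suc S)) (E (Suc S) u))"
      by (simp del: complete_op.simps)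
    also have "\<dots> = - (\<Sum>l\<le>S. Y a (H (- 1 - int l) (E (S - l) u)))"
      unfolding E_Suc by (simp add: sum_simps)
    also have "\<dots> = - ((\<Sum>l\<le>S. H (- 1 - int l) (E_shift 0 (S - l) (Y a u)))
        - scl 2 (\<Sum>l\<le>S. H (- 1 - int l) (E_shift 1 (S - l) (Y (a - 1) u)))
        + (\<Sum>l\<le>S. H (- 1 - int l) (E_shift 2 (S - l) (Y (a - 2) u))) + scl 2 (g 1 - g 2))"
      unfolding tele [symmetric] scale_sum_right sum.distrib [symmetric] sum_subtractf [symmetric]
      by (intro arg_cong [where f = uminus] sum.cong refl YH) simp
    also have "\<dots> = scl (of_nat (Suc S)) (E (Suc S) (Y a u)) - scl (2 * of_nat S) (g 1)
        + scl (of_nat S - 1) (g 2) - scl 2 (g 1) + scl 2 (g 2)"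
      unfolding sum_H_E_shift by (simp add: g_def E_shift_def [of 0] algebra_simps del: complete_op.simps)
    also have "\<dots> = scl (of_nat (Suc S)) (E (Suc S) (Y a u) - scl 2 (g 1) + g 2)"
    proof -
      have "scl (2 * of_nat S) (g 1) = scl (of_nat S) (g 1) + scl (of_nat S) (g 1)"
        by (metis scale_2 scale_scale)
      then show ?thesis by (simp add: algebra_simps scale_2 del: complete_op.simps)
    qed
    finally have "Y a (E (Suc S) u) = E (Suc S) (Y a u) - scl 2 (g 1) + g 2"
      unfolding scale_cancel_left by (simp del: complete_op.simps of_nat_Suc)
    then show ?thesis by (simp add: Suc g_def del: complete_op.simps)
  qed
qed

end

section \<open>Transport of the vacuum relations to all extremal vectors\<close>

context level_one_vacuum
begin

context
  fixes m :: int
begin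

interpretation S: level_one_vacuum scl "\<lambda>a. X (a - 2 * m)" "\<lambda>a. Y (a + 2 * m)"
    "\<lambda>a u. H a u - scl (if a = 0 then of_int (2 * m) else 0) u"
    "\<lambda>u. D u + scl (of_int m) (H 0 u) - scl (of_int (m ^ 2)) u" "extremal_vec m"
  by (rule extremal_vacuum [OF extremal_extremal_vec])

lemma extremal_vec_nonzero: "extremal_vec m \<noteq> 0"
  by (rule S.v_nonzero)

lemma X_extremal_vec_eq_0: "- 2 * m \<le> a \<Longrightarrow> X a (extremal_vec m) = 0"
  using S.X_v [of "a + 2 * m"] by simp

lemma Y_extremal_vec_eq_0: "2 * m \<le> a \<Longrightarrow> Y a (extremal_vec m) = 0"
  using S.Y_v [of "a - 2 * m"] by simp

lemma H_extremal_vec_eq_0: "0 < a \<Longrightarrow> H a (extremal_vec m) = 0"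
  using S.H_v [of a] by simp

lemma H0_extremal_vec: "H 0 (extremal_vec m) = scl (of_int (2 * m)) (extremal_vec m)"
  using extremal_extremal_vec by (simp add: extremal_def)

lemma D_extremal_vec: "D (extremal_vec m) = scl (of_int (- (m ^ 2))) (extremal_vec m)"
  using extremal_extremal_vec by (simp add: extremal_def)

lemma X_extremal_vec_eq_complete_op:
  "X (- 1 - 2 * m - int s) (extremal_vec m) = complete_op scl H s (extremal_vec (m + 1))"
proof -
  have e: "- 1 - 2 * m - int s = - 1 - int s - 2 * m" by simp
  show ?thesis
    unfolding e using S.X_eq_complete_op [of s] X_extremal_vec [of m]
      complete_op_cong [of "\<lambda>a u. H a u - scl (if a = 0 then of_int (2 * m) else 0) u" H scl s]
    by simp
qed

lemma Y_extremal_vec_eq_E: "Y (- 1 + 2 * m - int s) (extremal_vec m) = E s (extremal_vec (m - 1))"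
proof -
  have e: "- 1 + 2 * m - int s = - 1 - int s + 2 * m" by simp
  show ?thesis
    unfolding e using S.Y_eq_complete_op [of s] Y_extremal_vec [of m]
      complete_op_cong [of "\<lambda>a u. - (H a u - scl (if a = 0 then of_int (2 * m) else 0) u)"
        "\<lambda>a u. - H a u" scl s]
    by simp
qed

lemma Y_extremal_vec_quadratic:
  "(\<Sum>s\<le>S. Y (- 1 + 2 * m - int s) (Y (- 1 + 2 * m - int (S - s)) (extremal_vec m))) = 0"
proof -
  have e: "- 1 + 2 * m - s = - 1 - s + 2 * m" for s :: int by simp
  show ?thesis unfolding e by (rule S.Y_quadratic)
qed

end

end

section \<open>Heisenberg monomials and weight spaces\<close>

context vector_space
begin

text \<open>Eigenvalues are attached to indices, and several indices may give one vector; choosing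
  an index for each vector reduces this to \<open>eigenvectors_span\<close>.\<close>

lemma eigenvectors_span_image:
  assumes A: "module_hom scale scale A"
    and eig: "\<And>i. i \<in> I \<Longrightarrow> A (f i) = scale (\<kappa> i) (f i)"
    and w: "w \<in> span (f ` I)" and Aw: "A w = scale a w"
  shows "w \<in> span (f ` {i \<in> I. \<kappa> i = a})"
proof -
  define g where "g s = (SOME i. i \<in> I \<and> f i = s)" for s
  have g: "g s \<in> I \<and> f (g s) = s" if "s \<in> f ` I" for s
    unfolding g_def by (rule someI_ex) (use that in blast)
  have "w \<in> span {s \<in> f ` I. \<kappa> (g s) = a}"
    by (rule eigenvectors_span [OF A _ w Aw]) (use g eig in metis)
  moreover have "{s \<in> f ` I. \<kappa> (g s) = a} \<subseteq> f ` {i \<in> I. \<kappa> i = a}"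
  proof
    fix s assume "s \<in> {s \<in> f ` I. \<kappa> (g s) = a}"
    then have "g s \<in> {i \<in> I. \<kappa> i = a}" "s = f (g s)" using g [of s] by auto
    then show "s \<in> f ` {i \<in> I. \<kappa> i = a}" by (rule rev_image_eqI)
  qed
  ultimately show ?thesis using span_mono by blast
qed

end

context level_one_operators
begin

lemma complete_op_closed:
  assumes W: "subspace W" and A: "\<And>l u. u \<in> W \<Longrightarrow> A (- 1 - int l) u \<in> W"
    and u: "u \<in> W"
  shows "complete_op scl A s u \<in> W"
proof (induction s rule: less_induct)
  case (less s)
  then show ?case
    by (cases s) (auto simp del: of_nat_Suc of_nat_diff simp: u less_Suc_eq_le
        intro!: subspace_scale [OF W] subspace_sum [OF W] A)
qed


text \<open>An entry \<open>l\<close> stands for h t^(-1-l), so that natural numbers enumerate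
  exactly the negative modes; it lowers the eigenvalue of \<open>D\<close> by
  \<open>Suc l\<close>.\<close>

primrec H_mon :: "nat list \<Rightarrow> 'v \<Rightarrow> 'v" where
  "H_mon [] u = u"
| "H_mon (l # ls) u = H (- 1 - int l) (H_mon ls u)"

primrec E_mon :: "nat list \<Rightarrow> 'v \<Rightarrow> 'v" where
  "E_mon [] u = u"
| "E_mon (s # ss) u = E s (E_mon ss u)"

lemma H0_H_mon: "H 0 (H_mon ls u) = H_mon ls (H 0 u)"
  by (induction ls) (simp_all add: H_H [of 0 "- 1 - int _"])

lemma H_mon_scale [simp]: "H_mon ls (scl c u) = scl c (H_mon ls u)"
  by (induction ls) simp_all

lemma D_H_mon:
  "D u = scl c u \<Longrightarrow> D (H_mon ls u) = scl (c - of_nat (sum_list (map Suc ls))) (H_mon ls u)"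
proof (induction ls)
  case (Cons l ls)
  then show ?case
    by (simp add: D_H del: scale_cancel_right flip: scale_left_distrib) (simp add: algebra_simps)
qed simp

lemma E_mon_drop_zeros: "E_mon (filter (\<lambda>s. s \<noteq> 0) ss) u = E_mon ss u"
  by (induction ss) (auto split: if_splits)

lemma E_mon_replicate_0: "E_mon (replicate k 0 @ ss) u = E_mon ss u"
  by (induction k) simp_all

definition E_mon_span :: "'v \<Rightarrow> nat \<Rightarrow> 'v set" where
  "E_mon_span u d = span ((\<lambda>ss. E_mon ss u) ` {ss. sum_list ss = d})"

lemma E_mon_span_E: "w \<in> E_mon_span u d \<Longrightarrow> E s w \<in> E_mon_span u (s + d)"
  unfolding E_mon_span_def
proof (rule module_hom_span_closed [OF module_hom_E])
  fix t assume "t \<in> (\<lambda>ss. E_mon ss u) ` {ss. sum_list ss = d}"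
  then obtain ss where "t = E_mon ss u" "sum_list ss = d" by blast
  then have "E s t = E_mon (s # ss) u" "sum_list (s # ss) = s + d" by simp_all
  then show "E s t \<in> span ((\<lambda>ss. E_mon ss u) ` {ss. sum_list ss = s + d})"
    by (intro span_base) blast
qed

text \<open>Newton's identities solved for the power sum: the recursion for \<open>E (Suc l)\<close>
  expresses \<open>H (- 1 - int l)\<close> through \<open>E (Suc l)\<close> and terms with smaller
  modes.\<close>

lemma E_mon_span_H: "w \<in> E_mon_span u d \<Longrightarrow> H (- 1 - int l) w \<in> E_mon_span u (Suc l + d)"
proof (induction l arbitrary: w d rule: less_induct)
  case (less l)
  have sub: "subspace (E_mon_span u k)" for k by (simp add: E_mon_span_def)
  have "H (- 1 - int i) (E (l - i) w) \<in> E_mon_span u (Suc l + d)" if "i < l" for i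
    using less.IH [OF that E_mon_span_E [OF less.prems, of "l - i"]] that by simp
  moreover have "E (Suc l) w \<in> E_mon_span u (Suc l + d)"
    by (rule E_mon_span_E [OF less.prems])
  moreover have "H (- 1 - int l) w = - scl (of_nat (Suc l)) (E (Suc l) w)
      - (\<Sum>i<l. H (- 1 - int i) (E (l - i) w))"
    unfolding E_Suc by (simp flip: lessThan_Suc_atMost)
  ultimately show ?case
    by (auto intro!: subspace_diff [OF sub] subspace_neg [OF sub] subspace_scale [OF sub]
        subspace_sum [OF sub] simp del: complete_op.simps)
qed

lemma H_mon_in_E_mon_span: "H_mon ls u \<in> E_mon_span u (sum_list (map Suc ls))"
proof (induction ls)
  case Nil
  have "[] \<in> {ss. sum_list ss = (0::nat)}" by simp
  then have "E_mon [] u \<in> (\<lambda>ss. E_mon ss u) ` {ss. sum_list ss = 0}" by blast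
  then show ?case by (simp add: E_mon_span_def span_base)
next
  case (Cons l ls)
  then show ?case using E_mon_span_H by simp
qed

lemma length_le_sum_list: "\<forall>s\<in>set ss. s \<noteq> 0 \<Longrightarrow> length ss \<le> sum_list (ss :: nat list)"
  by (induction ss) auto

lemma E_mon_span_length:
  assumes "d \<le> r"
  shows "E_mon_span u d = span ((\<lambda>ss. E_mon ss u) ` {ss. length ss = r \<and> sum_list ss = d})"
proof -
  have "(\<lambda>ss. E_mon ss u) ` {ss. sum_list ss = d} \<subseteq> (\<lambda>ss. E_mon ss u) ` {ss. length ss = r \<and> sum_list ss = d}"
  proof safe
    fix ss :: "nat list" assume d: "d = sum_list ss"
    define ts where "ts = filter (\<lambda>s. s \<noteq> 0) ss"
    have sum: "sum_list ts = sum_list ss" unfolding ts_def by (induction ss) auto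
    have "length ts \<le> r" using length_le_sum_list [of ts] sum d assms by (simp add: ts_def)
    then have "length (replicate (r - length ts) 0 @ ts) = r"
      "sum_list (replicate (r - length ts) 0 @ ts) = sum_list ss"
      using sum by (simp_all add: sum_list_replicate)
    moreover have "E_mon ss u = E_mon (replicate (r - length ts) 0 @ ts) u"
      by (simp only: E_mon_replicate_0 ts_def E_mon_drop_zeros)
    ultimately show "E_mon ss u \<in> (\<lambda>ss. E_mon ss u) ` {ts. length ts = r \<and> sum_list ts = sum_list ss}"
      by blast
  qed
  then show ?thesis
    unfolding E_mon_span_def by (intro antisym span_mono) auto
qed

end

context level_one_vacuum
begin

text \<open>The span is a submodule containing \<open>v\<close>. On an extremal vector
  \<open>X\<close> and \<open>Y\<close> give a Heisenberg polynomial times the neighbouring extremal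
  vector, and moving them past negative modes of h changes only their own mode.\<close>

lemma span_H_mon: "span (range (\<lambda>(j, ls). H_mon ls (extremal_vec j))) = UNIV"
proof -
  let ?f = "\<lambda>(j, ls). H_mon ls (extremal_vec j)"
  define G where "G = span (range ?f)"
  have sub: "subspace G" by (simp add: G_def)
  have base: "H_mon ls (extremal_vec j) \<in> G" for ls j
    unfolding G_def by (rule span_base) (rule image_eqI [of _ _ "(j, ls)"], auto)
  have ext: "A u \<in> G" if "module_hom scl scl A" "\<And>ls j. A (H_mon ls (extremal_vec j)) \<in> G" "u \<in> G"
    for A u
  proof -
    have "A s \<in> span (range ?f)" if "s \<in> range ?f" for s
      using that \<open>\<And>ls j. A (H_mon ls (extremal_vec j)) \<in> G\<close> by (auto simp: G_def)
    then show ?thesis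
      using module_hom_span_closed [OF that(1), of "range ?f" "range ?f" u] that(3) by (simp only: G_def)
  qed
  have Hm: "H (- 1 - int l) u \<in> G" if "u \<in> G" for l u
    by (rule ext [OF hom_H _ that]) (use base [of "l # _"] in simp)
  have H: "H a (H_mon ls (extremal_vec j)) \<in> G" if a: "0 \<le> a" for a ls j
  proof (induction ls)
    case Nil
    show ?case
      using a H0_extremal_vec H_extremal_vec_eq_0 [of a] base [of "[]" j]
      by (cases "a = 0") (auto intro!: subspace_scale [OF sub] subspace_0 [OF sub])
  next
    case (Cons l ls)
    then show ?case
      unfolding H_mon.simps H_H [of a]
      by (intro subspace_add [OF sub] subspace_scale [OF sub] Hm base)
  qed
  have H': "H a u \<in> G" if "u \<in> G" for a u
  proof (cases "0 \<le> a")
    case True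
    show ?thesis by (rule ext [OF hom_H H [OF True] that])
  next
    case False
    then have "a = - 1 - int (nat (- 1 - a))" by simp
    then show ?thesis using Hm [OF that] by metis
  qed
  have cH: "complete_op scl H s u \<in> G" if "u \<in> G" for s u
    by (rule complete_op_closed [OF sub _ that]) (rule Hm)
  have cE: "E s u \<in> G" if "u \<in> G" for s u
    by (rule complete_op_closed [OF sub _ that]) (intro subspace_neg [OF sub] Hm)
  have X: "X a (H_mon ls (extremal_vec j)) \<in> G" for a ls j
  proof (induction ls arbitrary: a)
    case Nil
    show ?case
    proof (cases "- 2 * j \<le> a")
      case True
      then show ?thesis using X_extremal_vec_eq_0 subspace_0 [OF sub] by simp
    next
      case False
      then have "a = - 1 - 2 * j - int (nat (- 1 - 2 * j - a))" by simp
      then show ?thesis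
        using X_extremal_vec_eq_complete_op [of j] cH base [of "[]" "j + 1"] H_mon.simps(1) by metis
    qed
  next
    case (Cons l ls)
    have "X a (H_mon (l # ls) (extremal_vec j)) = H (- 1 - int l) (X a (H_mon ls (extremal_vec j)))
        - scl 2 (X (- 1 - int l + a) (H_mon ls (extremal_vec j)))"
      by (simp add: H_X)
    then show ?case by (simp only:) (intro subspace_diff [OF sub] subspace_scale [OF sub] Hm Cons)
  qed
  have Y: "Y a (H_mon ls (extremal_vec j)) \<in> G" for a ls j
  proof (induction ls arbitrary: a)
    case Nil
    show ?case
    proof (cases "2 * j \<le> a")
      case True
      then show ?thesis using Y_extremal_vec_eq_0 subspace_0 [OF sub] by simp
    next
      case False
      then have "a = - 1 + 2 * j - int (nat (- 1 + 2 * j - a))" by simp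
      then show ?thesis
        using Y_extremal_vec_eq_E [of j] cE base [of "[]" "j - 1"] H_mon.simps(1) by metis
    qed
  next
    case (Cons l ls)
    have "Y a (H_mon (l # ls) (extremal_vec j)) = H (- 1 - int l) (Y a (H_mon ls (extremal_vec j)))
        - scl (- 2) (Y (- 1 - int l + a) (H_mon ls (extremal_vec j)))"
      by (simp add: H_Y)
    then show ?case by (simp only:) (intro subspace_diff [OF sub] subspace_scale [OF sub] Hm Cons)
  qed
  have D: "D (H_mon ls (extremal_vec j)) \<in> G" for ls j
    unfolding D_H_mon [OF D_extremal_vec] by (intro subspace_scale [OF sub] base)
  have "G = {0} \<or> G = UNIV"
    by (rule irreducible [OF sub ext [OF hom_X X] ext [OF hom_Y Y] H' ext [OF hom_D D]])
  moreover have "v \<in> G" using base [of "[]" 0] by (simp add: extremal_vec_0)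
  ultimately show ?thesis using v_nonzero by (auto simp: G_def)
qed

definition wspace :: "int \<Rightarrow> nat \<Rightarrow> 'v set" where
  "wspace j d = {u. H 0 u = scl (of_int (2 * j)) u \<and> D u = scl (of_int (- (j ^ 2) - int d)) u}"

lemma joint_eigenvector_in_span:
  assumes "H 0 w = scl h w" "D w = scl e w"
  shows "w \<in> span ((\<lambda>(j, ls). H_mon ls (extremal_vec j)) `
    {(j, ls). of_int (2 * j) = h \<and> of_int (- (j ^ 2) - int (sum_list (map Suc ls))) = e})"
proof -
  let ?f = "\<lambda>(j, ls). H_mon ls (extremal_vec j)"
  have "w \<in> span (?f ` {i \<in> UNIV. (case i of (j, ls) \<Rightarrow> of_int (2 * j)) = h})"
    by (rule eigenvectors_span_image [OF hom_H _ _ assms(1)])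
      (auto simp: H0_H_mon H0_extremal_vec span_H_mon)
  then have "w \<in> span (?f ` {i \<in> {i \<in> UNIV. (case i of (j, ls) \<Rightarrow> of_int (2 * j)) = h}.
      (case i of (j, ls) \<Rightarrow> of_int (- (j ^ 2) - int (sum_list (map Suc ls)))) = e})"
    by (intro eigenvectors_span_image [OF hom_D _ _ assms(2)])
      (auto simp: D_H_mon [OF D_extremal_vec])
  also have "{i \<in> {i \<in> UNIV. (case i of (j, ls) \<Rightarrow> of_int (2 * j)) = h}.
      (case i of (j, ls) \<Rightarrow> of_int (- (j ^ 2) - int (sum_list (map Suc ls)))) = e} = 
     {(j, ls). of_int (2 * j) = h \<and> of_int (- (j ^ 2) - int (sum_list (map Suc ls))) = e}"
    by auto
  finally show ?thesis .
qed

text \<open>If no pair (j, d) matched, the spanning set cut down to these eigenvalues would be empty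
  and \<open>w\<close> would be 0.\<close>

lemma joint_eigenvector_wspace:
  assumes "H 0 w = scl h w" "D w = scl e w" "w \<noteq> 0"
  shows "\<exists>j d. w \<in> wspace j d \<and> h = of_int (2 * j) \<and> e = of_int (- (j ^ 2) - int d)"
proof (rule ccontr)
  assume n: "\<not> ?thesis"
  have "{(j, ls). of_int (2 * j) = h \<and> of_int (- (j ^ 2) - int (sum_list (map Suc ls))) = e} = {}"
    using n assms(1,2) by (auto simp: wspace_def)
  then show False using joint_eigenvector_in_span [OF assms(1,2)] assms(3)
    by (simp only: image_empty span_empty) simp
qed

lemma wspace_subset_E_mon_span: "wspace j d \<subseteq> E_mon_span (extremal_vec j) d"
proof
  fix w assume "w \<in> wspace j d"
  then have w: "H 0 w = scl (of_int (2 * j)) w" "D w = scl (of_int (- (j ^ 2) - int d)) w"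
    by (auto simp: wspace_def)
  have "w \<in> span ((\<lambda>(j, ls). H_mon ls (extremal_vec j)) `
    {(j', ls). of_int (2 * j') = (of_int (2 * j) :: complex)
      \<and> of_int (- (j' ^ 2) - int (sum_list (map Suc ls))) = (of_int (- (j ^ 2) - int d) :: complex)})"
    by (rule joint_eigenvector_in_span [OF w])
  also have "\<dots> \<subseteq> E_mon_span (extremal_vec j) d"
  proof (rule span_minimal)
    show "subspace (E_mon_span (extremal_vec j) d)" by (simp add: E_mon_span_def)
  qed (use H_mon_in_E_mon_span in \<open>auto simp only: of_int_eq_iff; force\<close>)
  finally show "w \<in> E_mon_span (extremal_vec j) d" .
qed

end

section \<open>Pairing of positive with negative Heisenberg modes\<close>

context level_one_operators
begin

interpretation H_neg: comp_fun_commute "\<lambda>l. H (- 1 - int l)"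
proof
  show "H (- 1 - int l) \<circ> H (- 1 - int k) = H (- 1 - int k) \<circ> H (- 1 - int l)" for l k
    using H_H [of "- 1 - int l" "- 1 - int k"] by (simp add: fun_eq_iff)
qed

interpretation H_pos: comp_fun_commute "\<lambda>l. H (1 + int l)"
proof
  show "H (1 + int l) \<circ> H (1 + int k) = H (1 + int k) \<circ> H (1 + int l)" for l k
    using H_H [of "1 + int l" "1 + int k"] by (simp add: fun_eq_iff)
qed

definition H_neg_mset :: "nat multiset \<Rightarrow> 'v \<Rightarrow> 'v" where
  "H_neg_mset N u = fold_mset (\<lambda>l. H (- 1 - int l)) u N"

definition H_pos_mset :: "nat multiset \<Rightarrow> 'v \<Rightarrow> 'v" where
  "H_pos_mset N u = fold_mset (\<lambda>l. H (1 + int l)) u N"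

lemma H_neg_mset_simps [simp]:
  "H_neg_mset {#} u = u" "H_neg_mset (add_mset l N) u = H (- 1 - int l) (H_neg_mset N u)"
  by (simp_all add: H_neg_mset_def)

lemma H_pos_mset_simps [simp]:
  "H_pos_mset {#} u = u" "H_pos_mset (add_mset l N) u = H (1 + int l) (H_pos_mset N u)"
  by (simp_all add: H_pos_mset_def)

lemma module_hom_H_pos_mset: "module_hom scl scl (H_pos_mset M)"
  by unfold_locales (induction M; simp)+

lemma H_neg_mset_eigen:
  assumes "H 0 u = scl h u" "D u = scl e u"
  shows "H 0 (H_neg_mset N u) = scl h (H_neg_mset N u)"
    "D (H_neg_mset N u) = scl (e - of_nat (\<Sum>l\<in>#N. Suc l)) (H_neg_mset N u)"
proof (induction N)
  case (add l N)
  show "H 0 (H_neg_mset (add_mset l N) u) = scl h (H_neg_mset (add_mset l N) u)"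
    using add.IH by (simp add: H_H [of 0 "- 1 - int _"])
  show "D (H_neg_mset (add_mset l N) u) = scl (e - of_nat (\<Sum>l\<in>#add_mset l N. Suc l)) (H_neg_mset (add_mset l N) u)"
    using add.IH by (simp add: D_H del: scale_cancel_right flip: scale_left_distrib) (simp add: algebra_simps)
qed (use assms in auto)

text \<open>By the Heisenberg relations a positive mode acts as 2 (l + 1) times the partial
  derivative with respect to the opposite negative mode.\<close>

lemma H_derivation:
  assumes "H (1 + int l) u = 0"
  shows "H (1 + int l) (H_neg_mset N u) = scl (2 * of_nat (Suc l * count N l)) (H_neg_mset (N - {#l#}) u)"
proof (induction N)
  case empty
  show ?case using assms by simp
next
  case (add x N)
  show ?case
  proof (cases "x = l")
    case True
    have "H (- 1 - int l) (H_neg_mset (N - {#l#}) u) = H_neg_mset N u" if "l \<in># N"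
      using H_neg_mset_simps(2) [of l "N - {#l#}" u] that by simp
    then have "scl (2 * of_nat (Suc l * count N l)) (H (- 1 - int l) (H_neg_mset (N - {#l#}) u))
        = scl (2 * of_nat (Suc l * count N l)) (H_neg_mset N u)"
      by (cases "l \<in># N") (auto simp: not_in_iff)
    then have "H (1 + int l) (H_neg_mset (add_mset x N) u)
      = scl (2 * of_nat (Suc l * count N l)) (H_neg_mset N u) + scl (2 * of_nat (Suc l)) (H_neg_mset N u)"
      using True by (simp add: H_H [of "1 + int l" "- 1 - int l"] add)
    then show ?thesis using True by (simp add: algebra_simps flip: scale_left_distrib)
  next
    case False
    have "N - {#l#} + {#x#} = add_mset x N - {#l#}" using False by auto
    then have "H (- 1 - int x) (H_neg_mset (N - {#l#}) u) = H_neg_mset (add_mset x N - {#l#}) u"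
      using H_neg_mset_simps(2) [of x "N - {#l#}" u] by simp
    then show ?thesis
      using False by (simp add: H_H [of "1 + int l" "- 1 - int x"] add)
  qed
qed

text \<open>Iterated differentiation of a monomial, which survives exactly when each derivative
  meets a remaining factor.\<close>

lemma H_pos_neg_pairing:
  assumes "\<And>l. H (1 + int l) u = 0"
  shows "\<exists>c. H_pos_mset M (H_neg_mset N u) = scl c (H_neg_mset (N - M) u) \<and> (c \<noteq> 0 \<longleftrightarrow> M \<subseteq># N)"
proof (induction M)
  case empty
  show ?case by (intro exI [of _ 1]) simp
next
  case (add l M)
  then obtain c where c: "H_pos_mset M (H_neg_mset N u) = scl c (H_neg_mset (N - M) u)"
    "c \<noteq> 0 \<longleftrightarrow> M \<subseteq># N" by blast
  define c' where "c' = c * (2 * of_nat (Suc l * count (N - M) l))"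
  have "H_pos_mset (add_mset l M) (H_neg_mset N u) = scl c' (H_neg_mset (N - add_mset l M) u)"
    by (simp add: c H_derivation [OF assms] c'_def del: of_nat_Suc of_nat_mult)
  moreover have "c' \<noteq> 0 \<longleftrightarrow> M \<subseteq># N \<and> l \<in># N - M"
  proof -
    have "c' \<noteq> 0 \<longleftrightarrow> c \<noteq> 0 \<and> count (N - M) l \<noteq> 0"
      unfolding c'_def mult_eq_0_iff of_nat_mult of_nat_eq_0_iff by simp
    then show ?thesis using c(2) by (simp only: count_eq_zero_iff) simp
  qed
  moreover have "M \<subseteq># N \<and> l \<in># N - M \<longleftrightarrow> add_mset l M \<subseteq># N"
  proof
    assume L: "M \<subseteq># N \<and> l \<in># N - M"
    then obtain K where K: "N = M + K" by (auto simp: mset_subset_eq_exists_conv)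
    with L obtain K' where "K = add_mset l K'" by (auto dest: mset_add)
    with K show "add_mset l M \<subseteq># N" by simp
  next
    assume "add_mset l M \<subseteq># N"
    then obtain K where "N = add_mset l M + K" by (auto simp: mset_subset_eq_exists_conv)
    then show "M \<subseteq># N \<and> l \<in># N - M" by simp
  qed
  ultimately show ?case by blast
qed

end

context level_one_vacuum
begin

text \<open>Among monomials of equal degree each is killed by the derivatives belonging to any
  other, so the pairing is diagonal with non-zero diagonal.\<close>

lemma H_neg_mset_independent:
  assumes "\<And>i. i \<in> I \<Longrightarrow> (\<Sum>l\<in>#f i. Suc l) = d" and "inj_on f I"
  shows "inj_on (\<lambda>i. H_neg_mset (f i) (extremal_vec j)) I"
    "independent ((\<lambda>i. H_neg_mset (f i) (extremal_vec j)) ` I)"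
proof -
  define e where "e = extremal_vec j"
  have H0: "H (1 + int l) e = 0" for l by (simp add: e_def H_extremal_vec_eq_0)
  have same: "H_pos_mset (f i) (H_neg_mset (f i) e) \<noteq> 0" for i
    using H_pos_neg_pairing [of e "f i" "f i", OF H0] extremal_vec_nonzero by (auto simp: e_def)
  have diff: "H_pos_mset (f i) (H_neg_mset (f k) e) = 0" if "i \<in> I" "k \<in> I" "i \<noteq> k" for i k
  proof -
    have "\<not> f i \<subseteq># f k"
    proof
      assume "f i \<subseteq># f k"
      then obtain K where K: "f k = f i + K" by (auto simp: mset_subset_eq_exists_conv)
      \<comment> \<open>Equal total degree leaves no room for \<open>K\<close>, each of whose
        entries counts at least 1.\<close>
      then have "(\<Sum>l\<in>#K. Suc l) = 0" 
        using assms(1) [OF that(1)] assms(1) [OF that(2)] by simp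
      then have "K = {#}" by (cases K) auto
      then show False using K assms(2) that by (auto dest: inj_onD)
    qed
    then show ?thesis using H_pos_neg_pairing [of e "f i" "f k", OF H0] by auto
  qed
  have inj: "inj_on (\<lambda>i. H_neg_mset (f i) e) I"
    by (rule inj_onI) (metis same diff)
  then show "inj_on (\<lambda>i. H_neg_mset (f i) (extremal_vec j)) I" by (simp add: e_def)
  have "independent ((\<lambda>i. H_neg_mset (f i) e) ` I)"
  proof
    assume "dependent ((\<lambda>i. H_neg_mset (f i) e) ` I)"
    then obtain i where i: "i \<in> I"
      "H_neg_mset (f i) e \<in> span ((\<lambda>i. H_neg_mset (f i) e) ` I - {H_neg_mset (f i) e})"
      by (auto simp: dependent_def)
    have "H_pos_mset (f i) (H_neg_mset (f i) e) \<in> span {}"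
    proof (rule module_hom_span_closed [OF module_hom_H_pos_mset _ i(2)])
      fix s assume "s \<in> (\<lambda>i. H_neg_mset (f i) e) ` I - {H_neg_mset (f i) e}"
      then obtain k where "k \<in> I" "s = H_neg_mset (f k) e" "k \<noteq> i" by auto
      then show "H_pos_mset (f i) s \<in> span {}" using diff [of i k] i(1) by (simp add: span_zero)
    qed
    then show False using same by (simp only: span_empty) simp
  qed
  then show "independent ((\<lambda>i. H_neg_mset (f i) (extremal_vec j)) ` I)" by (simp add: e_def)
qed

end

section \<open>Products of vertex operators\<close>

text \<open>For \<open>card S = r\<close>, this is the complete symmetric polynomial of degree \<open>s - (r - 1)\<close> in the elements
  of \<open>S\<close>, and \<open>0\<close> if \<open>s < r - 1\<close>.\<close>

definition lagrange_sum :: "'a::field set \<Rightarrow> nat \<Rightarrow> 'a" where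
  "lagrange_sum S s = (\<Sum>x\<in>S. x ^ s / (\<Prod>y\<in>S - {x}. x - y))"

text \<open>The factor x - z of x^(s+1) - z x^s cancels the one that z puts into each denominator,
  and the summand x = z drops out. It is the recursion h_i(S, z) = z h_{i-1}(S, z) + h_i(S).\<close>

lemma lagrange_sum_insert:
  assumes "finite S" "z \<notin> S"
  shows "lagrange_sum (insert z S) (Suc s) = z * lagrange_sum (insert z S) s + lagrange_sum S s"
proof -
  have "lagrange_sum (insert z S) (Suc s) - z * lagrange_sum (insert z S) s
    = (\<Sum>x\<in>insert z S. (x - z) * x ^ s / (\<Prod>y\<in>insert z S - {x}. x - y))"
    unfolding lagrange_sum_def sum_distrib_left sum_subtractf [symmetric]
    by (intro sum.cong refl) (simp add: diff_divide_distrib left_diff_distrib)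
  also have "\<dots> = (\<Sum>x\<in>S. (x - z) * x ^ s / (\<Prod>y\<in>insert z S - {x}. x - y))"
    using assms by simp
  also have "\<dots> = lagrange_sum S s"
    unfolding lagrange_sum_def
  proof (intro sum.cong refl)
    fix x assume x: "x \<in> S"
    have "insert z S - {x} = insert z (S - {x})" using x assms by auto
    then have "(\<Prod>y\<in>insert z S - {x}. x - y) = (x - z) * (\<Prod>y\<in>S - {x}. x - y)"
      using assms x by simp
    moreover have "x - z \<noteq> 0" using x assms by auto
    ultimately show "(x - z) * x ^ s / (\<Prod>y\<in>insert z S - {x}. x - y)
        = x ^ s / (\<Prod>y\<in>S - {x}. x - y)" by simp
  qed
  finally show ?thesis by (simp add: algebra_simps)
qed

text \<open>Removing either of two elements a, b gives a L + L_a = b L + L_b with the sums L_a, L_b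
  over the smaller sets. These agree: both are 1 if two elements were present, otherwise both are 0
  by induction. Hence (a - b) L = 0.\<close>

lemma lagrange_sum_0:
  assumes "finite S" "2 \<le> card S"
  shows "lagrange_sum S 0 = 0"
  using assms
proof (induction "card S" arbitrary: S rule: less_induct)
  case less
  obtain a b where ab: "a \<in> S" "b \<in> S" "a \<noteq> b"
    using less.prems by (metis card_le_Suc0_iff_eq not_less_eq_eq numeral_2_eq_2)
  have rec: "lagrange_sum S 1 = c * lagrange_sum S 0 + lagrange_sum (S - {c}) 0" if "c \<in> S" for c
    using lagrange_sum_insert [of "S - {c}" c 0] less.prems(1) that by (simp add: insert_absorb)
  have "lagrange_sum (S - {a}) 0 = lagrange_sum (S - {b}) 0"
  proof (cases "card S = 2")
    case True
    have "lagrange_sum (S - {c}) 0 = 1" if "c \<in> S" for c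
    proof -
      have "card (S - {c}) = 1" using True that less.prems(1) by simp
      then obtain z where "S - {c} = {z}" by (auto simp: card_1_singleton_iff)
      then show ?thesis by (simp add: lagrange_sum_def)
    qed
    then show ?thesis using ab by simp
  next
    case False
    have "lagrange_sum (S - {c}) 0 = 0" if "c \<in> S" for c
    proof (rule less.hyps)
      show "card (S - {c}) < card S" using that less.prems(1) by (intro card_Diff1_less)
      show "2 \<le> card (S - {c})" using False less.prems that by simp
    qed (use less.prems in auto)
    then show ?thesis using ab by simp
  qed
  with rec [OF ab(1)] rec [OF ab(2)] have "(a - b) * lagrange_sum S 0 = 0"
    by (simp add: algebra_simps)
  then show ?case using ab(3) by simp
qed

lemma lagrange_sum_eq:
  assumes "finite S" "s < card S"
  shows "lagrange_sum S s = (if Suc s = card S then 1 else 0)"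
  using assms
proof (induction s arbitrary: S)
  case 0
  show ?case
  proof (cases "card S = 1")
    case True
    then obtain z where "S = {z}" by (auto simp: card_1_singleton_iff)
    then show ?thesis by (simp add: lagrange_sum_def)
  next
    case False
    then show ?thesis using 0 lagrange_sum_0 [of S] by simp
  qed
next
  case (Suc s)
  then obtain z where z: "z \<in> S" by fastforce
  have c: "card (S - {z}) = card S - 1" using z Suc.prems by simp
  have "lagrange_sum S (Suc s) = z * lagrange_sum S s + lagrange_sum (S - {z}) s"
    using lagrange_sum_insert [of "S - {z}" z s] Suc.prems(1) z by (simp add: insert_absorb)
  moreover have "lagrange_sum S s = 0" using Suc.IH [of S] Suc.prems by simp
  moreover have "lagrange_sum (S - {z}) s = (if Suc s = card S - 1 then 1 else 0)"
    using Suc.IH [of "S - {z}"] Suc.prems c by simp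
  ultimately show ?case using Suc.prems by auto
qed

text \<open>A pair k < i occurs as u_k - u_i and as its negative, so it contributes minus a square;
  the index i is the larger member of i pairs.\<close>

lemma prod_differences_sign:
  fixes u :: "nat \<Rightarrow> 'a::comm_ring_1"
  shows "(\<Prod>i<r. \<Prod>l\<in>{..<r} - {i}. u i - u l)
    = (\<Prod>i<r. (- 1) ^ i) * (\<Prod>i<r. \<Prod>k<i. (u k - u i) ^ 2)"
proof (induction r)
  case (Suc r)
  have "(\<Prod>l\<in>{..<Suc r} - {i}. u i - u l) = (u i - u r) * (\<Prod>l\<in>{..<r} - {i}. u i - u l)" if "i < r" for i
  proof -
    have "{..<Suc r} - {i} = insert r ({..<r} - {i})" using that by auto
    then show ?thesis by simp
  qed
  moreover have "{..<Suc r} - {r} = {..<r}" by auto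
  ultimately have "(\<Prod>i<Suc r. \<Prod>l\<in>{..<Suc r} - {i}. u i - u l)
    = (\<Prod>i<r. u i - u r) * (\<Prod>i<r. \<Prod>l\<in>{..<r} - {i}. u i - u l) * (\<Prod>l<r. u r - u l)"
    by (simp add: prod.distrib)
  also have "(\<Prod>l<r. u r - u l) = (\<Prod>l<r. - 1 * (u l - u r))" by simp
  also have "\<dots> = (- 1) ^ r * (\<Prod>l<r. u l - u r)" by (subst prod.distrib) simp
  finally show ?case
    unfolding Suc prod.lessThan_Suc power2_eq_square prod.distrib by (simp only: ac_simps)
qed simp

section \<open>Series with coefficients in the module; exchange of y(a) with E(b)\<close>

context level_one_operators
begin

text \<open>Sequences stand for formal power series in a grading variable with coefficients in the
  module.\<close>

definition series :: "(nat \<Rightarrow> 'v \<Rightarrow> 'v) \<Rightarrow> (nat \<Rightarrow> 'v) \<Rightarrow> nat \<Rightarrow> 'v" where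
  "series F \<phi> n = (\<Sum>s\<le>n. F s (\<phi> (n - s)))"

definition shift_seq :: "nat \<Rightarrow> (nat \<Rightarrow> 'v) \<Rightarrow> nat \<Rightarrow> 'v" where
  "shift_seq k \<phi> n = (if n < k then 0 else \<phi> (n - k))"

definition scale_seq :: "complex \<Rightarrow> (nat \<Rightarrow> 'v) \<Rightarrow> nat \<Rightarrow> 'v" where
  "scale_seq c \<phi> n = scl c (\<phi> n)"

definition const_seq :: "'v \<Rightarrow> nat \<Rightarrow> 'v" where
  "const_seq u n = (if n = 0 then u else 0)"

lemma series_series:
  assumes "\<And>s. module_hom scl scl (F s)"
  shows "series F (series G \<phi>) n = (\<Sum>N\<le>n. \<Sum>s\<le>N. F s (G (N - s) (\<phi> (n - N))))"
proof -
  have "series F (series G \<phi>) n = (\<Sum>s\<le>n. \<Sum>t\<le>n - s. F s (G t (\<phi> (n - s - t))))"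
    unfolding series_def by (simp add: module_hom.sum [OF assms])
  also have "\<dots> = (\<Sum>(s, t)\<in>{(i, j). i + j \<le> n}. F s (G t (\<phi> (n - s - t))))"
    by (subst sum.Sigma) (auto intro!: sum.cong)
  also have "\<dots> = (\<Sum>N\<le>n. \<Sum>s\<le>N. F s (G (N - s) (\<phi> (n - s - (N - s)))))"
    by (rule sum.triangle_reindex_eq)
  also have "\<dots> = (\<Sum>N\<le>n. \<Sum>s\<le>N. F s (G (N - s) (\<phi> (n - N))))"
    by (intro sum.cong refl) auto
  finally show ?thesis .
qed

lemma series_commute:
  assumes "\<And>s. module_hom scl scl (F s)" "\<And>s. module_hom scl scl (G s)"
    and "\<And>s t u. F s (G t u) = G t (F s u)"
  shows "series F (series G \<phi>) = series G (series F \<phi>)"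
proof
  fix n
  have "(\<Sum>s\<le>N. F s (G (N - s) u)) = (\<Sum>s\<le>N. G s (F (N - s) u))" for N u
    by (rule sum.reindex_bij_witness [of _ "\<lambda>s. N - s" "\<lambda>s. N - s"]) (auto simp: assms(3))
  then show "series F (series G \<phi>) n = series G (series F \<phi>) n"
    by (simp add: series_series assms)
qed

lemma series_shift_seq:
  assumes "\<And>s. module_hom scl scl (F s)"
  shows "series F (shift_seq k \<phi>) = shift_seq k (series F \<phi>)"
proof
  fix n
  show "series F (shift_seq k \<phi>) n = shift_seq k (series F \<phi>) n"
  proof (cases "n < k")
    case True
    then show ?thesis
      by (auto simp: series_def shift_seq_def module_hom.zero [OF assms] intro!: sum.neutral)
  next
    case False
    have "series F (shift_seq k \<phi>) n = (\<Sum>s\<le>n - k. F s (\<phi> (n - k - s)))"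
      unfolding series_def
      by (rule sum.mono_neutral_cong_right)
        (use False in \<open>auto simp: shift_seq_def module_hom.zero [OF assms] add.commute\<close>)
    then show ?thesis using False by (simp add: series_def shift_seq_def)
  qed
qed

lemma series_scale_seq:
  assumes "\<And>s. module_hom scl scl (F s)"
  shows "series F (scale_seq c \<phi>) = scale_seq c (series F \<phi>)"
  by (rule ext) (simp add: series_def scale_seq_def module_hom.scale [OF assms] scale_sum_right)

lemma shift_seq_scale_seq: "shift_seq k (scale_seq c \<phi>) = scale_seq c (shift_seq k \<phi>)"
  by (rule ext) (simp add: shift_seq_def scale_seq_def)

lemma shift_seq_shift_seq [simp]: "shift_seq k (shift_seq l \<phi>) = shift_seq (k + l) \<phi>"
  by (rule ext) (auto simp: shift_seq_def intro: arg_cong [where f = \<phi>])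

lemma scale_seq_scale_seq [simp]: "scale_seq a (scale_seq b \<phi>) = scale_seq (a * b) \<phi>"
  by (rule ext) (simp add: scale_seq_def)

lemma shift_seq_0 [simp]: "shift_seq 0 \<phi> = \<phi>" and scale_seq_1 [simp]: "scale_seq 1 \<phi> = \<phi>"
  by (simp_all add: fun_eq_iff shift_seq_def scale_seq_def)

lemma shift_seq_inject: "shift_seq k \<phi> = shift_seq k \<psi> \<Longrightarrow> \<phi> = \<psi>"
proof
  fix n
  assume "shift_seq k \<phi> = shift_seq k \<psi>"
  from fun_cong [OF this, of "n + k"] show "\<phi> n = \<psi> n" by (simp add: shift_seq_def)
qed

text \<open>The mode - 1 + 2 m is the highest one that does not kill \<open>extremal_vec m\<close>;
  counting downwards from it makes y(c) a power series.\<close>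

definition Y_series :: "int \<Rightarrow> complex \<Rightarrow> (nat \<Rightarrow> 'v) \<Rightarrow> nat \<Rightarrow> 'v" where
  "Y_series m c = series (\<lambda>s u. scl (c ^ s) (Y (- 1 + 2 * m - int s) u))"

definition E_series :: "complex \<Rightarrow> (nat \<Rightarrow> 'v) \<Rightarrow> nat \<Rightarrow> 'v" where
  "E_series c = series (\<lambda>s u. scl (c ^ s) (E s u))"

lemma module_hom_Y_term: "module_hom scl scl (\<lambda>u. scl c (Y a u))"
  by unfold_locales (simp_all add: scale_right_distrib mult.commute)

lemma module_hom_E_term: "module_hom scl scl (\<lambda>u. scl c (E a u))"
  by unfold_locales (simp_all add: scale_right_distrib mult.commute)

lemma Y_series_commute: "Y_series m a (Y_series m b \<phi>) = Y_series m b (Y_series m a \<phi>)"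
  unfolding Y_series_def
  by (rule series_commute [OF module_hom_Y_term module_hom_Y_term]) (simp add: Y_Y mult.commute)

lemma Y_series_shift_seq: "Y_series m a (shift_seq k \<phi>) = shift_seq k (Y_series m a \<phi>)"
  unfolding Y_series_def by (rule series_shift_seq [OF module_hom_Y_term])

lemma Y_series_scale_seq: "Y_series m a (scale_seq c \<phi>) = scale_seq c (Y_series m a \<phi>)"
  unfolding Y_series_def by (rule series_scale_seq [OF module_hom_Y_term])

lemma E_series_shift_seq: "E_series a (shift_seq k \<phi>) = shift_seq k (E_series a \<phi>)"
  unfolding E_series_def by (rule series_shift_seq [OF module_hom_E_term])

lemma E_series_scale_seq: "E_series a (scale_seq c \<phi>) = scale_seq c (E_series a \<phi>)"
  unfolding E_series_def by (rule series_scale_seq [OF module_hom_E_term])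

text \<open>On these vectors the modes omitted from \<open>Y_series m\<close> act as 0, so the
  truncation loses nothing.\<close>

definition Y_kernel :: "int \<Rightarrow> 'v set" where
  "Y_kernel m = {x. \<forall>a\<ge>2 * m. Y a x = 0}"

lemma subspace_Y_kernel: "subspace (Y_kernel m)"
  by (auto simp: subspace_def Y_kernel_def)

lemma Y_in_Y_kernel: "x \<in> Y_kernel m \<Longrightarrow> Y a x \<in> Y_kernel m"
  by (simp add: Y_kernel_def Y_Y [of _ a])

lemma Y_series_in_subspace:
  assumes "subspace W" "\<And>a x. x \<in> W \<Longrightarrow> Y a x \<in> W" "\<And>n. \<phi> n \<in> W"
  shows "Y_series m c \<phi> n \<in> W"
  unfolding Y_series_def series_def
  by (intro subspace_sum [OF assms(1)] subspace_scale [OF assms(1)] assms(2,3))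

lemma sum_Suc_Suc_shift:
  fixes f g h :: "nat \<Rightarrow> 'v"
  assumes "f 0 = 0" "f 1 = 0" "g 0 = 0" "g (Suc (Suc M)) = 0" "h (Suc M) = 0" "h (Suc (Suc M)) = 0"
  shows "(\<Sum>s\<le>Suc (Suc M). f s - g s + h s) = (\<Sum>s\<le>M. f (Suc (Suc s)) - g (Suc s) + h s)"
proof -
  have "(\<Sum>s\<le>Suc (Suc M). f s) = (\<Sum>s\<le>M. f (Suc (Suc s)))"
    using assms by (simp only: sum.atMost_Suc_shift [of f] sum.atMost_Suc_shift [of "\<lambda>s. f (Suc s)"]) simp
  moreover have "(\<Sum>s\<le>Suc (Suc M). g s) = (\<Sum>s\<le>M. g (Suc s))"
    using assms by (simp only: sum.atMost_Suc_shift [of g]) simp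
  moreover have "(\<Sum>s\<le>Suc (Suc M). h s) = (\<Sum>s\<le>M. h s)"
    using assms by simp
  ultimately show ?thesis by (simp only: sum.distrib sum_subtractf)
qed

text \<open>Starting at mode 2 m - 1 instead of 2 m - 3 multiplies the series by the square of its
  variable, the two additional modes being 0 on \<open>x\<close>. This turns the factor (1 - b/a)^2
  of \<open>Y_E\<close> into (a - b)^2 and lowers the remaining degree by 2.\<close>

lemma Y_E_convolution:
  assumes x: "x \<in> Y_kernel (m - 1)"
  shows "(\<Sum>s\<le>N. scl (a ^ s) (Y (- 1 + 2 * m - int s) (scl (b ^ (N - s)) (E (N - s) x)))) =
    (if N < 2 then 0 else scl ((a - b) ^ 2)
      (\<Sum>s\<le>N - 2. scl (b ^ s) (E s (scl (a ^ (N - 2 - s)) (Y (- 1 + 2 * (m - 1) - int (N - 2 - s)) x)))))"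
proof -
  \<comment> \<open>Modes are counted from 2 m - 3; \<open>f\<close>, \<open>g\<close> and
    \<open>h\<close> are the three terms of \<open>Y_E\<close>.\<close>
  define y where "y s = Y (- 3 + 2 * m - int s) x" for s
  define f where "f s = scl (a ^ s * b ^ (N - s)) (E (N - s) (if s < 2 then 0 else y (s - 2)))" for s
  define g where "g s = scl (2 * (a ^ s * b ^ (N - s))) (E_shift 1 (N - s) (if s < 1 then 0 else y (s - 1)))" for s
  define h where "h s = scl (a ^ s * b ^ (N - s)) (E_shift 2 (N - s) (y s))" for s
  have "scl (a ^ s) (Y (- 1 + 2 * m - int s) (scl (b ^ (N - s)) (E (N - s) x))) = f s - g s + h s" for s
  proof -
    have "- 3 + 2 * m - int (s - 2) = - 1 + 2 * m - int s" if "\<not> s < 2" using that by simp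
    then have "Y (- 1 + 2 * m - int s) x = (if s < 2 then 0 else y (s - 2))"
      by (cases "s < 2") (use x in \<open>simp add: Y_kernel_def\<close>, simp only: y_def if_False simp_thms)
    moreover have "- 3 + 2 * m - int (s - 1) = - 1 + 2 * m - int s - 1" if "\<not> s < 1" using that by simp
    then have "Y (- 1 + 2 * m - int s - 1) x = (if s < 1 then 0 else y (s - 1))"
      by (cases "s < 1") (use x in \<open>simp add: Y_kernel_def\<close>, simp only: y_def if_False simp_thms)
    moreover have "- 3 + 2 * m - int s = - 1 + 2 * m - int s - 2" by simp
    then have "Y (- 1 + 2 * m - int s - 2) x = y s" unfolding y_def by (simp only:)
    ultimately show ?thesis
      by (simp only: Y_simps Y_E f_def g_def h_def)
        (simp add: scale_right_distrib scale_right_diff_distrib mult_ac del: complete_op.simps)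
  qed
  then have eq: "(\<Sum>s\<le>N. scl (a ^ s) (Y (- 1 + 2 * m - int s) (scl (b ^ (N - s)) (E (N - s) x))))
    = (\<Sum>s\<le>N. f s - g s + h s)" by simp
  show ?thesis
  proof (cases "N < 2")
    case True
    then have "N = 0 \<or> N = 1" by auto
    then show ?thesis
      unfolding eq by (auto simp: f_def g_def h_def E_shift_def)
  next
    case False
    then obtain M where N: "N = Suc (Suc M)" by (metis add_2_eq_Suc le_Suc_ex not_less)
    have "(\<Sum>s\<le>N. f s - g s + h s) = (\<Sum>s\<le>M. f (Suc (Suc s)) - g (Suc s) + h s)"
      unfolding N by (rule sum_Suc_Suc_shift) (simp_all add: f_def g_def h_def N E_shift_def)
    also have "\<dots> = (\<Sum>s\<le>M. scl ((a - b) ^ 2) (scl (a ^ s * b ^ (M - s)) (E (M - s) (y s))))"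
    proof (intro sum.cong refl)
      fix s assume "s \<in> {..M}"
      then have s: "Suc M - s = Suc (M - s)" "Suc (Suc M) - s = Suc (Suc (M - s))" by auto
      have "(a - b) ^ 2 * (a ^ s * b ^ (M - s))
         = a ^ Suc (Suc s) * b ^ (M - s) - 2 * (a ^ Suc s * b ^ Suc (M - s)) + a ^ s * b ^ Suc (Suc (M - s))"
        by (simp add: power2_eq_square algebra_simps)
      then show "f (Suc (Suc s)) - g (Suc s) + h s
        = scl ((a - b) ^ 2) (scl (a ^ s * b ^ (M - s)) (E (M - s) (y s)))"
        by (simp add: f_def g_def h_def N E_shift_def s scale_left_distrib scale_left_diff_distrib
            del: complete_op.simps power_Suc)
    qed
    also have "\<dots> = scl ((a - b) ^ 2) (\<Sum>s\<le>M. scl (b ^ s) (E s (scl (a ^ (M - s)) (y (M - s)))))"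
      unfolding scale_sum_right
      by (rule sum.reindex_bij_witness [of _ "\<lambda>s. M - s" "\<lambda>s. M - s"]) (auto simp: mult_ac)
    finally show ?thesis unfolding eq by (simp add: N y_def)
  qed
qed

lemma Y_series_E_series:
  assumes "\<And>n. \<phi> n \<in> Y_kernel (m - 1)"
  shows "Y_series m a (E_series b \<phi>) = shift_seq 2 (scale_seq ((a - b) ^ 2) (E_series b (Y_series (m - 1) a \<phi>)))"
proof
  fix n
  define G where "G N = (\<Sum>s\<le>N. scl (b ^ s) (E s (scl (a ^ (N - s))
      (Y (- 1 + 2 * (m - 1) - int (N - s)) (\<phi> (n - (N + 2)))))))" for N
  have "Y_series m a (E_series b \<phi>) n = (\<Sum>N\<le>n. if N < 2 then 0 else scl ((a - b) ^ 2) (G (N - 2)))"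
    unfolding Y_series_def E_series_def series_series [OF module_hom_Y_term]
      Y_E_convolution [OF assms]
  proof (intro sum.cong refl if_cong)
    fix N assume "\<not> N < (2 :: nat)"
    then have "n - N = n - (N - 2 + 2)" by simp
    then show "scl ((a - b)\<^sup>2) (\<Sum>s\<le>N - 2. scl (b ^ s) (E s (scl (a ^ (N - 2 - s))
        (Y (- 1 + 2 * (m - 1) - int (N - 2 - s)) (\<phi> (n - N)))))) = scl ((a - b)\<^sup>2) (G (N - 2))"
      unfolding G_def by (simp only:)
  qed
  also have "\<dots> = (if n < 2 then 0 else scl ((a - b) ^ 2) (\<Sum>N\<le>n - 2. G N))"
  proof (cases "n < 2")
    case False
    have "(\<Sum>N\<le>n. if N < 2 then 0 else scl ((a - b) ^ 2) (G (N - 2)))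
        = (\<Sum>N\<in>{2..n}. scl ((a - b) ^ 2) (G (N - 2)))"
      by (rule sum.mono_neutral_cong_right) auto
    also have "\<dots> = (\<Sum>N\<le>n - 2. scl ((a - b) ^ 2) (G N))"
      by (rule sum.reindex_bij_witness [of _ "\<lambda>N. N + 2" "\<lambda>N. N - 2"]) (use False in auto)
    finally show ?thesis using False by (simp add: scale_sum_right)
  qed (auto intro!: sum.neutral)
  also have "\<dots> = shift_seq 2 (scale_seq ((a - b) ^ 2) (E_series b (Y_series (m - 1) a \<phi>))) n"
    unfolding Y_series_def E_series_def shift_seq_def scale_seq_def series_series [OF module_hom_E_term]
      G_def by (auto intro!: sum.cong arg_cong2 [where f = scl] simp: algebra_simps)
  finally show "Y_series m a (E_series b \<phi>) n
    = shift_seq 2 (scale_seq ((a - b) ^ 2) (E_series b (Y_series (m - 1) a \<phi>))) n" .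
qed

end

section \<open>Products and powers of the series y(u)\<close>

context level_one_operators
begin

primrec Y_prod :: "int \<Rightarrow> (nat \<Rightarrow> complex) \<Rightarrow> nat \<Rightarrow> (nat \<Rightarrow> 'v) \<Rightarrow> nat \<Rightarrow> 'v" where
  "Y_prod m u 0 \<phi> = \<phi>"
| "Y_prod m u (Suc r) \<phi> = Y_series m (u r) (Y_prod m u r \<phi>)"

primrec E_prod :: "(nat \<Rightarrow> complex) \<Rightarrow> nat \<Rightarrow> (nat \<Rightarrow> 'v) \<Rightarrow> nat \<Rightarrow> 'v" where
  "E_prod u 0 \<phi> = \<phi>"
| "E_prod u (Suc r) \<phi> = E_series (u r) (E_prod u r \<phi>)"

lemma Y_prod_Y_series: "Y_prod m u r (Y_series m a \<phi>) = Y_series m a (Y_prod m u r \<phi>)"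
  by (induction r) (simp_all add: Y_series_commute)

lemma Y_prod_in_Y_kernel: "(\<And>n. \<phi> n \<in> Y_kernel m) \<Longrightarrow> Y_prod k u r \<phi> n \<in> Y_kernel m"
  by (induction r arbitrary: n)
    (simp_all add: Y_series_in_subspace [OF subspace_Y_kernel Y_in_Y_kernel])

lemma Y_prod_E_series:
  assumes "\<And>n. \<phi> n \<in> Y_kernel (m - 1)"
  shows "Y_prod m u r (E_series b \<phi>)
    = shift_seq (2 * r) (scale_seq (\<Prod>k<r. (u k - b) ^ 2) (E_series b (Y_prod (m - 1) u r \<phi>)))"
proof (induction r)
  case (Suc r)
  have "Y_prod (m - 1) u r \<phi> n \<in> Y_kernel (m - 1)" for n
    by (rule Y_prod_in_Y_kernel) (rule assms)
  note YE = Y_series_E_series [OF this]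
  show ?case
    by (simp add: Suc YE Y_series_shift_seq Y_series_scale_seq shift_seq_scale_seq mult.commute)
qed simp

text \<open>Each \<open>Y_series m (u i)\<close> squares to zero on the sequences below and they all commute, so the
  \<open>p\<close>-th power of a combination of \<open>p\<close> of them is \<open>p!\<close> times the product of its terms.\<close>

definition Y_comb :: "int \<Rightarrow> (nat \<Rightarrow> complex) \<Rightarrow> (nat \<Rightarrow> complex) \<Rightarrow> nat \<Rightarrow> (nat \<Rightarrow> 'v) \<Rightarrow> nat \<Rightarrow> 'v" where
  "Y_comb m w u p \<phi> n = (\<Sum>i<p. scl (w i) (Y_series m (u i) \<phi> n))"

definition Y_quadratic_kernel :: "int \<Rightarrow> 'v set" where
  "Y_quadratic_kernel m =
    {x. \<forall>S. (\<Sum>s\<le>S. Y (- 1 + 2 * m - int s) (Y (- 1 + 2 * m - int (S - s)) x)) = 0}"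

lemma subspace_Y_quadratic_kernel: "subspace (Y_quadratic_kernel m)"
  by (auto simp: subspace_def Y_quadratic_kernel_def sum.distrib simp flip: scale_sum_right)

lemma Y_in_Y_quadratic_kernel: "x \<in> Y_quadratic_kernel m \<Longrightarrow> Y a x \<in> Y_quadratic_kernel m"
proof -
  assume x: "x \<in> Y_quadratic_kernel m"
  have "Y b (Y c (Y a x)) = Y a (Y b (Y c x))" for b c
    by (simp only: Y_Y [of c a] Y_Y [of b a])
  then show ?thesis
    using x by (simp add: Y_quadratic_kernel_def flip: module_hom.sum [OF hom_Y])
qed

lemma Y_series_square:
  assumes "\<And>n. \<phi> n \<in> Y_quadratic_kernel m"
  shows "Y_series m a (Y_series m a \<phi>) = (\<lambda>n. 0)"
proof
  fix n
  have "(\<Sum>s\<le>N. scl (a ^ s) (Y (- 1 + 2 * m - int s) (scl (a ^ (N - s)) (Y (- 1 + 2 * m - int (N - s)) x))))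
      = scl (a ^ N) (\<Sum>s\<le>N. Y (- 1 + 2 * m - int s) (Y (- 1 + 2 * m - int (N - s)) x))" for N x
    unfolding scale_sum_right by (intro sum.cong refl) (simp flip: power_add)
  then show "Y_series m a (Y_series m a \<phi>) n = 0"
    unfolding Y_series_def series_series [OF module_hom_Y_term]
    using assms by (simp add: Y_quadratic_kernel_def)
qed

lemma Y_series_linear:
  "Y_series m a (\<lambda>n. \<phi> n + \<psi> n) n = Y_series m a \<phi> n + Y_series m a \<psi> n"
  "Y_series m a (\<lambda>n. scl c (\<phi> n)) n = scl c (Y_series m a \<phi> n)"
  "Y_series m a (\<lambda>n. \<Sum>i\<in>I. \<theta> i n) n = (\<Sum>i\<in>I. Y_series m a (\<theta> i) n)"
  "Y_series m a (\<lambda>n. 0) n = 0"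
  unfolding Y_series_def series_def
  by (simp_all add: scale_right_distrib sum.distrib scale_sum_right mult.commute module_hom.sum [OF hom_Y])
    (rule sum.swap)

lemma Y_comb_linear:
  "Y_comb m w u p (\<lambda>n. \<phi> n + \<psi> n) n = Y_comb m w u p \<phi> n + Y_comb m w u p \<psi> n"
  "Y_comb m w u p (\<lambda>n. scl c (\<phi> n)) n = scl c (Y_comb m w u p \<phi> n)"
  "Y_comb m w u p (\<lambda>n. 0) n = 0"
  by (simp_all add: Y_comb_def Y_series_linear scale_right_distrib sum.distrib scale_sum_right mult.commute)

lemma Y_comb_Suc:
  "Y_comb m w u (Suc p) \<phi> = (\<lambda>n. Y_comb m w u p \<phi> n + scl (w p) (Y_series m (u p) \<phi> n))"
  by (rule ext) (simp add: Y_comb_def)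

lemma Y_comb_Y_series: "Y_comb m w u p (Y_series m a \<phi>) = Y_series m a (Y_comb m w u p \<phi>)"
proof
  fix n
  have "Y_comb m w u p \<phi> = (\<lambda>n. \<Sum>i<p. scl (w i) (Y_series m (u i) \<phi> n))"
    by (rule ext) (rule Y_comb_def)
  then show "Y_comb m w u p (Y_series m a \<phi>) n = Y_series m a (Y_comb m w u p \<phi>) n"
    by (simp add: Y_comb_def Y_series_linear Y_series_commute [of m _ a])
qed

text \<open>The binomial theorem for (T + B)^(k+1), where the new term B commutes with T and has
  square 0.\<close>

lemma Y_comb_power_Suc:
  assumes "\<And>n. \<phi> n \<in> Y_quadratic_kernel m"
  shows "(Y_comb m w u (Suc p) ^^ Suc k) \<phi> = (\<lambda>n. (Y_comb m w u p ^^ Suc k) \<phi> n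
    + scl (of_nat (Suc k) * w p) (Y_series m (u p) ((Y_comb m w u p ^^ k) \<phi>) n))"
proof (induction k)
  case 0
  show ?case by (simp add: Y_comb_Suc)
next
  case (Suc k)
  have ker: "(Y_comb m w u p ^^ k) \<phi> n \<in> Y_quadratic_kernel m" for n
  proof (induction k arbitrary: n)
    case (Suc k)
    then show ?case
      by (auto simp: Y_comb_def intro!: subspace_sum subspace_scale subspace_Y_quadratic_kernel
          Y_series_in_subspace [OF subspace_Y_quadratic_kernel Y_in_Y_quadratic_kernel])
  qed (simp add: assms)
  let ?T = "Y_comb m w u p" and ?c = "of_nat (Suc k) * w p"
  have "(Y_comb m w u (Suc p) ^^ Suc (Suc k)) \<phi> = Y_comb m w u (Suc p)
      (\<lambda>n. (?T ^^ Suc k) \<phi> n + scl ?c (Y_series m (u p) ((?T ^^ k) \<phi>) n))"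
    using Suc by simp
  also have "\<dots> = (\<lambda>n. (?T ^^ Suc (Suc k)) \<phi> n + scl ?c (Y_series m (u p) ((?T ^^ Suc k) \<phi>) n)
      + scl (w p) (Y_series m (u p) ((?T ^^ Suc k) \<phi>) n))"
    unfolding Y_comb_Suc Y_comb_linear Y_series_linear Y_series_square [OF ker] Y_comb_Y_series
    by (simp add: scale_right_distrib)
  also have "\<dots> = (\<lambda>n. (?T ^^ Suc (Suc k)) \<phi> n
      + scl (of_nat (Suc (Suc k)) * w p) (Y_series m (u p) ((?T ^^ Suc k) \<phi>) n))"
  proof -
    have "of_nat (Suc (Suc k)) * w p = ?c + w p" by (simp add: algebra_simps)
    then show ?thesis by (simp only: scale_left_distrib add.assoc)
  qed
  finally show ?case .
qed

text \<open>The claims share one induction: the vanishing of the next power removes the first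
  summand in \<open>Y_comb_power_Suc\<close>, leaving \<open>Suc p\<close> times the product with
  the new term.\<close>

lemma Y_comb_power:
  assumes "\<And>n. \<phi> n \<in> Y_quadratic_kernel m"
  shows "(Y_comb m w u p ^^ p) \<phi> = scale_seq (fact p * (\<Prod>i<p. w i)) (Y_prod m u p \<phi>)"
    "(Y_comb m w u p ^^ Suc p) \<phi> = (\<lambda>n. 0)"
  using assms
proof (induction p arbitrary: \<phi>)
  case 0
  { case 1 show ?case by simp }
  { case 2 show ?case by (simp add: Y_comb_def fun_eq_iff) }
next
  case (Suc p)
  { case 1
    have "(Y_comb m w u (Suc p) ^^ Suc p) \<phi> = (\<lambda>n. scl (of_nat (Suc p) * w p)
        (Y_series m (u p) (scale_seq (fact p * (\<Prod>i<p. w i)) (Y_prod m u p \<phi>)) n))"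
      unfolding Y_comb_power_Suc [OF 1] Suc.IH(1) [of \<phi>, OF 1] Suc.IH(2) [of \<phi>, OF 1] by simp
    then show ?case
      by (simp add: Y_series_scale_seq fun_eq_iff) (simp add: scale_seq_def mult_ac del: of_nat_Suc) }
  { case 2
    have "(Y_comb m w u p ^^ Suc (Suc p)) \<phi> = (\<lambda>n. 0)"
      by (subst funpow.simps(2), subst o_apply, subst Suc.IH(2) [of \<phi>, OF 2])
        (rule ext, rule Y_comb_linear(3))
    then show ?case
      unfolding Y_comb_power_Suc [OF 2] Suc.IH(2) [of \<phi>, OF 2] by (simp add: Y_series_linear) }
qed

end

section \<open>Expansion of powers of the interpolated operator\<close>

definition nat_lists :: "nat \<Rightarrow> nat \<Rightarrow> nat list set" where
  "nat_lists r d = {xs. length xs = r \<and> sum_list xs = d}"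

lemma nat_lists_0: "nat_lists 0 d = (if d = 0 then {[]} else {})"
  by (auto simp: nat_lists_def)

lemma nat_lists_Suc: "nat_lists (Suc r) d = (\<lambda>(s, xs). s # xs) ` (SIGMA s:{..d}. nat_lists r (d - s))"
proof (intro equalityI subsetI)
  fix xs assume "xs \<in> nat_lists (Suc r) d"
  then obtain s ys where "xs = s # ys" "length ys = r" "s + sum_list ys = d"
    by (auto simp: nat_lists_def length_Suc_conv)
  then show "xs \<in> (\<lambda>(s, xs). s # xs) ` (SIGMA s:{..d}. nat_lists r (d - s))"
    by (intro image_eqI [of _ _ "(s, ys)"]) (auto simp: nat_lists_def)
qed (auto simp: nat_lists_def)

lemma finite_nat_lists: "finite (nat_lists r d)"
  by (induction r arbitrary: d) (simp_all add: nat_lists_0 nat_lists_Suc)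

context level_one_operators
begin

definition Q_series :: "int \<Rightarrow> (nat \<Rightarrow> complex) \<Rightarrow> (nat \<Rightarrow> 'v) \<Rightarrow> nat \<Rightarrow> 'v" where
  "Q_series k q = series (\<lambda>s u. scl (q s) (Y (k - int s) u))"

text \<open>The Lagrange sums below r - 1 vanish, so the combination starts r - 1 modes further
  down, at - 1 + 2 m - (r - 1) = 2 m - r. This is the k of the definition of c.\<close>

lemma Y_comb_eq_Q_series:
  assumes S: "S = u ` {..<r}" and inj: "inj_on u {..<r}" and r: "0 < r"
    and w: "\<And>i. i < r \<Longrightarrow> w i = 1 / (\<Prod>y\<in>S - {u i}. u i - y)"
  shows "Y_comb m w u r \<phi>
    = shift_seq (r - 1) (Q_series (2 * m - int r) (\<lambda>s. lagrange_sum S (s + (r - 1))) \<phi>)"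
proof
  fix n
  have fin: "finite S" and card: "card S = r" using S inj by (simp_all add: card_image)
  have "Y_comb m w u r \<phi> n = (\<Sum>s\<le>n. \<Sum>i<r. scl (w i * u i ^ s) (Y (- 1 + 2 * m - int s) (\<phi> (n - s))))"
    unfolding Y_comb_def Y_series_def series_def scale_sum_right
    by (subst sum.swap) simp
  also have "\<dots> = (\<Sum>s\<le>n. scl (lagrange_sum S s) (Y (- 1 + 2 * m - int s) (\<phi> (n - s))))"
  proof (intro sum.cong refl)
    fix s
    have "(\<Sum>i<r. w i * u i ^ s) = lagrange_sum S s"
      unfolding lagrange_sum_def S using w
      by (simp add: sum.reindex [OF inj] S)
    then show "(\<Sum>i<r. scl (w i * u i ^ s) (Y (- 1 + 2 * m - int s) (\<phi> (n - s))))
        = scl (lagrange_sum S s) (Y (- 1 + 2 * m - int s) (\<phi> (n - s)))"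
      by (simp flip: scale_sum_left)
  qed
  also have "\<dots> = shift_seq (r - 1) (Q_series (2 * m - int r) (\<lambda>s. lagrange_sum S (s + (r - 1))) \<phi>) n"
  proof (cases "n < r - 1")
    case True
    then have "lagrange_sum S s = 0" if "s \<le> n" for s
      using lagrange_sum_eq [OF fin, of s] card that by simp
    then show ?thesis using True by (simp add: shift_seq_def)
  next
    case False
    have z: "lagrange_sum S s = 0" if "s < r - 1" for s
      using lagrange_sum_eq [OF fin, of s] card that by simp
    have "(\<Sum>s\<le>n. scl (lagrange_sum S s) (Y (- 1 + 2 * m - int s) (\<phi> (n - s))))
      = (\<Sum>s\<in>{r - 1..n}. scl (lagrange_sum S s) (Y (- 1 + 2 * m - int s) (\<phi> (n - s))))"
      by (rule sum.mono_neutral_right) (auto simp: z)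
    also have "\<dots> = (\<Sum>s\<le>n - (r - 1). scl (lagrange_sum S (s + (r - 1)))
        (Y (2 * m - int r - int s) (\<phi> (n - (r - 1) - s))))"
    proof (rule sum.reindex_bij_witness [of _ "\<lambda>s. s + (r - 1)" "\<lambda>s. s - (r - 1)"])
      fix s assume s: "s \<in> {r - 1..n}"
      have "2 * m - int r - int (s - (r - 1)) = - 1 + 2 * m - int s" using s r by auto
      moreover have "n - (r - 1) - (s - (r - 1)) = n - s" "s - (r - 1) + (r - 1) = s" using s by auto
      ultimately show "scl (lagrange_sum S (s - (r - 1) + (r - 1)))
          (Y (2 * m - int r - int (s - (r - 1))) (\<phi> (n - (r - 1) - (s - (r - 1))))) =
         scl (lagrange_sum S s) (Y (- 1 + 2 * m - int s) (\<phi> (n - s)))" by (simp only:)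
    qed (use False in auto)
    finally show ?thesis using False by (simp add: shift_seq_def Q_series_def series_def)
  qed
  finally show "Y_comb m w u r \<phi> n
    = shift_seq (r - 1) (Q_series (2 * m - int r) (\<lambda>s. lagrange_sum S (s + (r - 1))) \<phi>) n" .
qed

lemma Q_series_shift_seq: "Q_series k q (shift_seq l \<phi>) = shift_seq l (Q_series k q \<phi>)"
  unfolding Q_series_def by (rule series_shift_seq [OF module_hom_Y_term])

primrec Y_mon :: "int \<Rightarrow> nat list \<Rightarrow> 'v \<Rightarrow> 'v" where
  "Y_mon k [] u = u"
| "Y_mon k (s # ss) u = Y (k - int s) (Y_mon k ss u)"

lemma Q_series_power_const_seq:
  "(Q_series k q ^^ r) (const_seq u) d
    = (\<Sum>xs\<in>nat_lists r d. scl (prod_list (map q xs)) (Y_mon k xs u))"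
proof (induction r arbitrary: d)
  case 0
  show ?case by (simp add: nat_lists_0 const_seq_def)
next
  case (Suc r)
  have "(Q_series k q ^^ Suc r) (const_seq u) d
    = (\<Sum>s\<le>d. \<Sum>xs\<in>nat_lists r (d - s). scl (prod_list (map q (s # xs))) (Y_mon k (s # xs) u))"
    by (simp add: Q_series_def series_def Suc [unfolded Q_series_def] sum_simps scale_sum_right)
  also have "\<dots> = (\<Sum>(s, xs)\<in>(SIGMA s:{..d}. nat_lists r (d - s)).
      scl (prod_list (map q (s # xs))) (Y_mon k (s # xs) u))"
    by (rule sum.Sigma) (auto simp: finite_nat_lists)
  also have "\<dots> = (\<Sum>xs\<in>nat_lists (Suc r) d. scl (prod_list (map q xs)) (Y_mon k xs u))"
    unfolding nat_lists_Suc
    by (subst sum.reindex) (auto simp: inj_on_def intro!: sum.cong)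
  finally show ?case .
qed

lemma E_series_const_seq: "E_series c (const_seq u) n = scl (c ^ n) (E n u)"
proof -
  have "E_series c (const_seq u) n = (\<Sum>s\<in>{n}. scl (c ^ s) (E s (const_seq u (n - s))))"
    unfolding E_series_def series_def
    by (rule sum.mono_neutral_right) (auto simp: const_seq_def)
  then show ?thesis by (simp add: const_seq_def)
qed

lemma Y_series_const_seq: "Y_series m c (const_seq u) n = scl (c ^ n) (Y (- 1 + 2 * m - int n) u)"
proof -
  have "Y_series m c (const_seq u) n
    = (\<Sum>s\<in>{n}. scl (c ^ s) (Y (- 1 + 2 * m - int s) (const_seq u (n - s))))"
    unfolding Y_series_def series_def
    by (rule sum.mono_neutral_right) (auto simp: const_seq_def)
  then show ?thesis by (simp add: const_seq_def)
qed

end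

context level_one_vacuum
begin

lemma const_seq_in_Y_kernel: "const_seq (extremal_vec m) n \<in> Y_kernel m"
  by (simp add: const_seq_def Y_kernel_def Y_extremal_vec_eq_0)

lemma const_seq_in_Y_quadratic_kernel: "const_seq (extremal_vec m) n \<in> Y_quadratic_kernel m"
  using Y_extremal_vec_quadratic by (simp add: const_seq_def Y_quadratic_kernel_def)

text \<open>The factor with \<open>u r\<close> is moved next to the extremal vector, where it
  becomes an exponential on the next lower one. Bringing that exponential to the front yields r
  squared differences, the shift 2 r, and the remaining product at m - 1.\<close>

lemma Y_prod_extremal_vec:
  "Y_prod m u r (const_seq (extremal_vec m)) = shift_seq (r * (r - 1))
    (scale_seq (\<Prod>i<r. \<Prod>k<i. (u k - u i) ^ 2) (E_prod u r (const_seq (extremal_vec (m - int r)))))"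
proof (induction r arbitrary: m)
  case (Suc r)
  have "Y_series m (u r) (const_seq (extremal_vec m)) = E_series (u r) (const_seq (extremal_vec (m - 1)))"
    by (rule ext) (simp only: Y_series_const_seq E_series_const_seq Y_extremal_vec_eq_E)
  then have "Y_prod m u (Suc r) (const_seq (extremal_vec m))
      = Y_prod m u r (E_series (u r) (const_seq (extremal_vec (m - 1))))"
    by (simp flip: Y_prod_Y_series)
  also have "\<dots> = shift_seq (2 * r) (scale_seq (\<Prod>k<r. (u k - u r) ^ 2)
      (E_series (u r) (Y_prod (m - 1) u r (const_seq (extremal_vec (m - 1))))))"
    by (rule Y_prod_E_series [OF const_seq_in_Y_kernel])
  also have "\<dots> = shift_seq (2 * r + r * (r - 1)) (scale_seq (\<Prod>i<Suc r. \<Prod>k<i. (u k - u i) ^ 2)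
      (E_prod u (Suc r) (const_seq (extremal_vec (m - int (Suc r))))))"
    unfolding Suc.IH
    by (simp add: E_series_shift_seq E_series_scale_seq shift_seq_scale_seq mult.commute algebra_simps)
  also have "2 * r + r * (r - 1) = Suc r * (Suc r - 1)"
    by (cases r) auto
  finally show ?case .
qed simp

theorem Q_series_power_eq_E_prod:
  assumes inj: "inj_on u {..<r}"
  shows "(Q_series (2 * m - int r) (\<lambda>s. lagrange_sum (u ` {..<r}) (s + (r - 1))) ^^ r)
      (const_seq (extremal_vec m))
    = scale_seq (fact r * (\<Prod>i<r. (- 1) ^ i)) (E_prod u r (const_seq (extremal_vec (m - int r))))"
proof (cases "r = 0")
  case True
  then show ?thesis by simp
next
  case False
  define S where "S = u ` {..<r}"
  define w where "w i = 1 / (\<Prod>y\<in>S - {u i}. u i - y)" for i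
  define Q where "Q = Q_series (2 * m - int r) (\<lambda>s. lagrange_sum S (s + (r - 1)))"
  define \<phi> where "\<phi> = const_seq (extremal_vec m)"
  define V where "V = (\<Prod>i<r. \<Prod>k<i. (u k - u i) ^ 2)"
  define \<sigma> :: complex where "\<sigma> = (\<Prod>i<r. (- 1) ^ i)"
  have comb: "Y_comb m w u r \<psi> = shift_seq (r - 1) (Q \<psi>)" for \<psi>
    unfolding Q_def by (rule Y_comb_eq_Q_series [OF S_def inj]) (use False in \<open>auto simp: w_def\<close>)
  have power: "(Y_comb m w u r ^^ k) \<phi> = shift_seq (k * (r - 1)) ((Q ^^ k) \<phi>)" for k
  proof (induction k)
    case (Suc k)
    then show ?case
      by (simp add: comb) (simp add: Q_def Q_series_shift_seq)
  qed simp
  have "(\<Prod>i<r. w i) = 1 / (\<Prod>i<r. \<Prod>l\<in>{..<r} - {i}. u i - u l)"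
    unfolding prod_dividef [symmetric] w_def
  proof (simp add: prod_dividef, intro prod.cong refl)
    fix i assume i: "i \<in> {..<r}"
    have "S - {u i} = u ` ({..<r} - {i})" using inj i by (auto simp: S_def inj_on_def)
    then show "(\<Prod>y\<in>S - {u i}. u i - y) = (\<Prod>l\<in>{..<r} - {i}. u i - u l)"
      using inj_on_diff [OF inj] by (simp add: prod.reindex)
  qed
  also have "\<dots> = 1 / (\<sigma> * V)" unfolding \<sigma>_def V_def prod_differences_sign ..
  finally have w: "(\<Prod>i<r. w i) = 1 / (\<sigma> * V)" .
  have "V \<noteq> 0" using inj by (auto simp: V_def inj_on_def)
  moreover have "\<sigma> * \<sigma> = 1" unfolding \<sigma>_def prod.distrib [symmetric] by (simp flip: power_add)
  moreover from this have "\<sigma> \<noteq> 0" by auto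
  \<comment> \<open>The sign is its own inverse, so cancelling the Vandermonde square from the
    weights leaves the sign itself.\<close>
  ultimately have wV: "(\<Prod>i<r. w i) * V = \<sigma>" unfolding w by (simp add: field_simps)
  \<comment> \<open>Each of the r applications of the combination shifts by r - 1, matching the
    shift in \<open>Y_prod_extremal_vec\<close>; the common shift is then cancelled.\<close>
  have "shift_seq (r * (r - 1)) ((Q ^^ r) \<phi>) = scale_seq (fact r * (\<Prod>i<r. w i)) (Y_prod m u r \<phi>)"
  proof -
    have "\<phi> n \<in> Y_quadratic_kernel m" for n
      unfolding \<phi>_def by (rule const_seq_in_Y_quadratic_kernel)
    from Y_comb_power(1) [where \<phi> = \<phi>, OF this]
    show ?thesis unfolding power [symmetric] .
  qed
  also have "\<dots> = shift_seq (r * (r - 1))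
      (scale_seq (fact r * \<sigma>) (E_prod u r (const_seq (extremal_vec (m - int r)))))"
    unfolding \<phi>_def Y_prod_extremal_vec V_def [symmetric]
    by (simp add: mult.assoc wV flip: shift_seq_scale_seq)
  finally show ?thesis
    by (auto dest: shift_seq_inject simp: Q_def S_def \<phi>_def \<sigma>_def)
qed

end

section \<open>Partitions and multisets\<close>

definition partitions_of :: "nat \<Rightarrow> (nat \<Rightarrow> nat) set" where
  "partitions_of d = {lam. is_partition lam \<and> psize lam = d}"

definition parts_mset :: "nat \<Rightarrow> (nat \<Rightarrow> nat) \<Rightarrow> nat multiset" where
  "parts_mset r lam = mset (map lam [0..<r])"

lemma partition_support:
  assumes "is_partition lam"
  shows "{i. lam i \<noteq> 0} = {..<psupp lam}"
proof -
  have fin: "finite {i. lam i \<noteq> 0}" and anti: "antimono lam"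
    using assms by (auto simp: is_partition_def)
  have "{i. lam i \<noteq> 0} \<subseteq> {..<psupp lam}"
  proof
    fix i assume i: "i \<in> {i. lam i \<noteq> 0}"
    have "{..i} \<subseteq> {i. lam i \<noteq> 0}"
    proof
      fix j assume "j \<in> {..i}"
      then have "lam i \<le> lam j" using anti by (simp add: antimonoD)
      then show "j \<in> {i. lam i \<noteq> 0}" using i by simp
    qed
    from card_mono [OF fin this] show "i \<in> {..<psupp lam}" by (simp add: psupp_def)
  qed
  moreover have "card {..<psupp lam} = card {i. lam i \<noteq> 0}" by (simp add: psupp_def)
  ultimately show ?thesis by (intro card_subset_eq) auto
qed

lemma partition_eq_0: "is_partition lam \<Longrightarrow> psupp lam \<le> i \<Longrightarrow> lam i = 0"
  using partition_support [of lam] by (metis (mono_tags, lifting) lessThan_iff mem_Collect_eq not_less)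

lemma psupp_le_psize: "psupp lam \<le> psize lam"
proof -
  have "psupp lam = (\<Sum>i | lam i \<noteq> 0. 1)" by (simp add: psupp_def)
  also have "\<dots> \<le> psize lam" unfolding psize_def by (rule sum_mono) auto
  finally show ?thesis .
qed

lemma part_le_psize: "is_partition lam \<Longrightarrow> lam i \<le> psize lam"
  unfolding psize_def by (cases "lam i = 0") (auto simp: is_partition_def intro!: member_le_sum)

lemma sum_parts:
  assumes "is_partition lam" "psupp lam \<le> r"
  shows "(\<Sum>i<r. lam i) = psize lam"
  unfolding psize_def partition_support [OF assms(1)]
  by (rule sum.mono_neutral_right) (use assms partition_eq_0 in auto)

lemma psupp_le: "lam \<in> partitions_of d \<Longrightarrow> d \<le> r \<Longrightarrow> psupp lam \<le> r"
  using psupp_le_psize [of lam] by (simp add: partitions_of_def)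

lemma map_parts_in_nat_lists:
  assumes "lam \<in> partitions_of d" "d \<le> r"
  shows "map lam [0..<r] \<in> nat_lists r d"
  using assms sum_parts [of lam r] psupp_le [OF assms]
  by (simp add: nat_lists_def partitions_of_def interv_sum_list_conv_sum_set_nat atLeast0LessThan)

lemma sorted_rev_map_parts: "is_partition lam \<Longrightarrow> sorted (rev (map lam [0..<r]))"
  unfolding is_partition_def sorted_rev_iff_nth_mono by (auto simp: antimonoD)

text \<open>\<open>d \<le> r\<close> puts all non-zero parts among the first \<open>r\<close>
  entries, and their decreasing list is determined by its multiset.\<close>

lemma inj_on_parts_mset: "d \<le> r \<Longrightarrow> inj_on (parts_mset r) (partitions_of d)"
proof (rule inj_onI)
  fix lam mu
  assume d: "d \<le> r" and lam: "lam \<in> partitions_of d" and mu: "mu \<in> partitions_of d"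
    and eq: "parts_mset r lam = parts_mset r mu"
  have p: "is_partition lam" "is_partition mu" using lam mu by (auto simp: partitions_of_def)
  have "rev (map lam [0..<r]) = rev (map mu [0..<r])"
    using eq sorted_rev_map_parts [OF p(1)] sorted_rev_map_parts [OF p(2)]
    by (metis mset_rev parts_mset_def properties_for_sort)
  then have "map lam [0..<r] = map mu [0..<r]" by simp
  then have "lam i = mu i" if "i < r" for i using that by (simp add: list_eq_iff_nth_eq)
  moreover have "lam i = mu i" if "r \<le> i" for i
    using partition_eq_0 [OF p(1), of i] partition_eq_0 [OF p(2), of i] psupp_le [OF lam d]
      psupp_le [OF mu d] that by simp
  ultimately show "lam = mu" using not_less by blast
qed

lemma parts_mset_image: "d \<le> r \<Longrightarrow> parts_mset r ` partitions_of d = mset ` nat_lists r d"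
proof (intro equalityI subsetI)
  fix A assume "d \<le> r" "A \<in> parts_mset r ` partitions_of d"
  then show "A \<in> mset ` nat_lists r d"
    unfolding parts_mset_def using map_parts_in_nat_lists by blast
next
  fix A assume d: "d \<le> r" and "A \<in> mset ` nat_lists r d"
  then obtain xs where xs: "A = mset xs" "length xs = r" "sum_list xs = d"
    by (auto simp: nat_lists_def)
  define ys where "ys = rev (sort xs)"
  define lam where "lam i = (if i < r then ys ! i else 0)" for i
  have len: "length ys = r" and sum: "sum_list ys = d"
    using xs by (simp_all add: ys_def sum_list_rev) (metis mset_sort sum_mset_sum_list)
  have map: "map lam [0..<r] = ys"
    by (rule nth_equalityI) (simp_all add: lam_def len)
  have "antimono lam"
  proof (rule antimonoI)
    fix i k :: nat assume "i \<le> k"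
    have "sorted (rev ys)" by (simp add: ys_def)
    then show "lam k \<le> lam i"
      using \<open>i \<le> k\<close> len by (auto simp: lam_def sorted_rev_iff_nth_mono)
  qed
  moreover have "finite {i. lam i \<noteq> 0}"
    by (rule finite_subset [of _ "{..<r}"]) (auto simp: lam_def split: if_splits)
  ultimately have p: "is_partition lam" by (simp add: is_partition_def)
  have "{i. lam i \<noteq> 0} \<subseteq> {..<r}" by (auto simp: lam_def split: if_splits)
  from card_mono [OF _ this] have "psupp lam \<le> r" by (simp add: psupp_def)
  then have "psize lam = (\<Sum>i<r. lam i)" by (simp add: sum_parts p)
  also have "\<dots> = sum_list (map lam [0..<r])"
    by (simp add: interv_sum_list_conv_sum_set_nat atLeast0LessThan)
  finally have "lam \<in> partitions_of d" using p map sum by (simp add: partitions_of_def)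
  moreover have "A = parts_mset r lam" by (simp add: parts_mset_def map xs ys_def del: map_map)
  ultimately show "A \<in> parts_mset r ` partitions_of d" by blast
qed

lemma finite_partitions_of: "finite (partitions_of d)"
  using finite_imageD [OF _ inj_on_parts_mset [of d d]] parts_mset_image [of d d] finite_nat_lists
  by simp

lemma count_parts_mset:
  assumes lam: "is_partition lam" "psupp lam \<le> r" and n: "r = n - k"
  shows "count (parts_mset r lam) x = mult_part (n, k, lam) x"
proof -
  have c: "count (parts_mset r lam) x = card {i. i < r \<and> lam i = x}"
  proof -
    have "count (parts_mset r lam) x = length (filter (\<lambda>y. x = y) (map lam [0..<r]))"
      by (simp only: parts_mset_def count_mset count_list_eq_length_filter)
    also have "\<dots> = card {i. i < r \<and> x = map lam [0..<r] ! i}"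
      by (simp add: length_filter_conv_card del: filter_map)
    also have "{i. i < r \<and> x = map lam [0..<r] ! i} = {i. i < r \<and> lam i = x}" by auto
    finally show ?thesis .
  qed
  show ?thesis
  proof (cases "x = 0")
    case True
    have "{i. i < r \<and> lam i = 0} = {..<r} - {..<psupp lam}"
      using partition_support [OF lam(1)] by blast
    then show ?thesis
      using True lam(2) n unfolding c by (simp add: mult_part_def card_Diff_subset)
  next
    case False
    have "{i. i < r \<and> lam i = x} = {i. lam i = x}"
      using False lam(2) partition_eq_0 [OF lam(1)] by (metis le_trans not_less)
    then show ?thesis unfolding c using False by (simp add: mult_part_def)
  qed
qed

definition mult_fact :: "nat multiset \<Rightarrow> complex" where
  "mult_fact A = (\<Prod>x\<in>set_mset A. fact (count A x))"

text \<open>Values up to k that do not occur contribute 0! = 1.\<close>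

lemma prod_mult_part:
  assumes lam: "is_partition lam" "psupp lam \<le> r" "lam 0 \<le> k" and n: "r = n - k"
  shows "(\<Prod>j = 0..k. fact (mult_part (n, k, lam) j)) = mult_fact (parts_mset r lam)"
proof -
  have "lam i \<le> k" for i using lam(1,3) by (meson antimonoD is_partition_def le0 order_trans)
  then have "set_mset (parts_mset r lam) \<subseteq> {0..k}" by (auto simp: parts_mset_def)
  then show ?thesis
    unfolding mult_fact_def count_parts_mset [OF lam(1,2) n, symmetric]
    by (intro prod.mono_neutral_right) (auto simp: not_in_iff)
qed

section \<open>The vectors attached to partitions\<close>

context level_one_operators
begin

lemma Y_mon_Y: "Y_mon k ss (Y a u) = Y a (Y_mon k ss u)"
  by (induction ss) (simp_all add: Y_Y [of _ a])

lemma Y_mon_append: "Y_mon k (ss @ ts) u = Y_mon k ss (Y_mon k ts u)"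
  by (induction ss) simp_all

lemma Y_mon_mset_cong: "mset ss = mset ts \<Longrightarrow> Y_mon k ss u = Y_mon k ts u"
proof (induction ss arbitrary: ts)
  case (Cons s ss)
  then have "s \<in> set ts" by (metis list.set_intros(1) mset_eq_setD)
  then obtain xs ys where ts: "ts = xs @ s # ys" by (meson split_list)
  with Cons.prems have "mset ss = mset (xs @ ys)" by simp
  then have "Y_mon k ss u = Y_mon k (xs @ ys) u" by (rule Cons.IH)
  then show ?case by (simp add: ts Y_mon_append Y_mon_Y)
qed simp

lemma H0_Y_mon:
  "H 0 u = scl h u \<Longrightarrow> H 0 (Y_mon k ss u) = scl (h - 2 * of_nat (length ss)) (Y_mon k ss u)"
proof (induction ss)
  case (Cons s ss)
  then show ?case
    by (simp add: H_Y del: scale_cancel_right flip: scale_left_diff_distrib) (simp add: algebra_simps)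
qed simp

lemma D_Y_mon:
  "D u = scl e u \<Longrightarrow>
    D (Y_mon k ss u) = scl (e + of_int (k * int (length ss) - int (sum_list ss))) (Y_mon k ss u)"
proof (induction ss)
  case (Cons s ss)
  then show ?case
    by (simp add: D_Y del: scale_cancel_right flip: scale_left_distrib scale_left_diff_distrib)
      (simp add: algebra_simps)
qed simp

lemma E_prod_cong: "(\<And>i. i < r \<Longrightarrow> u i = u' i) \<Longrightarrow> E_prod u r \<phi> = E_prod u' r \<phi>"
  by (induction r) simp_all

text \<open>The points \<open>2\<^sup>i 3\<^sup>n\<close> stay distinct when each \<open>n\<close> varies independently, so coefficients can be
  extracted one variable at a time.\<close>

lemma E_mon_in_subspace:
  assumes "subspace W" "ss \<in> nat_lists r d"
    and "\<And>u. (\<forall>i<r. \<exists>n. u i = 2 ^ i * 3 ^ n) \<Longrightarrow> E_prod u r (const_seq e) d \<in> W"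
  shows "E_mon ss e \<in> W"
  using assms
proof (induction r arbitrary: ss d W)
  case 0
  then show ?case by (auto simp: nat_lists_0 const_seq_def split: if_splits)
next
  case (Suc r)
  from Suc.prems(2) obtain s ts where ss: "ss = s # ts" "s \<le> d" "ts \<in> nat_lists r (d - s)"
    by (auto simp: nat_lists_Suc)
  have "subspace (E s -` W)"
    using Suc.prems(1) by (auto simp: subspace_def vimage_def)
  moreover have "E_prod u r (const_seq e) (d - s) \<in> E s -` W" if u: "\<forall>i<r. \<exists>n. u i = 2 ^ i * 3 ^ n" for u
  proof -
    have inj: "inj (\<lambda>n. (3 :: complex) ^ n)"
    proof (rule injI)
      fix a b assume "(3 :: complex) ^ a = 3 ^ b"
      then have "of_nat (3 ^ a) = (of_nat (3 ^ b) :: complex)" by simp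
      then have "(3 :: nat) ^ a = 3 ^ b" by (simp only: of_nat_eq_iff)
      then show "a = b" by simp
    qed
    have "(\<Sum>t\<le>d. scl ((2 ^ r * 3 ^ n) ^ t) (E t (E_prod u r (const_seq e) (d - t)))) \<in> W" for n
    proof -
      define u' where "u' = u(r := 2 ^ r * 3 ^ n)"
      have "E_prod u' r (const_seq e) = E_prod u r (const_seq e)"
        by (rule E_prod_cong) (simp add: u'_def)
      moreover have "\<forall>i<Suc r. \<exists>n. u' i = 2 ^ i * 3 ^ n" using u by (auto simp: u'_def less_Suc_eq)
      then have "E_prod u' (Suc r) (const_seq e) d \<in> W" by (rule Suc.prems(3))
      ultimately show ?thesis by (simp add: E_series_def series_def u'_def)
    qed
    from coefficients_in_subspace [OF Suc.prems(1) _ inj this ss(2)]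
    show ?thesis by simp
  qed
  ultimately have "E_mon ts e \<in> E s -` W" using Suc.IH ss(3) by blast
  then show ?case by (simp add: ss(1))
qed

end

text \<open>The power of 2 dividing 2^i 3^n recovers i, whatever the exponent of 3.\<close>

lemma inj_on_generic:
  fixes u :: "nat \<Rightarrow> complex"
  assumes "\<forall>i<r. \<exists>n. u i = 2 ^ i * 3 ^ n"
  shows "inj_on u {..<r}" "i < r \<Longrightarrow> u i \<noteq> 0"
proof -
  have le: "a \<le> b" if "(2 :: complex) ^ a * 3 ^ n = 2 ^ b * 3 ^ k" for a b n k
  proof (rule ccontr)
    assume "\<not> a \<le> b"
    then obtain c where c: "a = b + Suc c" by (metis less_iff_Suc_add not_le add_Suc_right)
    have "of_nat (2 ^ a * 3 ^ n) = (of_nat (2 ^ b * 3 ^ k) :: complex)" using that by simp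
    then have "(2 :: nat) ^ a * 3 ^ n = 2 ^ b * 3 ^ k" by (simp only: of_nat_eq_iff)
    then have "2 ^ Suc c * 3 ^ n = (3 :: nat) ^ k" by (simp add: c power_add)
    moreover have "even ((2 :: nat) ^ Suc c * 3 ^ n)" "odd ((3 :: nat) ^ k)" by simp_all
    ultimately show False by simp
  qed
  show "inj_on u {..<r}"
  proof (rule inj_onI)
    fix i l assume il: "i \<in> {..<r}" "l \<in> {..<r}" "u i = u l"
    then obtain n k where "u i = 2 ^ i * 3 ^ n" "u l = 2 ^ l * 3 ^ k" using assms by blast
    then show "i = l" using le [of i n l k] le [of l k i n] il(3) by simp
  qed
  show "u i \<noteq> 0" if "i < r" using assms that by force
qed

text \<open>The exponent r (r - 1) / 2 has the parity of [r/2].\<close>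

lemma sign_prod: "(\<Prod>i<r. (- 1) ^ i) = ((- 1) ^ (r div 2) :: 'a::comm_ring_1)"
proof (induction r)
  case (Suc r)
  then show ?case by (cases "even r") (auto elim!: evenE oddE)
qed simp

section \<open>The vectors c in the expansion of E(u_1) ... E(u_r)\<close>

context level_one_vacuum
begin

text \<open>The vector attached to \<open>(2 m, 2 m - r, lam)\<close>; the extremal vector \<open>w\<close> of the
  definition is \<open>extremal_vec m\<close> up to the sign \<open>(- 1) ^ (m div 2)\<close>.\<close>

definition c_vec :: "int \<Rightarrow> nat \<Rightarrow> (nat \<Rightarrow> nat) \<Rightarrow> 'v" where
  "c_vec m r lam = scl ((- 1) ^ (r div 2) / mult_fact (parts_mset r lam))
     (Y_mon (2 * m - int r) (map lam [0..<r]) (extremal_vec m))"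

lemma c_vec_in_wspace:
  assumes "lam \<in> partitions_of d" "d \<le> r"
  shows "c_vec m r lam \<in> wspace (m - int r) d"
proof -
  have l: "length (map lam [0..<r]) = r" "sum_list (map lam [0..<r]) = d"
    using map_parts_in_nat_lists [OF assms] by (auto simp: nat_lists_def)
  define y where "y = Y_mon (2 * m - int r) (map lam [0..<r]) (extremal_vec m)"
  have "H 0 y = scl (of_int (2 * m) - 2 * of_nat r) y"
    unfolding y_def H0_Y_mon [OF H0_extremal_vec] l ..
  also have "of_int (2 * m) - 2 * of_nat r = (of_int (2 * (m - int r)) :: complex)" by simp
  finally have H: "H 0 y = scl (of_int (2 * (m - int r))) y" .
  have "D y = scl (of_int (- (m ^ 2)) + of_int ((2 * m - int r) * int r - int d)) y"
    unfolding y_def D_Y_mon [OF D_extremal_vec] l ..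
  also have "of_int (- (m ^ 2)) + of_int ((2 * m - int r) * int r - int d)
      = (of_int (- ((m - int r) ^ 2) - int d) :: complex)"
    by (simp add: power2_eq_square algebra_simps)
  finally have D: "D y = scl (of_int (- ((m - int r) ^ 2) - int d)) y" .
  have c: "c_vec m r lam = scl ((- 1) ^ (r div 2) / mult_fact (parts_mset r lam)) y"
    by (simp only: c_vec_def y_def)
  show ?thesis
    unfolding wspace_def c by (simp only: mem_Collect_eq H_simps D_simps H D) (simp add: mult.commute)
qed

text \<open>The power expands over ordered tuples. Each shape collects r! / prod m_j! rearrangements
  with equal terms, since the modes of y commute; after r! cancels, what remains is the
  normalisation of \<open>c_vec\<close>. The coefficients are the h_lambda(u).\<close>

lemma sum_c_vec:
  assumes u: "inj_on u {..<r}" and d: "d \<le> r"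
    and q: "\<And>s. q s = lagrange_sum (u ` {..<r}) (s + (r - 1))"
  shows "(\<Sum>lam\<in>partitions_of d. scl (\<Prod>i<r. q (lam i)) (c_vec m r lam))
    = E_prod u r (const_seq (extremal_vec (m - int r))) d"
proof -
  define k where "k = 2 * m - int r"
  define e where "e = extremal_vec m"
  define \<sigma> :: complex where "\<sigma> = (- 1) ^ (r div 2)"
  define g where "g xs = scl (prod_list (map q xs)) (Y_mon k xs e)" for xs
  have \<sigma>: "\<sigma> * \<sigma> = 1" by (simp add: \<sigma>_def flip: power_add)
  have g: "g xs = g ys" if "mset xs = mset ys" for xs ys
  proof -
    have "prod_list (map q xs) = prod_list (map q ys)"
      using that by (metis mset_map prod_mset_prod_list)
    then show ?thesis using Y_mon_mset_cong [OF that] by (simp add: g_def)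
  qed
  have q_eq: "q = (\<lambda>s. lagrange_sum (u ` {..<r}) (s + (r - 1)))" by (rule ext) (rule q)
  have "scl (fact r * \<sigma>) (E_prod u r (const_seq (extremal_vec (m - int r))) d)
      = (\<Sum>xs\<in>nat_lists r d. g xs)"
    using fun_cong [OF Q_series_power_eq_E_prod [OF u, of m], of d]
    unfolding Q_series_power_const_seq scale_seq_def sign_prod g_def k_def e_def \<sigma>_def q_eq by simp
  also have "\<dots> = (\<Sum>A\<in>mset ` nat_lists r d. \<Sum>xs | xs \<in> nat_lists r d \<and> mset xs = A. g xs)"
    by (rule sum.image_gen) (rule finite_nat_lists)
  also have "\<dots> = (\<Sum>lam\<in>partitions_of d. \<Sum>xs | xs \<in> nat_lists r d \<and> mset xs = parts_mset r lam. g xs)"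
    unfolding parts_mset_image [OF d, symmetric]
    by (rule sum.reindex [OF inj_on_parts_mset [OF d], unfolded o_def])
  also have "\<dots> = (\<Sum>lam\<in>partitions_of d. scl (fact r * \<sigma>) (scl (\<Prod>i<r. q (lam i)) (c_vec m r lam)))"
  proof (intro sum.cong refl)
    fix lam assume lam: "lam \<in> partitions_of d"
    define xs where "xs = map lam [0..<r]"
    define A where "A = parts_mset r lam"
    have A: "A = mset xs" by (simp add: A_def xs_def parts_mset_def)
    have "ys \<in> nat_lists r d" if "mset ys = A" for ys
    proof -
      have "length ys = length xs" "sum_list ys = sum_list xs"
        using that unfolding A by (metis mset_eq_length, metis sum_mset_sum_list)
      then show ?thesis using map_parts_in_nat_lists [OF lam d] unfolding xs_def [symmetric]
        by (simp add: nat_lists_def)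
    qed
    then have "{ys \<in> nat_lists r d. mset ys = A} = permutations_of_multiset A"
      unfolding permutations_of_multiset_def by blast
    moreover have "(\<Sum>ys\<in>permutations_of_multiset A. g ys) = (\<Sum>ys\<in>permutations_of_multiset A. g xs)"
      by (intro sum.cong refl g) (simp add: permutations_of_multiset_def A)
    ultimately have "(\<Sum>ys | ys \<in> nat_lists r d \<and> mset ys = A. g ys)
        = scl (of_nat (card (permutations_of_multiset A))) (g xs)"
      by (simp add: sum_constant_scale)
    also have "of_nat (card (permutations_of_multiset A)) = fact r / mult_fact A"
    proof -
      have "of_nat (card (permutations_of_multiset A) * (\<Prod>x\<in>set_mset A. fact (count A x)))
          = (of_nat (fact (size A)) :: complex)"
        by (simp only: card_permutations_of_multiset_aux)
      moreover have "mult_fact A \<noteq> 0" by (simp add: mult_fact_def)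
      ultimately show ?thesis by (simp add: mult_fact_def A xs_def field_simps)
    qed
    also have "scl (fact r / mult_fact A) (g xs)
        = scl (fact r * \<sigma>) (scl (\<Prod>i<r. q (lam i)) (c_vec m r lam))"
    proof -
      have "prod_list (map q xs) = (\<Prod>i<r. q (lam i))"
        by (simp add: xs_def comp_def atLeast0LessThan flip: prod.distinct_set_conv_list)
      then show ?thesis
        using \<sigma> by (simp add: g_def c_vec_def A_def k_def e_def xs_def \<sigma>_def [symmetric] mult.assoc)
    qed
    finally show "(\<Sum>xs | xs \<in> nat_lists r d \<and> mset xs = parts_mset r lam. g xs)
        = scl (fact r * \<sigma>) (scl (\<Prod>i<r. q (lam i)) (c_vec m r lam))"
      by (simp only: A_def)
  qed
  finally have "scl (fact r * \<sigma>) (E_prod u r (const_seq (extremal_vec (m - int r))) d)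
      = scl (fact r * \<sigma>) (\<Sum>lam\<in>partitions_of d. scl (\<Prod>i<r. q (lam i)) (c_vec m r lam))"
    by (simp only: scale_sum_right)
  moreover have "fact r * \<sigma> \<noteq> 0" using \<sigma> by auto
  ultimately show ?thesis by simp
qed

text \<open>Values at generic points determine the coefficients of the product, and these span the
  weight space, so containment of the values in \<open>W\<close> suffices.\<close>

lemma wspace_subset:
  assumes W: "subspace W" and d: "d \<le> r"
    and gen: "\<And>u. (\<forall>i<r. \<exists>n. u i = 2 ^ i * 3 ^ n)
      \<Longrightarrow> E_prod u r (const_seq (extremal_vec j)) d \<in> W"
  shows "wspace j d \<subseteq> W"
proof -
  have "E_mon ss (extremal_vec j) \<in> W" if "ss \<in> nat_lists r d" for ss
    by (rule E_mon_in_subspace [OF W that gen])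
  then have "span ((\<lambda>ss. E_mon ss (extremal_vec j)) ` nat_lists r d) \<subseteq> W"
    by (intro span_minimal W) auto
  then show ?thesis
    using wspace_subset_E_mon_span [of j d] E_mon_span_length [OF d, of "extremal_vec j"]
    by (simp add: nat_lists_def)
qed

lemma wspace_subset_span_c_vec:
  assumes "d \<le> r"
  shows "wspace (m - int r) d \<subseteq> span (c_vec m r ` partitions_of d)"
proof (rule wspace_subset [OF subspace_span assms])
  fix u :: "nat \<Rightarrow> complex" assume "\<forall>i<r. \<exists>n. u i = 2 ^ i * 3 ^ n"
  then have "inj_on u {..<r}" by (rule inj_on_generic)
  from sum_c_vec [OF this assms refl, of m, symmetric]
  show "E_prod u r (const_seq (extremal_vec (m - int r))) d \<in> span (c_vec m r ` partitions_of d)"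
    by (simp only:) (intro span_sum span_scale span_base imageI)
qed

text \<open>A part p corresponds to h t^-p, which the monomials index by p - 1.\<close>

definition reduced_parts :: "nat \<Rightarrow> (nat \<Rightarrow> nat) \<Rightarrow> nat multiset" where
  "reduced_parts r lam = image_mset (\<lambda>x. x - 1) (filter_mset (\<lambda>x. x \<noteq> 0) (parts_mset r lam))"

lemma Suc_reduced_parts: "image_mset Suc (reduced_parts r lam) = filter_mset (\<lambda>x. x \<noteq> 0) (parts_mset r lam)"
  unfolding reduced_parts_def image_mset.compositionality
  by (rule trans [OF image_mset_cong [where g = id]]) auto

lemma sum_reduced_parts:
  assumes "lam \<in> partitions_of d" "d \<le> r"
  shows "(\<Sum>l\<in>#reduced_parts r lam. Suc l) = d"
proof -
  have "sum_mset (filter_mset (\<lambda>x. x \<noteq> 0) A) = sum_mset A" for A :: "nat multiset"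
    by (induction A) auto
  then have "(\<Sum>l\<in>#reduced_parts r lam. Suc l) = sum_mset (parts_mset r lam)"
    by (simp only: Suc_reduced_parts)
  also have "\<dots> = sum_list (map lam [0..<r])"
    by (simp only: parts_mset_def sum_mset_sum_list)
  finally show ?thesis using map_parts_in_nat_lists [OF assms] by (simp add: nat_lists_def)
qed

text \<open>The number of dropped zeros is recovered as r minus the number of remaining
  parts.\<close>

lemma inj_on_reduced_parts:
  assumes "d \<le> r"
  shows "inj_on (reduced_parts r) (partitions_of d)"
proof (rule inj_onI)
  fix lam mu assume lm: "lam \<in> partitions_of d" "mu \<in> partitions_of d"
    and "reduced_parts r lam = reduced_parts r mu"
  then have f: "filter_mset (\<lambda>x. x \<noteq> 0) (parts_mset r lam) = filter_mset (\<lambda>x. x \<noteq> 0) (parts_mset r mu)"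
    by (metis Suc_reduced_parts)
  have "parts_mset r lam = parts_mset r mu"
  proof (rule multiset_eqI)
    fix x
    have pos: "count (parts_mset r lam) y = count (parts_mset r mu) y" if "y \<noteq> 0" for y
      using arg_cong [OF f, of "\<lambda>A. count A y"] that by simp
    have z: "count A 0 = size A - size (filter_mset (\<lambda>x. x \<noteq> 0) A)" for A :: "nat multiset"
      by (induction A) (auto simp: Suc_diff_le size_filter_mset_lesseq)
    show "count (parts_mset r lam) x = count (parts_mset r mu) x"
    proof (cases "x = 0")
      case True
      have "size (parts_mset r nu) = r" for nu by (simp add: parts_mset_def)
      then show ?thesis using True f by (simp only: z)
    qed (use pos in auto)
  qed
  then show "lam = mu" using inj_on_parts_mset [OF assms] lm by (auto dest: inj_onD)
qed

text \<open>The weight space is spanned by vectors indexed by the partitions of d and contains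
  equally many independent Heisenberg monomials, so no two of the spanning vectors coincide and none
  is redundant.\<close>

theorem c_vec_basis:
  assumes d: "d \<le> r"
  shows "independent (c_vec m r ` partitions_of d)"
    "inj_on (c_vec m r) (partitions_of d)"
    "span (c_vec m r ` partitions_of d) = wspace (m - int r) d"
proof -
  define j where "j = m - int r"
  define f where "f lam = H_neg_mset (reduced_parts r lam) (extremal_vec j)" for lam
  have f: "inj_on f (partitions_of d)" "independent (f ` partitions_of d)"
    unfolding f_def using H_neg_mset_independent [OF sum_reduced_parts inj_on_reduced_parts, OF _ d d] by auto
  have fw: "f lam \<in> wspace j d" if "lam \<in> partitions_of d" for lam
    using H_neg_mset_eigen [OF H0_extremal_vec D_extremal_vec, of "reduced_parts r lam" j]
      sum_reduced_parts [OF that d] by (simp add: f_def wspace_def)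
  then have sub: "f ` partitions_of d \<subseteq> span (c_vec m r ` partitions_of d)"
    using wspace_subset_span_c_vec [OF d] by (auto simp: j_def)
  have le: "card (c_vec m r ` partitions_of d) \<le> card (f ` partitions_of d)"
    by (simp add: card_image f(1) card_image_le finite_partitions_of)
  note ind = spanning_set_independent [OF _ le f(2) sub]
  show "independent (c_vec m r ` partitions_of d)"
    by (rule ind(1)) (simp add: finite_partitions_of)
  have "card (c_vec m r ` partitions_of d) = card (partitions_of d)"
    using ind(2) f(1) by (simp add: finite_partitions_of card_image)
  then show "inj_on (c_vec m r) (partitions_of d)"
    by (intro eq_card_imp_inj_on finite_partitions_of)
  have "subspace (wspace (m - int r) d)"
    by (auto simp: subspace_def wspace_def scale_right_distrib mult.commute)
  then show "span (c_vec m r ` partitions_of d) = wspace (m - int r) d"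
    by (intro antisym span_minimal wspace_subset_span_c_vec d) (auto intro: c_vec_in_wspace d)
qed

text \<open>Both families expand the same product, as the series E(0) is 1 and h_s(u, 0) = h_s(u).
  Rather than inverting this system, the linear map \<open>T\<close> from one family to the other is
  shown to fix the values of the product, hence the whole weight space.\<close>

theorem c_vec_stable:
  assumes lam: "lam \<in> partitions_of d" and d: "d \<le> r"
  shows "c_vec (m + 1) (Suc r) lam = c_vec m r lam"
proof -
  interpret pair: vector_space_pair scl scl by unfold_locales
  obtain T where T: "Vector_Spaces.linear scl scl T"
    "\<forall>x\<in>c_vec m r ` partitions_of d. T x = (c_vec (m + 1) (Suc r) \<circ> inv_into (partitions_of d) (c_vec m r)) x"
    using pair.linear_independent_extend [OF c_vec_basis(1) [OF d]] by blast
  have hom: "module_hom scl scl T" using T(1) by (simp add: module_hom_iff_linear)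
  have Tc: "T (c_vec m r lam) = c_vec (m + 1) (Suc r) lam" if "lam \<in> partitions_of d" for lam
    using T(2) that c_vec_basis(2) [OF d] by simp
  have "wspace (m - int r) d \<subseteq> {x. T x = x}"
  proof (rule wspace_subset [OF _ d])
    show "subspace {x. T x = x}"
      by (simp add: subspace_def module_hom.add [OF hom] module_hom.scale [OF hom] module_hom.zero [OF hom])
    fix u :: "nat \<Rightarrow> complex" assume u: "\<forall>i<r. \<exists>n. u i = 2 ^ i * 3 ^ n"
    define u' where "u' = u(r := 0)"
    define S where "S = u ` {..<r}"
    have S: "finite S" "card S = r" "0 \<notin> S"
      using inj_on_generic [OF u] by (auto simp: S_def card_image)
    have S': "u' ` {..<Suc r} = insert 0 S"
      by (auto simp: S_def u'_def lessThan_Suc image_iff)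
    have inj': "inj_on u' {..<Suc r}"
      using inj_on_generic [OF u] by (auto simp: inj_on_def u'_def less_Suc_eq)
    define q where "q s = lagrange_sum S (s + (r - 1))" for s
    define q' where "q' s = lagrange_sum (insert 0 S) (s + r)" for s
    have q': "q' s = q s" if "r \<noteq> 0" for s
    proof -
      have "s + r = Suc (s + (r - 1))" using that by simp
      then show ?thesis
        unfolding q_def q'_def by (simp only: lagrange_sum_insert [OF S(1,3)]) simp
    qed
    have q'0: "q' 0 = 1"
      using lagrange_sum_eq [of "insert 0 S" r] S by (simp add: q'_def)
    have prod: "(\<Prod>i<Suc r. q' (mu i)) = (\<Prod>i<r. q (mu i))" if mu: "mu \<in> partitions_of d" for mu
    proof -
      \<comment> \<open>The additional part is 0 because d \<le> r, and its factor is h_0 =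
        1.\<close>
      have "mu r = 0"
        using mu partition_eq_0 psupp_le [OF mu d] by (simp add: partitions_of_def)
      then show ?thesis using q' q'0 by simp
    qed
    have j: "m + 1 - int (Suc r) = m - int r" by simp
    have "E_prod u' (Suc r) \<phi> = E_prod u r \<phi>" for \<phi>
    proof
      fix n
      have "E_prod u' r \<phi> = E_prod u r \<phi>" by (rule E_prod_cong) (simp add: u'_def)
      then have "E_prod u' (Suc r) \<phi> n = (\<Sum>s\<le>n. scl (0 ^ s) (E s (E_prod u r \<phi> (n - s))))"
        by (simp add: E_series_def series_def u'_def)
      also have "\<dots> = (\<Sum>s\<in>{0}. scl (0 ^ s) (E s (E_prod u r \<phi> (n - s))))"
        by (rule sum.mono_neutral_right) auto
      finally show "E_prod u' (Suc r) \<phi> n = E_prod u r \<phi> n" by simp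
    qed
    then have "E_prod u r (const_seq (extremal_vec (m - int r))) d
      = (\<Sum>mu\<in>partitions_of d. scl (\<Prod>i<Suc r. q' (mu i)) (c_vec (m + 1) (Suc r) mu))"
      using sum_c_vec [OF inj', of d q' "m + 1"] d unfolding S' j q'_def by simp
    also have "\<dots> = (\<Sum>mu\<in>partitions_of d. scl (\<Prod>i<r. q (mu i)) (T (c_vec m r mu)))"
      by (intro sum.cong refl) (simp only: prod Tc)
    also have "\<dots> = T (\<Sum>mu\<in>partitions_of d. scl (\<Prod>i<r. q (mu i)) (c_vec m r mu))"
      by (simp add: module_hom.sum [OF hom] module_hom.scale [OF hom])
    also have "(\<Sum>mu\<in>partitions_of d. scl (\<Prod>i<r. q (mu i)) (c_vec m r mu))
        = E_prod u r (const_seq (extremal_vec (m - int r))) d"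
      by (rule sum_c_vec [OF inj_on_generic(1) [OF u] d]) (simp add: q_def S_def)
    finally show "E_prod u r (const_seq (extremal_vec (m - int r))) d \<in> {x. T x = x}"
      by (intro CollectI) (rule sym)
  qed
  then have "T (c_vec m r lam) = c_vec m r lam" using c_vec_in_wspace [OF lam d] by blast
  then show ?thesis by (simp only: Tc [OF lam])
qed

text \<open>The degree 0 term of \<open>Q_series_power_eq_E_prod\<close>: only the tuple of zeros
  contributes, and each exponential acts as 1. Any distinct points can be used.\<close>

lemma Y_power_extremal_vec:
  "(Y (2 * m - int r) ^^ r) (extremal_vec m) = scl (fact r * (- 1) ^ (r div 2)) (extremal_vec (m - int r))"
proof -
  define u where "u i = (of_nat i :: complex)" for i
  have inj: "inj_on u {..<r}" by (simp add: u_def inj_on_def)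
  define q where "q s = lagrange_sum (u ` {..<r}) (s + (r - 1))" for s
  have q0: "q 0 = 1" if "r \<noteq> 0"
    using lagrange_sum_eq [of "u ` {..<r}" "r - 1"] inj that by (simp add: q_def card_image)
  have "xs = replicate r 0" if "xs \<in> nat_lists r 0" for xs
    using that by (auto simp: nat_lists_def intro: replicate_eqI)
  then have "nat_lists r 0 = {replicate r 0}"
    by (auto simp: nat_lists_def sum_list_replicate)
  then have "(Q_series (2 * m - int r) q ^^ r) (const_seq (extremal_vec m)) 0
      = scl (q 0 ^ r) (Y_mon (2 * m - int r) (replicate r 0) (extremal_vec m))"
    by (simp add: Q_series_power_const_seq prod_list_replicate)
  also have "\<dots> = Y_mon (2 * m - int r) (replicate r 0) (extremal_vec m)"
    using q0 by (cases "r = 0") auto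
  also have "Y_mon k (replicate s 0) w = (Y k ^^ s) w" for k s w
    by (induction s) simp_all
  finally have "(Y (2 * m - int r) ^^ r) (extremal_vec m)
      = (Q_series (2 * m - int r) q ^^ r) (const_seq (extremal_vec m)) 0" ..
  also have "\<dots> = scl (fact r * (- 1) ^ (r div 2)) (E_prod u r (const_seq (extremal_vec (m - int r))) 0)"
    using fun_cong [OF Q_series_power_eq_E_prod [OF inj, of m], of 0]
    by (simp add: scale_seq_def sign_prod q_def [abs_def])
  also have "E_prod u s (const_seq w) 0 = w" for s w
    by (induction s) (simp_all add: const_seq_def E_series_def series_def)
  finally show ?thesis .
qed

end

text \<open>\<open>Y_power_extremal_vec\<close> with x and y exchanged and m = 0. It identifies w_n,
  n = 2 r, with the extremal vector up to the sign (-1)^[r/2] = (-1)^[n/4].\<close>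

lemma (in level_one_vacuum) X_power_vacuum:
  "(X (- int r) ^^ r) v = scl (fact r * (- 1) ^ (r div 2)) (extremal_vec (int r))"
proof -
  interpret S: level_one_vacuum scl Y X "\<lambda>a u. - H a u" D v by (rule swapped_vacuum)
  have "S.extremal_below s = extremal_above s" for s
    by (induction s) simp_all
  then have "S.extremal_vec (- int r) = extremal_vec (int r)"
    by (cases "r = 0") (simp_all add: S.extremal_vec_def extremal_vec_def)
  then show ?thesis
    using S.Y_power_extremal_vec [where m = 0 and r = r]
    unfolding S.extremal_vec_0 by (simp only: diff_0 mult_zero_right)
qed

section \<open>The action of the affine Lie algebra\<close>

lemma sl2_entries [simp]:
  "sl2_x $ 1 $ 1 = 0" "sl2_x $ 1 $ 2 = 1" "sl2_x $ 2 $ 1 = 0" "sl2_x $ 2 $ 2 = 0"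
  "sl2_h $ 1 $ 1 = 1" "sl2_h $ 1 $ 2 = 0" "sl2_h $ 2 $ 1 = 0" "sl2_h $ 2 $ 2 = - 1"
  "sl2_y $ 1 $ 1 = 0" "sl2_y $ 1 $ 2 = 0" "sl2_y $ 2 $ 1 = 1" "sl2_y $ 2 $ 2 = 0"
  by (simp_all add: sl2_x_def sl2_h_def sl2_y_def)

lemma mat2_eq_iff: "(A :: mat2) = B \<longleftrightarrow>
    A $ 1 $ 1 = B $ 1 $ 1 \<and> A $ 1 $ 2 = B $ 1 $ 2 \<and> A $ 2 $ 1 = B $ 2 $ 1 \<and> A $ 2 $ 2 = B $ 2 $ 2"
  by (auto simp: vec_eq_iff forall_2)

lemma mat2_mult_entry: "((A :: mat2) ** (B :: mat2)) $ i $ j = A $ i $ 1 * B $ 1 $ j + A $ i $ 2 * B $ 2 $ j"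
  by (simp add: matrix_matrix_mult_def sum_2)

lemma trace_mat2: "trace (A :: mat2) = A $ 1 $ 1 + A $ 2 $ 2"
  by (simp add: trace_def sum_2)

lemma mat_bracket_sl2:
  "mat_bracket sl2_x sl2_x = 0" "mat_bracket sl2_y sl2_y = 0" "mat_bracket sl2_h sl2_h = 0"
  "mat_bracket sl2_h sl2_x = mat_scale 2 sl2_x" "mat_bracket sl2_h sl2_y = mat_scale (- 2) sl2_y"
  "mat_bracket sl2_x sl2_y = sl2_h"
  by (simp_all add: mat2_eq_iff mat_bracket_def mat2_mult_entry mat_scale_def)

lemma loop_mat_scale: "loop (mat_scale a A) m = affine_scale a (loop A m)"
  by (simp add: loop_def affine_scale_def map_mat_scale_single)

lemma loop_add: "loop (A + B) m = loop A m + loop B m"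
  by (simp add: loop_def single_add)

lemma loop_in_affine_sl2: "trace A = 0 \<Longrightarrow> loop A m \<in> affine_sl2"
  by (auto simp: affine_sl2_def loop_def lookup_single when_def)

lemma central_deriv_in_affine_sl2: "central_c \<in> affine_sl2" "deriv_d \<in> affine_sl2"
  by (simp_all add: affine_sl2_def central_c_def deriv_d_def)

lemma trace_sl2 [simp]: "trace sl2_x = 0" "trace sl2_h = 0" "trace sl2_y = 0"
  by (simp_all add: trace_mat2)

lemma affine_sl2_closed:
  "Z \<in> affine_sl2 \<Longrightarrow> Z' \<in> affine_sl2 \<Longrightarrow> Z + Z' \<in> affine_sl2"
  "Z \<in> affine_sl2 \<Longrightarrow> affine_scale a Z \<in> affine_sl2"
proof -
  have "trace (mat_scale a A) = a * trace A" for A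
    by (simp add: trace_mat2 mat_scale_def distrib_left)
  then show "Z \<in> affine_sl2 \<Longrightarrow> affine_scale a Z \<in> affine_sl2"
    by (cases Z) (simp add: affine_sl2_def affine_scale_def Poly_Mapping.map.rep_eq when_def)
qed (cases Z; cases Z'; simp add: affine_sl2_def lookup_add trace_add)

lemma affine_scale_0: "affine_scale 0 Z = 0"
  by (cases Z) (simp add: affine_scale_def zero_prod_def)

lemma zero_in_affine_sl2: "0 \<in> affine_sl2"
  by (simp add: affine_sl2_def zero_prod_def)

context affine_module
begin

lemma act_0: "act 0 u = 0"
  using act_scale [OF zero_in_affine_sl2, of 0 u] by (simp add: affine_scale_0)

lemma module_hom_act: "Z \<in> affine_sl2 \<Longrightarrow> module_hom scl scl (act Z)"
  using act_linear by (simp add: module_hom_iff_linear)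

lemma act_of_cartan:
  "act (of_cartan (a, b, e)) u
    = scl a (act (loop sl2_h 0) u) + scl b (act central_c u) + scl e (act deriv_d u)"
  by (simp add: of_cartan_def act_add act_scale affine_sl2_closed loop_in_affine_sl2
      central_deriv_in_affine_sl2)

lemma act_loop_loop:
  assumes "trace A = 0" "trace B = 0" and c: "\<And>u. act central_c u = u"
  shows "act (loop A m) (act (loop B n) u) = act (loop B n) (act (loop A m) u)
    + act (loop (mat_bracket A B) (m + n)) u
    + scl (if m + n = 0 then of_int m * trace (A ** B) else 0) u"
proof -
  have t: "trace (mat_bracket A B) = 0"
    by (simp add: mat_bracket_def trace_mat2 mat2_mult_entry)
  have "act (loop A m) (act (loop B n) u) - act (loop B n) (act (loop A m) u)
      = act (affine_bracket (loop A m) (loop B n)) u"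
    using act_bracket assms by (simp add: loop_in_affine_sl2)
  also have "\<dots> = act (loop (mat_bracket A B) (m + n)) u
      + scl (if m = - n then of_int m * trace (A ** B) else 0) u"
    unfolding affine_bracket_loop
    by (simp add: act_add act_scale t loop_in_affine_sl2 central_deriv_in_affine_sl2 affine_sl2_closed c)
  finally show ?thesis by (simp add: algebra_simps eq_neg_iff_add_eq_0)
qed

lemma act_deriv_loop:
  assumes "trace A = 0"
  shows "act deriv_d (act (loop A m) u) = act (loop A m) (act deriv_d u) + scl (of_int m) (act (loop A m) u)"
proof -
  have "act deriv_d (act (loop A m) u) - act (loop A m) (act deriv_d u)
      = act (affine_bracket deriv_d (loop A m)) u"
    using act_bracket assms by (simp add: loop_in_affine_sl2 central_deriv_in_affine_sl2)
  also have "\<dots> = scl (of_int m) (act (loop A m) u)"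
    unfolding affine_bracket_d using assms by (simp add: act_scale loop_in_affine_sl2)
  finally show ?thesis by (simp add: algebra_simps)
qed

text \<open>A traceless matrix is a combination of h, x and y, and a loop is a finite sum of
  monomials, so stability can be tested on these.\<close>

lemma submoduleI_loops:
  assumes W: "subspace W"
    and X: "\<And>m u. u \<in> W \<Longrightarrow> act (loop sl2_x m) u \<in> W"
    and Y: "\<And>m u. u \<in> W \<Longrightarrow> act (loop sl2_y m) u \<in> W"
    and H: "\<And>m u. u \<in> W \<Longrightarrow> act (loop sl2_h m) u \<in> W"
    and c: "\<And>u. u \<in> W \<Longrightarrow> act central_c u \<in> W"
    and D: "\<And>u. u \<in> W \<Longrightarrow> act deriv_d u \<in> W"
  shows "submodule scl act W"
proof -
  define good where "good Z \<longleftrightarrow> Z \<in> affine_sl2 \<and> (\<forall>u\<in>W. act Z u \<in> W)" for Z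
  have add: "good (Z + Z')" if "good Z" "good Z'" for Z Z'
    using that by (simp add: good_def act_add affine_sl2_closed subspace_add [OF W])
  have scale: "good (affine_scale a Z)" if "good Z" for a Z
    using that by (simp add: good_def act_scale affine_sl2_closed subspace_scale [OF W])
  have loop: "good (loop A m)" if "trace A = 0" for A m
  proof -
    have "A = mat_scale (A $ 1 $ 1) sl2_h + mat_scale (A $ 1 $ 2) sl2_x + mat_scale (A $ 2 $ 1) sl2_y"
      using that by (simp add: mat2_eq_iff mat_scale_def trace_mat2 eq_neg_iff_add_eq_0 add.commute)
    then have "loop A m = affine_scale (A $ 1 $ 1) (loop sl2_h m) + affine_scale (A $ 1 $ 2) (loop sl2_x m)
        + affine_scale (A $ 2 $ 1) (loop sl2_y m)"
      by (metis loop_add loop_mat_scale)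
    moreover have "good (loop sl2_h m)" "good (loop sl2_x m)" "good (loop sl2_y m)"
      using X Y H by (simp_all add: good_def loop_in_affine_sl2)
    ultimately show ?thesis by (auto intro!: add scale)
  qed
  have "good Z" if "Z \<in> affine_sl2" for Z
  proof -
    obtain F b e where Z: "Z = (F, b, e)" by (cases Z)
    have "good (\<Sum>m\<in>K. Poly_Mapping.single m (Poly_Mapping.lookup F m), 0, 0)" if "finite K" for K
      using that
    proof (induction K)
      case empty
      show ?case
        using act_0 subspace_0 [OF W] zero_in_affine_sl2 by (simp add: good_def flip: zero_prod_def)
    next
      case (insert m K)
      have "trace (Poly_Mapping.lookup F m) = 0" using \<open>Z \<in> affine_sl2\<close> by (simp add: Z affine_sl2_def)
      from add [OF loop [OF this, of m] insert.IH] insert.hyps show ?case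
        by (simp add: loop_def)
    qed
    moreover have "(\<Sum>m\<in>Poly_Mapping.keys F. Poly_Mapping.single m (Poly_Mapping.lookup F m)) = F"
      by (rule poly_mapping_eqI) (simp add: lookup_sum lookup_single when_def in_keys_iff)
    ultimately have "good (F, 0, 0)" by (metis finite_keys)
    moreover have "good central_c" "good deriv_d"
      using c D by (simp_all add: good_def central_deriv_in_affine_sl2)
    moreover have "Z = (F, 0, 0) + affine_scale b central_c + affine_scale e deriv_d"
      by (simp add: Z affine_scale_def central_c_def deriv_d_def)
    ultimately show ?thesis by (auto intro!: add scale)
  qed
  then show ?thesis using W by (auto simp: submodule_def good_def)
qed

end

lemma (in irreducible_highest_weight_module) level_one_vacuum:
  assumes \<Lambda>: "\<Lambda> = Lambda0"
  shows "level_one_vacuum scl (\<lambda>a. act (loop sl2_x a)) (\<lambda>a. act (loop sl2_y a))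
      (\<lambda>a. act (loop sl2_h a)) (act deriv_d) v"
    and "act central_c u = u"
proof -
  have hw: "act (loop sl2_h 0) v = 0" "act central_c v = v" "act deriv_d v = 0"
  proof -
    have *: "act (of_cartan H) v = scl (Lambda0 H) v" for H
      using hw_weight unfolding weight_space_def \<Lambda> by blast
    show "act (loop sl2_h 0) v = 0" using * [of "(1, 0, 0)"] by (simp add: act_of_cartan Lambda0_def)
    show "act central_c v = v" using * [of "(0, 1, 0)"] by (simp add: act_of_cartan Lambda0_def)
    show "act deriv_d v = 0" using * [of "(0, 0, 1)"] by (simp add: act_of_cartan Lambda0_def)
  qed
  \<comment> \<open>As c is central, its fixed vectors form a submodule; it contains
    \<open>v\<close> and is therefore everything.\<close>
  have "submodule scl act {u. act central_c u = u}"
  proof -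
    have hom: "module_hom scl scl (act central_c)"
      by (rule module_hom_act) (rule central_deriv_in_affine_sl2)
    have "act central_c (act Z u) = act Z (act central_c u)" if "Z \<in> affine_sl2" for Z u
      using act_bracket [OF central_deriv_in_affine_sl2(1) that, of u] by (simp add: affine_bracket_c act_0)
    then show ?thesis
      unfolding submodule_def
      by (auto simp: subspace_def module_hom.add [OF hom] module_hom.scale [OF hom] module_hom.zero [OF hom])
  qed
  then have "{u. act central_c u = u} = UNIV" by (rule hw_generates) (simp add: hw)
  then show c: "act central_c u = u" for u by blast
  have bracket_h: "act (loop (mat_scale a A) m) u = scl a (act (loop A m) u)" if "trace A = 0" for a A m u
    using that by (simp add: loop_mat_scale act_scale loop_in_affine_sl2)
  have loop_0: "act (loop 0 m) u = 0" for m u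
    using act_0 by (simp add: loop_def flip: zero_prod_def)
  note comm = act_loop_loop [OF _ _ c]
  show "level_one_vacuum scl (\<lambda>a. act (loop sl2_x a)) (\<lambda>a. act (loop sl2_y a))
      (\<lambda>a. act (loop sl2_h a)) (act deriv_d) v"
  proof (intro level_one_vacuum.intro level_one_operators.intro vector_space_axioms
      level_one_operators_axioms.intro level_one_vacuum_axioms.intro, goal_cases)
    case (5 a b u)
    show ?case using comm [of sl2_x sl2_x a b u]
      by (simp add: mat_bracket_sl2 loop_0 trace_mat2 mat2_mult_entry)
  next
    case (6 a b u)
    show ?case using comm [of sl2_y sl2_y a b u]
      by (simp add: mat_bracket_sl2 loop_0 trace_mat2 mat2_mult_entry)
  next
    case (7 a b u)
    show ?case using comm [of sl2_h sl2_x a b u]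
      by (simp add: mat_bracket_sl2 bracket_h trace_mat2 mat2_mult_entry)
  next
    case (8 a b u)
    show ?case using comm [of sl2_h sl2_y a b u]
      by (simp add: mat_bracket_sl2 bracket_h trace_mat2 mat2_mult_entry)
  next
    case (9 a b u)
    show ?case using comm [of sl2_h sl2_h a b u]
      by (simp add: mat_bracket_sl2 loop_0 trace_mat2 mat2_mult_entry mult.commute)
  next
    case (10 a b u)
    show ?case using comm [of sl2_x sl2_y a b u]
      by (simp add: mat_bracket_sl2 trace_mat2 mat2_mult_entry)
  next
    case (19 W)
    show ?case by (rule irreducible [OF submoduleI_loops]) (use 19 c in auto)
  qed (use hw_nonzero hw_e0 hw_e1 hw in \<open>auto simp: e0_def e1_def act_deriv_loop
      intro!: module_hom_act loop_in_affine_sl2 central_deriv_in_affine_sl2\<close>)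
qed

section \<open>The bases of the weight spaces and of the whole module\<close>

locale basic_representation = irreducible_highest_weight_module scl act Lambda0 v
  for scl :: "complex \<Rightarrow> 'v::ab_group_add \<Rightarrow> 'v" and act :: "affine \<Rightarrow> 'v \<Rightarrow> 'v" and v :: 'v
begin

sublocale V: level_one_vacuum scl "\<lambda>a. act (loop sl2_x a)" "\<lambda>a. act (loop sl2_y a)"
  "\<lambda>a. act (loop sl2_h a)" "act deriv_d" v
  by (rule level_one_vacuum(1) [OF refl])

lemma act_of_cartan_basic:
  "act (of_cartan (a, b, e)) u = scl a (act (loop sl2_h 0) u) + scl b u + scl e (act deriv_d u)"
  using level_one_vacuum(2) [OF refl] by (simp add: act_of_cartan)

lemma wt_apply: "wt j d (a, b, e) = b + of_int (2 * j) * a + of_int (- (j ^ 2) - int d) * e"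
  by (simp add: wt_def transl_Lambda0_def Lambda0_def alpha1_def delta_def algebra_simps)

lemma weight_space_wt: "weight_space scl act (wt j d) = V.wspace j d"
proof (intro equalityI subsetI)
  fix u assume "u \<in> weight_space scl act (wt j d)"
  then have u: "act (of_cartan H) u = scl (wt j d H) u" for H
    unfolding weight_space_def by blast
  show "u \<in> V.wspace j d"
    using u [of "(1, 0, 0)"] u [of "(0, 0, 1)"] by (simp add: V.wspace_def act_of_cartan_basic wt_apply)
next
  fix u assume "u \<in> V.wspace j d"
  then have u: "act (loop sl2_h 0) u = scl (of_int (2 * j)) u"
    "act deriv_d u = scl (of_int (- (j ^ 2) - int d)) u" by (simp_all only: V.wspace_def mem_Collect_eq)
  have "act (of_cartan (a, b, e)) u = scl (wt j d (a, b, e)) u" for a b e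
    unfolding act_of_cartan_basic u wt_apply by (simp add: scale_left_distrib mult.commute add.commute)
  then show "u \<in> weight_space scl act (wt j d)" by (auto simp: weight_space_def)
qed

text \<open>A non-zero weight vector is a joint eigenvector of h and d, which determines (j, d);
  being non-zero, it then forces equality of the two weights on the whole Cartan subalgebra.\<close>

lemma weights_are_wt:
  assumes "\<mu> \<in> weights scl act"
  shows "\<exists>j d. \<mu> = wt j d"
proof -
  have "0 \<in> weight_space scl act \<mu>"
    by (auto simp: weight_space_def act_of_cartan_basic)
  then obtain u where u: "u \<in> weight_space scl act \<mu>" "u \<noteq> 0"
    using assms unfolding weights_def by blast
  then have \<mu>: "act (of_cartan H) u = scl (\<mu> H) u" for H
    unfolding weight_space_def by blast
  have "act (loop sl2_h 0) u = scl (\<mu> (1, 0, 0)) u" "act deriv_d u = scl (\<mu> (0, 0, 1)) u"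
    using \<mu> [of "(1, 0, 0)"] \<mu> [of "(0, 0, 1)"] by (simp_all add: act_of_cartan_basic)
  from V.joint_eigenvector_wspace [OF this u(2)] obtain j d where "u \<in> V.wspace j d" by blast
  then have "act (of_cartan H) u = scl (wt j d H) u" for H
    using weight_space_wt unfolding weight_space_def by blast
  then have "scl (\<mu> H) u = scl (wt j d H) u" for H using \<mu> by simp
  then have "\<mu> = wt j d" using u(2) by auto
  then show ?thesis by blast
qed

text \<open>The sign (-1)^[m/2] of w_n, n = 2 m, cancels the factor (-1)^[n/4] of z and leaves
  (-1)^[r/2].\<close>

lemma cvec_eq_c_vec:
  assumes lam: "is_partition lam" "lam 0 \<le> k" "psupp lam \<le> 2 * m - k" and k: "k \<le> 2 * m"
  shows "cvec scl act v (2 * m, k, lam) = V.c_vec (int m) (2 * m - k) lam"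
proof -
  define r where "r = 2 * m - k"
  have k_r: "2 * int m - int r = int k" using k by (simp add: r_def)
  have w: "wvec scl act v (2 * m) = scl ((- 1) ^ (m div 2)) (V.extremal_vec (int m))"
    using V.X_power_vacuum [of m] by (simp add: wvec_def divided_power_def)
  have f: "foldr (\<lambda>i. act (loop sl2_y (int k - int (lam i)))) xs u
      = V.Y_mon (2 * int m - int r) (map lam xs) u" for xs u
    by (induction xs) (simp_all add: k_r)
  have hom: "V.Y_mon l ss (scl c u) = scl c (V.Y_mon l ss u)" for l ss c u
    by (induction ss) simp_all
  have sign: "(- 1 :: complex) powi (int a - int b) * (- 1) ^ a = (- 1) ^ b" for a b
  proof -
    have "(- 1 :: complex) powi (int a - int b) = (- 1) ^ a / (- 1) ^ b"
      by (simp add: power_int_diff)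
    moreover have "(- 1 :: complex) ^ a * (- 1) ^ a = 1" "(- 1 :: complex) ^ b * (- 1) ^ b = 1"
      by (simp_all flip: power_add)
    ultimately show ?thesis
      by (simp only: times_divide_eq_left) (simp add: divide_eq_eq)
  qed
  have z: "zcoef (2 * m, k, lam) * (- 1) ^ (m div 2) = (- 1) ^ (r div 2) / mult_fact (parts_mset r lam)"
  proof -
    have "2 * m div 4 = m div 2" by simp
    moreover have "(\<Prod>i = 0..k. fact (mult_part (2 * m, k, lam) i)) = mult_fact (parts_mset r lam)"
      by (rule prod_mult_part) (use lam in \<open>simp_all add: r_def\<close>)
    ultimately show ?thesis
      using sign [of "m div 2" "r div 2"] by (simp add: zcoef_def r_def)
  qed
  have "cvec scl act v (2 * m, k, lam)
      = scl (zcoef (2 * m, k, lam)) (scl ((- 1) ^ (m div 2))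
          (V.Y_mon (2 * int m - int r) (map lam [0..<r]) (V.extremal_vec (int m))))"
    by (simp only: cvec_def prod.case f w hom r_def)
  then show ?thesis by (simp add: z V.c_vec_def flip: r_def)
qed

text \<open>For k = n/2 + j the bound on n gives d \<le> k and d \<le> n - k, so every partition of
  d fits into the box.\<close>

lemma BB_eq:
  assumes "even n" "2 * (int d + \<bar>j\<bar>) \<le> int n"
  shows "BB scl act v (wt j d) n = V.c_vec (int (n div 2)) (nat (int (n div 2) - j)) ` partitions_of d"
    and "d \<le> nat (int (n div 2) - j)"
proof -
  obtain m where n: "n = 2 * m" using assms(1) by blast
  define k where "k = nat (int m + j)"
  have m: "int d + \<bar>j\<bar> \<le> int m" using assms(2) n by simp
  then have k: "int k = int m + j" "k \<le> 2 * m" "2 * m - k = nat (int m - j)" "d \<le> k" "d \<le> 2 * m - k"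
    unfolding k_def by auto
  have rat: "of_nat k' - of_nat n / 2 = (of_int j :: rat) \<longleftrightarrow> k' = k" for k'
  proof -
    have "of_nat k' - of_nat n / 2 = (of_int (int k' - int m) :: rat)" by (simp add: n)
    then have "of_nat k' - of_nat n / 2 = (of_int j :: rat) \<longleftrightarrow> int k' - int m = j"
      by (simp only: of_int_eq_iff)
    then show ?thesis using k(1) by auto
  qed
  have "PP_wt (wt j d) n = (\<lambda>lam. (n, k, lam)) ` partitions_of d"
  proof (intro equalityI subsetI)
    fix \<xi> assume "\<xi> \<in> PP_wt (wt j d) n"
    then show "\<xi> \<in> (\<lambda>lam. (n, k, lam)) ` partitions_of d"
      by (auto simp: PP_wt_def PP_def wt_inject rat partitions_of_def)
  next
    fix \<xi> assume "\<xi> \<in> (\<lambda>lam. (n, k, lam)) ` partitions_of d"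
    then obtain lam where lam: "\<xi> = (n, k, lam)" "is_partition lam" "psize lam = d"
      by (auto simp: partitions_of_def)
    have "lam 0 \<le> k" using part_le_psize [OF lam(2), of 0] lam(3) k by simp
    moreover have "psupp lam \<le> n - k" using psupp_le_psize [of lam] lam(3) k n by simp
    ultimately show "\<xi> \<in> PP_wt (wt j d) n"
      using lam k n rat [of k] by (auto simp: PP_wt_def PP_def wt_inject)
  qed
  then have "BB scl act v (wt j d) n = (\<lambda>lam. cvec scl act v (n, k, lam)) ` partitions_of d"
    by (simp add: BB_def image_image)
  also have "\<dots> = V.c_vec (int m) (2 * m - k) ` partitions_of d"
  proof (rule image_cong [OF refl])
    fix lam assume "lam \<in> partitions_of d"
    then have lam: "is_partition lam" "psize lam = d" by (auto simp: partitions_of_def)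
    show "cvec scl act v (n, k, lam) = V.c_vec (int m) (2 * m - k) lam"
      unfolding n using lam part_le_psize [of lam 0] psupp_le_psize [of lam] k
      by (intro cvec_eq_c_vec) auto
  qed
  finally show "BB scl act v (wt j d) n
      = V.c_vec (int (n div 2)) (nat (int (n div 2) - j)) ` partitions_of d"
    by (simp add: n k(3))
  show "d \<le> nat (int (n div 2) - j)" using k by (simp add: n)
qed

lemma BB_basis:
  assumes "even n" "2 * (int d + \<bar>j\<bar>) \<le> int n"
  shows "is_basis scl (BB scl act v (wt j d) n) (weight_space scl act (wt j d))"
proof -
  define r where "r = nat (int (n div 2) - j)"
  note BB = BB_eq [OF assms, folded r_def]
  have "n div 2 * 2 = n" using assms(1) by simp
  then have "int (n div 2) - int r = j" using assms(2) by (auto simp: r_def)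
  then show ?thesis
    using V.c_vec_basis [OF BB(2), of "int (n div 2)"] by (simp add: is_basis_def BB(1) weight_space_wt)
qed

text \<open>Raising n by 2 with j fixed raises both m = n/2 and r = m - j by one.\<close>

lemma c_vec_add:
  assumes "lam \<in> partitions_of d" "d \<le> r"
  shows "V.c_vec (m + int t) (r + t) lam = V.c_vec m r lam"
proof (induction t)
  case (Suc t)
  then show ?case
    using V.c_vec_stable [OF assms(1), of "r + t" "m + int t"] assms(2)
    by (simp add: add.left_commute add.commute)
qed simp

lemma BB_independent_of_n:
  assumes "even n" "2 * (int d + \<bar>j\<bar>) \<le> int n"
  shows "BB scl act v (wt j d) n = BB scl act v (wt j d) (2 * (d + nat \<bar>j\<bar>))"
proof -
  define n0 where "n0 = 2 * (d + nat \<bar>j\<bar>)"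
  define r0 where "r0 = nat (int (n0 div 2) - j)"
  define t where "t = n div 2 - n0 div 2"
  have n0: "even n0" "2 * (int d + \<bar>j\<bar>) \<le> int n0" by (auto simp: n0_def)
  have "n0 \<le> n" using assms(2) by (simp add: n0_def)
  then have t: "int (n div 2) = int (n0 div 2) + int t" by (simp add: t_def div_le_mono)
  moreover have "j \<le> int (n0 div 2)" by (simp add: n0_def)
  ultimately have r: "nat (int (n div 2) - j) = r0 + t" by (simp add: r0_def)
  have "d \<le> r0" using BB_eq(2) [OF n0] by (simp add: r0_def)
  then show ?thesis
    unfolding n0_def [symmetric] BB_eq(1) [OF assms] BB_eq(1) [OF n0] r
    unfolding t r0_def [symmetric] by (intro image_cong refl c_vec_add)
qed

lemma union_BB_basis:
  assumes N: "\<And>j d. even (N (wt j d)) \<and> 2 * (int d + \<bar>j\<bar>) \<le> int (N (wt j d))"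
  shows "disjoint_family_on (\<lambda>\<mu>. BB scl act v \<mu> (N \<mu>)) (weights scl act)"
    and "is_basis scl (\<Union>\<mu>\<in>weights scl act. BB scl act v \<mu> (N \<mu>)) UNIV"
proof -
  define B where "B j d = BB scl act v (wt j d) (N (wt j d))" for j d
  define U where "U = (\<Union>\<mu>\<in>weights scl act. BB scl act v \<mu> (N \<mu>))"
  have B: "independent (B j d)" "span (B j d) = V.wspace j d" for j d
    using BB_basis [of "N (wt j d)" d j] N by (auto simp: B_def is_basis_def weight_space_wt)
  have eig: "act (loop sl2_h 0) b = scl (of_int (2 * j)) b"
    "act deriv_d b = scl (of_int (- (j ^ 2) - int d)) b" "b \<noteq> 0" if "b \<in> B j d" for b j d
    using that B [of j d] span_base [of b "B j d"] dependent_zero [of "B j d"]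
    by (auto simp: V.wspace_def)
  have uniq: "j = j' \<and> d = d'" if "b \<in> B j d" "b \<in> B j' d'" for b j d j' d'
  proof -
    have "(of_int (2 * j) :: complex) = of_int (2 * j')"
      using eig(1,3) [OF that(1)] eig(1) [OF that(2)] by (metis scale_right_imp_eq)
    then have j: "j = j'" unfolding of_int_eq_iff by simp
    have "(of_int (- (j ^ 2) - int d) :: complex) = of_int (- (j' ^ 2) - int d')"
      using eig(2,3) [OF that(1)] eig(2) [OF that(2)] by (metis scale_right_imp_eq)
    then show ?thesis using j unfolding of_int_eq_iff by simp
  qed
  show "disjoint_family_on (\<lambda>\<mu>. BB scl act v \<mu> (N \<mu>)) (weights scl act)"
    unfolding disjoint_family_on_def
  proof (intro ballI impI)
    fix \<mu> \<nu> assume \<mu>\<nu>: "\<mu> \<in> weights scl act" "\<nu> \<in> weights scl act" "\<mu> \<noteq> \<nu>"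
    obtain j d where \<mu>: "\<mu> = wt j d" using weights_are_wt [OF \<mu>\<nu>(1)] by blast
    obtain j' d' where \<nu>: "\<nu> = wt j' d'" using weights_are_wt [OF \<mu>\<nu>(2)] by blast
    have "\<not> (j = j' \<and> d = d')" using \<mu>\<nu>(3) \<mu> \<nu> by blast
    then have "B j d \<inter> B j' d' = {}" using uniq by blast
    then show "BB scl act v \<mu> (N \<mu>) \<inter> BB scl act v \<nu> (N \<nu>) = {}"
      by (simp only: \<mu> \<nu> B_def)
  qed
  have U: "\<exists>j d. wt j d \<in> weights scl act \<and> b \<in> B j d" if "b \<in> U" for b
    using that weights_are_wt unfolding U_def B_def by blast
  then obtain jj dd where jd: "\<And>b. b \<in> U \<Longrightarrow> b \<in> B (jj b) (dd b)" by metis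
  have "independent U"
  proof
    assume "dependent U"
    then obtain a where a: "a \<in> U" "a \<in> span (U - {a})" by (auto simp: dependent_def)
    define j d where "j = jj a" and "d = dd a"
    have aB: "a \<in> B j d" using jd [OF a(1)] by (simp add: j_def d_def)
    \<comment> \<open>Two passes, first by the eigenvalue of h and then by that of d, confine the
      dependency to the weight space of \<open>a\<close>.\<close>
    have "a \<in> span {b \<in> U - {a}. of_int (2 * jj b) = (of_int (2 * j) :: complex)}"
      by (rule eigenvectors_span [OF V.hom_H _ a(2) eig(1) [OF aB]]) (use eig(1) jd in blast)
    then have "a \<in> span {b \<in> {b \<in> U - {a}. of_int (2 * jj b) = (of_int (2 * j) :: complex)}.
        of_int (- (jj b ^ 2) - int (dd b)) = (of_int (- (j ^ 2) - int d) :: complex)}"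
      by (rule eigenvectors_span [OF V.hom_D, rotated]) (use eig(2) jd aB in blast)+
    moreover have "{b \<in> {b \<in> U - {a}. of_int (2 * jj b) = (of_int (2 * j) :: complex)}.
        of_int (- (jj b ^ 2) - int (dd b)) = (of_int (- (j ^ 2) - int d) :: complex)} \<subseteq> B j d - {a}"
    proof
      fix b assume b: "b \<in> {b \<in> {b \<in> U - {a}. of_int (2 * jj b) = (of_int (2 * j) :: complex)}.
        of_int (- (jj b ^ 2) - int (dd b)) = (of_int (- (j ^ 2) - int d) :: complex)}"
      then have "jj b = j" "b \<in> U" "b \<noteq> a" by (simp_all only: mem_Collect_eq of_int_eq_iff) auto
      moreover from this b have "dd b = d" by (simp only: mem_Collect_eq of_int_eq_iff) simp
      ultimately show "b \<in> B j d - {a}" using jd [of b] by simp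
    qed
    ultimately have "a \<in> span (B j d - {a})" using span_mono by blast
    then show False using B(1) [of j d] aB by (auto simp: dependent_def)
  qed
  moreover have "span U = UNIV"
  proof -
    have w: "V.wspace j d \<subseteq> span U" for j d
    proof (cases "wt j d \<in> weights scl act")
      case True
      then have "B j d \<subseteq> U" by (auto simp: U_def B_def)
      then show ?thesis using span_mono B(2) by blast
    next
      case False
      then have "V.wspace j d = {0}" by (simp add: weights_def weight_space_wt)
      then show ?thesis by (simp add: span_zero)
    qed
    \<comment> \<open>The Heisenberg monomials are weight vectors spanning the module, so it
      suffices that \<open>span U\<close> contains every weight space.\<close>
    have "V.H_mon ls (V.extremal_vec j) \<in> V.wspace j (sum_list (map Suc ls))" for ls j
      using V.H0_H_mon [of ls "V.extremal_vec j"] V.H0_extremal_vec [of j]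
        V.D_H_mon [OF V.D_extremal_vec, of ls j] by (simp add: V.wspace_def)
    then have "range (\<lambda>(j, ls). V.H_mon ls (V.extremal_vec j)) \<subseteq> span U"
      by (auto intro: subsetD [OF w])
    then show ?thesis using V.span_H_mon span_minimal [OF _ subspace_span] by blast
  qed
  ultimately show "is_basis scl (\<Union>\<mu>\<in>weights scl act. BB scl act v \<mu> (N \<mu>)) UNIV"
    by (simp add: is_basis_def U_def)
qed

end

theorem mainTheorem2:
  fixes scl :: "complex \<Rightarrow> 'v::ab_group_add \<Rightarrow> 'v"
    and act :: "affine \<Rightarrow> 'v \<Rightarrow> 'v"
    and v :: 'v
  assumes "irreducible_highest_weight_module scl act Lambda0 v"
  shows "(\<forall>j d n n'. even n \<and> 2 * (int d + \<bar>j\<bar>) \<le> int n \<longrightarrow>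
            even n' \<and> 2 * (int d + \<bar>j\<bar>) \<le> int n' \<longrightarrow>
            BB scl act v (wt j d) n = BB scl act v (wt j d) n')
    \<and> (\<forall>j d n. even n \<and> 2 * (int d + \<bar>j\<bar>) \<le> int n \<longrightarrow>
            is_basis scl (BB scl act v (wt j d) n) (weight_space scl act (wt j d)))
    \<and> (\<forall>N :: weight \<Rightarrow> nat.
          (\<forall>j d. even (N (wt j d)) \<and> 2 * (int d + \<bar>j\<bar>) \<le> int (N (wt j d))) \<longrightarrow>
            disjoint_family_on (\<lambda>\<mu>. BB scl act v \<mu> (N \<mu>)) (weights scl act)
            \<and> is_basis scl (\<Union>\<mu>\<in>weights scl act. BB scl act v \<mu> (N \<mu>)) UNIV)"
proof -
  interpret basic_representation scl act v
    using assms by (rule basic_representation.intro)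
  show ?thesis
  proof (intro conjI allI impI)
    fix j d n n'
    assume n: "even n \<and> 2 * (int d + \<bar>j\<bar>) \<le> int n" and n': "even n' \<and> 2 * (int d + \<bar>j\<bar>) \<le> int n'"
    show "BB scl act v (wt j d) n = BB scl act v (wt j d) n'"
      using BB_independent_of_n [of n d j] BB_independent_of_n [of n' d j] n n' by simp
  next
    fix j d n
    assume "even n \<and> 2 * (int d + \<bar>j\<bar>) \<le> int n"
    then show "is_basis scl (BB scl act v (wt j d) n) (weight_space scl act (wt j d))"
      by (intro BB_basis) auto
  next
    fix N :: "weight \<Rightarrow> nat"
    assume N: "\<forall>j d. even (N (wt j d)) \<and> 2 * (int d + \<bar>j\<bar>) \<le> int (N (wt j d))"
    show "disjoint_family_on (\<lambda>\<mu>. BB scl act v \<mu> (N \<mu>)) (weights scl act)"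
      by (rule union_BB_basis(1)) (use N in blast)
    show "is_basis scl (\<Union>\<mu>\<in>weights scl act. BB scl act v \<mu> (N \<mu>)) UNIV"
      by (rule union_BB_basis(2)) (use N in blast)
  qed
qed

end
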